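(* For every integer $k\ge 2$, $$f_k=\frac1k\sum_{\operatorname{wt}(\lambda)=k+1}\frac{(-k)^{\ell(\lambda)-1}}{\varkappa!}\,p_\lambda+\dots,$$ where the sum is over all partitions $\lambda=1^{\varkappa_1}2^{\varkappa_2}3^{\varkappa_3}\cdots$ of weight $\operatorname{wt}(\lambda)=k+1$, $\varkappa!=\prod_i\varkappa_i!$, and the dots stand for terms of lower weight, i.e. a linear combination of $p_\eta$ with $\operatorname{wt}(\eta)<k+1$.
   Context: For a partition $\lambda=(\lambda_1\ge\lambda_2\ge\dots)$ (with $\lambda_i=0$ for large $i$) and $k\ge1$ put $$p_k(\lambda)=\sum_{i=1}^\infty\left[(\lambda_i-i+\tfrac12)^k-(-i+\tfrac12)^k\right]+(1-2^{-k})\zeta(-k),$$ where $\zeta$ is the Riemann zeta function. $\Lambda^*$ is the algebra of shifted symmetric functions, i.e. the algebra of functions on partitions which is the polynomial algebra in the algebraically independent generators $p_1,p_2,\dots$. For a partition $\eta=(\eta_1,\dots,\eta_\ell)$ with parts $\ge1$, $p_\eta=\prod_i p_{\eta_i}$, $\ell(\eta)=\ell$ is the number of parts, $|\eta|=\sum\eta_i$, and the weight is $\operatorname{wt}(\eta)=|\eta|+\ell(\eta)$. The notation $\lambda=1^{\varkappa_1}2^{\varkappa_2}\cdots$ means that $\lambda$ has $\varkappa_j$ parts equal to $j$. For $k\ge2$ let $f_k$ be the function on partitions $f_k(\lambda)=|C|\,\chi^\lambda(C)/\dim\lambda$, where $C$ is the conjugacy class in $S(|\lambda|)$ of a $k$-cycle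 (all other points fixed), $\chi^\lambda$ is the irreducible character of $S(|\lambda|)$ corresponding to $\lambda$, and $\dim\lambda=\chi^\lambda(1)$; $f_k(\lambda)=0$ if $|\lambda|<k$. It is known that $f_k\in\Lambda^*$. *)

theory Defs
  imports
    "HOL-Analysis.Analysis"
    "HOL-Combinatorics.Combinatorics"
    "HOL-Library.Function_Algebras"
begin

section \<open>Partitions\<close>

text \<open>A partition is the weakly decreasing list of its non-zero parts.\<close>

definition is_partition :: "nat list \<Rightarrow> bool" where
  "is_partition \<mu> \<longleftrightarrow> sorted_wrt (\<ge>) \<mu> \<and> (\<forall>a\<in>set \<mu>. a \<ge> 1)"

text \<open>The part \<open>\<mu>\<^sub>i\<close> with \<open>i\<close> counted from 1; it is 0 beyond the length of the list.\<close>

definition part :: "nat list \<Rightarrow> nat \<Rightarrow> nat" where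
  "part \<mu> i = (if 1 \<le> i \<and> i \<le> length \<mu> then \<mu> ! (i - 1) else 0)"

definition weight :: "nat list \<Rightarrow> nat" where
  "weight \<eta> = sum_list \<eta> + length \<eta>"

text \<open>\<open>\<kappa>!\<close> for \<open>\<mu> = 1\<^bsup>\<kappa>\<^sub>1\<^esup> 2\<^bsup>\<kappa>\<^sub>2\<^esup> \<dots>\<close>; sizes that do not occur contribute \<open>0! = 1\<close>.\<close>

definition mult_fact :: "nat list \<Rightarrow> nat" where
  "mult_fact \<mu> = (\<Prod>j\<in>set \<mu>. fact (count_list \<mu> j))"


section \<open>Shifted power sums\<close>

text \<open>The Riemann zeta function as the analytic continuation of its Dirichlet series. Its value
  is determined by this for every \<open>s \<noteq> 1\<close>; the value at the pole is irrelevant.\<close>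

definition riemann_zeta :: "complex \<Rightarrow> complex" where
  "riemann_zeta = (SOME f. f holomorphic_on (- {1}) \<and>
     (\<forall>s. Re s > 1 \<longrightarrow> f s = (\<Sum>n. 1 / of_nat (Suc n) powr s)))"

text \<open>The series over \<open>i \<ge> 1\<close> is indexed by \<open>m = i - 1\<close>; almost all of its terms vanish.\<close>

definition p_fun :: "nat \<Rightarrow> nat list \<Rightarrow> complex" where
  "p_fun k \<mu> =
     (\<Sum>m. let i = Suc m in
        (of_nat (part \<mu> i) - of_nat i + 1/2) ^ k - (- of_nat i + 1/2) ^ k)
     + (1 - 1 / 2 ^ k) * riemann_zeta (- of_nat k)"

definition p_prod :: "nat list \<Rightarrow> nat list \<Rightarrow> complex" where
  "p_prod \<eta> \<mu> = (\<Prod>k\<leftarrow>\<eta>. p_fun k \<mu>)"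


section \<open>Irreducible characters of the symmetric groups\<close>

text \<open>The symmetric group \<open>S(n)\<close> consists of the permutations of \<open>{..<n}\<close>. Elements of its
  complex group algebra are functions \<open>x\<close>, where \<open>x g\<close> is the coefficient of the basis
  element \<open>g\<close>; they vanish outside \<open>S(n)\<close>.\<close>

definition sym_grp :: "nat \<Rightarrow> (nat \<Rightarrow> nat) set" where
  "sym_grp n = {g. g permutes {..<n}}"

type_synonym grp_alg = "(nat \<Rightarrow> nat) \<Rightarrow> complex"

definition grp_alg_scale :: "complex \<Rightarrow> grp_alg \<Rightarrow> grp_alg" where
  "grp_alg_scale c x = (\<lambda>g. c * x g)"

interpretation grp_alg: vector_space grp_alg_scale
  by unfold_locales (auto simp: grp_alg_scale_def algebra_simps)

definition grp_alg_carrier :: "nat \<Rightarrow> grp_alg set" where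
  "grp_alg_carrier n = {x. \<forall>g. g \<notin> sym_grp n \<longrightarrow> x g = 0}"

definition grp_alg_mult :: "nat \<Rightarrow> grp_alg \<Rightarrow> grp_alg \<Rightarrow> grp_alg" where
  "grp_alg_mult n x y = (\<lambda>g. \<Sum>(h, h') | h \<in> sym_grp n \<and> h' \<in> sym_grp n \<and> h \<circ> h' = g. x h * y h')"

definition grp_alg_single :: "(nat \<Rightarrow> nat) \<Rightarrow> grp_alg" where
  "grp_alg_single g = (\<lambda>h. if h = g then 1 else 0)"

text \<open>The trace of a linear operator \<open>T\<close> on an invariant finite-dimensional subspace \<open>V\<close>:
  the sum of the diagonal entries of its matrix with respect to any basis of \<open>V\<close>.\<close>

definition grp_alg_trace :: "grp_alg set \<Rightarrow> (grp_alg \<Rightarrow> grp_alg) \<Rightarrow> complex" where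
  "grp_alg_trace V T =
     (let B = (SOME B. B \<subseteq> V \<and> grp_alg.independent B \<and> V \<subseteq> grp_alg.span B)
      in \<Sum>b\<in>B. grp_alg.representation B (T b) b)"

text \<open>Boxes are pairs (row, column), counted from 0. The standard tableau used below is filled
  with \<open>0, 1, 2, \<dots>\<close> row by row.\<close>

definition diagram :: "nat list \<Rightarrow> (nat \<times> nat) set" where
  "diagram \<mu> = {(i, j). i < length \<mu> \<and> j < \<mu> ! i}"

definition tableau_entry :: "nat list \<Rightarrow> nat \<Rightarrow> nat \<Rightarrow> nat" where
  "tableau_entry \<mu> i j = sum_list (take i \<mu>) + j"

definition row_group :: "nat list \<Rightarrow> (nat \<Rightarrow> nat) set" where
  "row_group \<mu> = {g \<in> sym_grp (sum_list \<mu>). \<forall>(i, j)\<in>diagram \<mu>.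
     \<exists>j'. (i, j') \<in> diagram \<mu> \<and> g (tableau_entry \<mu> i j) = tableau_entry \<mu> i j'}"

definition col_group :: "nat list \<Rightarrow> (nat \<Rightarrow> nat) set" where
  "col_group \<mu> = {g \<in> sym_grp (sum_list \<mu>). \<forall>(i, j)\<in>diagram \<mu>.
     \<exists>i'. (i', j) \<in> diagram \<mu> \<and> g (tableau_entry \<mu> i j) = tableau_entry \<mu> i' j}"

definition young_symmetrizer :: "nat list \<Rightarrow> grp_alg" where
  "young_symmetrizer \<mu> =
     (\<Sum>p\<in>row_group \<mu>. \<Sum>q\<in>col_group \<mu>. grp_alg_scale (of_int (sign q)) (grp_alg_single (p \<circ> q)))"

text \<open>The irreducible representation of \<open>S(|\<mu>|)\<close> corresponding to \<open>\<mu>\<close>: the left ideal generated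
  by the Young symmetrizer, on which the group acts by left multiplication. With this convention
  the one-row partition gives the trivial representation.\<close>

definition irrep :: "nat list \<Rightarrow> grp_alg set" where
  "irrep \<mu> = (\<lambda>x. grp_alg_mult (sum_list \<mu>) x (young_symmetrizer \<mu>)) ` grp_alg_carrier (sum_list \<mu>)"

definition irr_char :: "nat list \<Rightarrow> (nat \<Rightarrow> nat) \<Rightarrow> complex" where
  "irr_char \<mu> g = grp_alg_trace (irrep \<mu>) (grp_alg_mult (sum_list \<mu>) (grp_alg_single g))"


section \<open>Normalised characters of cycles\<close>

definition conj_class :: "nat \<Rightarrow> (nat \<Rightarrow> nat) \<Rightarrow> (nat \<Rightarrow> nat) set" where
  "conj_class n c = {g \<circ> c \<circ> inv g | g. g \<in> sym_grp n}"

text \<open>The class of \<open>k\<close>-cycles is represented by \<open>(0 1 \<dots> k-1)\<close>.\<close>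

definition f_fun :: "nat \<Rightarrow> nat list \<Rightarrow> complex" where
  "f_fun k \<mu> =
     (let n = sum_list \<mu>; c = cycle_of_list [0..<k] in
      if n < k then 0
      else of_nat (card (conj_class n c)) * irr_char \<mu> c / irr_char \<mu> id)"


text \<open>The sums over partitions of given or bounded weight are finite.\<close>

lemma finite_partitions_weight_le: "finite {\<eta>. is_partition \<eta> \<and> weight \<eta> \<le> w}"
proof (rule finite_subset)
  show "{\<eta>. is_partition \<eta> \<and> weight \<eta> \<le> w} \<subseteq> {\<eta>. set \<eta> \<subseteq> {..w} \<and> length \<eta> \<le> w}"
    by (auto simp: weight_def dest: member_le_sum_list)
  show "finite {\<eta>. set \<eta> \<subseteq> {..w} \<and> length \<eta> \<le> w}"
    by (rule finite_lists_length_le) simp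
qed

end

theory Submission
  imports Defs
begin

text \<open>
  Let \<open>\<phi>(g)\<close> be the coefficients of the Young symmetrizer. Since every element \<open>x\<close> with
  \<open>p x q = sgn(q) x\<close> for row and column permutations \<open>p, q\<close> is a multiple of it, a class sum acts on
  the irreducible representation by the scalar \<open>\<Sum> \<phi>(h)\<close> over the class; taking traces,
  \<open>f\<^sub>k(\<mu>)\<close> is this scalar for the class of \<open>k\<close>-cycles.

  To compute it, let \<open>D = \<Sum>\<^sub>g \<phi>(g) a\<^sub>\<delta> p\<^sub>g\<close>, where \<open>p\<^sub>g\<close> is the product of power sums of the
  cycle type of \<open>g\<close>. The sum of all transpositions acts by the content sum and at the same time by
  a quadratic function of the exponents; together with the dominance order this forces \<open>D\<close> to be a
  multiple of the alternant \<open>a\<^bsub>\<mu>+\<delta>\<^esub>\<close>. Applying the adjoints of multiplication by \<open>p\<^sub>1\<close> and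
  \<open>p\<^sub>k\<close> to both sides extracts the identity and the \<open>k\<close>-cycles and gives Frobenius' formula for
  \<open>f\<^sub>k\<close> as a sum of residues. By partial fractions this sum is a coefficient of the product of a
  fixed series and \<open>\<Prod> (1 - (\<mu>\<^sub>i - i + 1/2 + h) t) / (1 - (\<mu>\<^sub>i - i + 1/2 - h) t)\<close>, normalised by its
  value at the empty partition, with \<open>h = k/2\<close>. The logarithm of the latter is
  \<open>-k \<Sum> p\<^sub>i t^(i+1)\<close> up to terms of lower weight, and exponentiating gives the leading terms.
\<close>

unbundle no vec_syntax
unbundle fps_syntax

section \<open>Partial fractions of formal power series\<close>

text \<open>Polynomials in \<open>N\<close> variables occur only through their coefficient functions
  on integer exponent vectors. Multiplication by a power sum evaluates such a function at vectors
  with one entry lowered, its adjoint at vectors with one entry raised, and p_g becomes a count of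
  words constant on the cycles of g. Two obstacles shape the proof. The adjoint of p_k acts on
  a_delta p_g as k d/dp_k as long as the degree is at most \<open>N\<close>; with raised and lowered
  entries this hinges on what happens at small exponents. And the content sum alone does not
  determine a partition: it does so here because the exponents of D are dominated by mu + delta, and
  among dominated vectors equality of the sums of squares forces equality. The factor between D and
  the alternant is never computed. Extracting the identity and extracting the k-cycles both involve
  it linearly, so it cancels from their ratio. The zeta constants in p_i have weight 0 and disappear
  among the lower terms. Centring the residue sum at the numbers mu_i - i + 1/2 is what removes
  \<open>N\<close> from the final coefficient.\<close>

definition lin :: "complex \<Rightarrow> complex fps" where
  "lin a = 1 - fps_const a * fps_X"

definition geo :: "complex \<Rightarrow> complex fps" where
  "geo a = Abs_fps (\<lambda>m. a ^ m)"

lemma geo_nth [simp]: "geo a $ m = a ^ m"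
  by (simp add: geo_def)

lemma lin_nth_0 [simp]: "lin a $ 0 = 1"
  by (simp add: lin_def)

lemma lin_mult_nth_Suc: "(lin a * f) $ Suc m = f $ Suc m - a * f $ m"
  by (simp add: lin_def left_diff_distrib mult.assoc)

lemma lin_mult_geo [simp]: "lin a * geo a = 1"
proof (rule fps_ext)
  fix m show "(lin a * geo a) $ m = 1 $ m"
    by (cases m) (simp_all add: lin_mult_nth_Suc fps_mult_nth_0)
qed

lemma geo_mult_lin [simp]: "geo a * lin a = 1"
  by (subst mult.commute) simp

lemma lin_diff: "lin x - lin a = fps_const (a - x) * fps_X"
  by (simp add: lin_def algebra_simps flip: fps_const_sub)

text \<open>Multiplying the difference of the two sides by \<open>lin x\<close> gives the same
  constant \<open>c\<close>, the sum of the weights, for every \<open>x\<close> in \<open>A\<close>.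
  Two distinct choices of \<open>x\<close> force the difference to vanish, so \<open>c\<close> need
  not be evaluated.\<close>

lemma partial_fractions:
  assumes "finite A" "A \<noteq> {}"
  shows "(\<Sum>a\<in>A. fps_const (inverse (\<Prod>b\<in>A-{a}. a - b)) * geo a)
    = fps_X ^ (card A - 1) * (\<Prod>a\<in>A. geo a)"
  using assms
proof (induction "card A" arbitrary: A rule: less_induct)
  case less
  define w where "w A a = inverse (\<Prod>b\<in>A-{a}. a - b)" for A and a :: complex
  define S where "S A = (\<Sum>a\<in>A. fps_const (w A a) * geo a)" for A
  define T where "T = fps_X ^ (card A - 1) * (\<Prod>a\<in>A. geo a)"
  define c where "c = (\<Sum>a\<in>A. fps_const (w A a))"
  note fin = \<open>finite A\<close>
  have "S A = T"
  proof (cases "card A = 1")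
    case True
    then obtain a where "A = {a}" by (auto simp: card_1_singleton_iff)
    then show ?thesis by (simp add: S_def T_def w_def)
  next
    case False
    then have c2: "card A \<ge> 2" using less.prems by (cases "card A") auto
    \<comment> \<open>The product \<open>lin x * geo a\<close> is 1 plus \<open>a - x\<close> times
      X \<open>geo a\<close>. The factor \<open>a - x\<close> removes \<open>x\<close> from the
      weight of \<open>a\<close>, which leaves the sum for \<open>A - {x}\<close>.\<close>
    have step: "lin x * (S A - T) = c" if x: "x \<in> A" for x
    proof -
      have "A - {x} \<noteq> {}" using c2 x fin
        by (metis card.empty card_Diff_singleton diff_is_0_eq not_less_eq_eq numeral_2_eq_2 One_nat_def)
      moreover have "card (A - {x}) < card A" using fin x by (rule card_Diff1_less)
      ultimately have IH: "S (A - {x}) = fps_X ^ (card A - 2) * (\<Prod>a\<in>A-{x}. geo a)"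
        using less.hyps[of "A - {x}"] fin x by (simp add: S_def w_def numeral_2_eq_2)
      have "lin x * S A - c = (\<Sum>a\<in>A. fps_const (w A a) * (lin x * geo a) - fps_const (w A a))"
        unfolding S_def c_def by (simp add: sum_distrib_left sum_subtractf mult_ac)
      also have "\<dots> = (\<Sum>a\<in>A. fps_const (w A a * (a - x)) * (fps_X * geo a))"
      proof (rule sum.cong[OF refl])
        fix a
        have "lin x * geo a = 1 + fps_const (a - x) * fps_X * geo a"
          using lin_diff[of x a] lin_mult_geo[of a]
          by (metis add.commute diff_add_cancel distrib_right)
        then have "fps_const (w A a) * (lin x * geo a) - fps_const (w A a)
            = fps_const (w A a) * fps_const (a - x) * (fps_X * geo a)"
          by (simp add: distrib_left mult.assoc del: fps_const_mult)
        then show "fps_const (w A a) * (lin x * geo a) - fps_const (w A a)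
            = fps_const (w A a * (a - x)) * (fps_X * geo a)"
          by simp
      qed
      also have "\<dots> = (\<Sum>a\<in>A-{x}. fps_const (w A a * (a - x)) * (fps_X * geo a))"
        using fin by (intro sum.mono_neutral_right) auto
      also have "\<dots> = (\<Sum>a\<in>A-{x}. fps_X * (fps_const (w (A-{x}) a) * geo a))"
      proof (rule sum.cong[OF refl])
        fix a assume a: "a \<in> A - {x}"
        have "A - {a} = insert x (A - {x} - {a})" using a x by auto
        then have "(\<Prod>b\<in>A-{a}. a - b) = (a - x) * (\<Prod>b\<in>A-{x}-{a}. a - b)"
          using fin by simp
        then have "w A a * (a - x) = w (A - {x}) a"
          using a by (simp add: w_def)
        then show "fps_const (w A a * (a - x)) * (fps_X * geo a)
          = fps_X * (fps_const (w (A-{x}) a) * geo a)" by (simp add: mult_ac)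
      qed
      also have "\<dots> = fps_X * S (A - {x})"
        by (simp add: S_def sum_distrib_left)
      also have "\<dots> = fps_X ^ (card A - 1) * (\<Prod>a\<in>A-{x}. geo a)"
        using c2 by (simp add: IH Suc_diff_le numeral_2_eq_2 flip: mult.assoc power_Suc)
          (use c2 in arith)
      also have "\<dots> = lin x * T"
        using fin x by (simp add: T_def prod.remove[of A x] flip: mult.assoc)
      finally show ?thesis by (simp add: right_diff_distrib algebra_simps)
    qed
    obtain x y where xy: "x \<in> A" "y \<in> A" "x \<noteq> y"
      using c2 by (metis card_le_Suc0_iff_eq fin not_less_eq_eq numeral_2_eq_2)
    have "(lin x - lin y) * (S A - T) = 0"
      using step[OF xy(1)] step[OF xy(2)] by (simp add: left_diff_distrib)
    then have "fps_const (y - x) = 0 \<or> S A - T = 0"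
      by (simp add: lin_diff)
    then show ?thesis using xy by (simp add: fps_const_eq_0_iff)
  qed
  then show ?case by (simp add: S_def T_def w_def)
qed

text \<open>A factor \<open>a - r\<close> in the weight turns \<open>a ^ m\<close> into
  \<open>a ^ (m + 1) - r * a ^ m\<close>, which is multiplication of the series by
  \<open>lin r\<close>, read one coefficient higher.\<close>

lemma weighted_geo_nth:
  assumes "finite I"
  shows "(\<Sum>a\<in>A. fps_const (w a * (\<Prod>i\<in>I. a - r i)) * geo a) $ m
    = ((\<Prod>i\<in>I. lin (r i)) * (\<Sum>a\<in>A. fps_const (w a) * geo a)) $ (m + card I)"
  using assms
proof (induction I arbitrary: m rule: finite_induct)
  case (insert x I)
  have "(\<Sum>a\<in>A. fps_const (w a * (\<Prod>i\<in>insert x I. a - r i)) * geo a) $ m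
    = (\<Sum>a\<in>A. fps_const (w a * (\<Prod>i\<in>I. a - r i)) * geo a) $ Suc m
      - r x * (\<Sum>a\<in>A. fps_const (w a * (\<Prod>i\<in>I. a - r i)) * geo a) $ m"
    using insert.hyps
    by (simp add: fps_sum_nth sum_distrib_left algebra_simps flip: sum_subtractf)
  then show ?case
    using insert.hyps by (simp only: insert.IH) (simp add: mult.assoc lin_mult_nth_Suc)
qed simp

text \<open>The residues at the points of \<open>A\<close> against the expansion at infinity.
  Including \<open>b = a\<close> in the product of the \<open>a - (b + k)\<close> supplies the
  factor \<open>- k\<close>; the power \<open>card A - 1\<close> of X in
  \<open>partial_fractions\<close> lowers the index \<open>K + card A\<close> to
  \<open>K + 1\<close>.\<close>

lemma residue_sum:
  fixes A :: "complex set"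
  assumes "finite A" "A \<noteq> {}"
  shows "- k * (\<Sum>a\<in>A. (\<Prod>s<K. a - c s) * (\<Prod>b\<in>A-{a}. (a - b - k) / (a - b)))
    = ((\<Prod>s<K. lin (c s)) * (\<Prod>a\<in>A. lin (a + k) * geo a)) $ (K + 1)"
proof -
  define w where "w a = inverse (\<Prod>b\<in>A-{a}. a - b)" for a
  define I where "I = {..<K} <+> A"
  define r where "r = case_sum c (\<lambda>b. b + k)"
  have "- k * (\<Sum>a\<in>A. (\<Prod>s<K. a - c s) * (\<Prod>b\<in>A-{a}. (a - b - k) / (a - b)))
      = (\<Sum>a\<in>A. fps_const (w a * (\<Prod>b\<in>A. a - (b + k)) * (\<Prod>s<K. a - c s)) * geo a) $ 0"
    unfolding fps_sum_nth sum_distrib_left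
  proof (rule sum.cong[OF refl])
    fix a assume a: "a \<in> A"
    have "(\<Prod>b\<in>A. a - (b + k)) = - k * (\<Prod>b\<in>A-{a}. a - b - k)"
      using assms a by (simp add: prod.remove diff_diff_eq)
    then show "- k * ((\<Prod>s<K. a - c s) * (\<Prod>b\<in>A-{a}. (a - b - k) / (a - b)))
      = (fps_const (w a * (\<Prod>b\<in>A. a - (b + k)) * (\<Prod>s<K. a - c s)) * geo a) $ 0"
      by (simp add: w_def prod_dividef) (simp add: field_simps)
  qed
  also have "\<dots> = (\<Sum>a\<in>A. fps_const (w a * (\<Prod>i\<in>I. a - r i)) * geo a) $ 0"
    using assms by (simp add: I_def r_def prod.Plus mult_ac)
  also have "\<dots> = ((\<Prod>i\<in>I. lin (r i)) * (\<Sum>a\<in>A. fps_const (w a) * geo a)) $ (card I)"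
    using assms by (subst weighted_geo_nth) (auto simp: I_def)
  also have "\<dots> = ((\<Prod>s<K. lin (c s)) * (\<Prod>a\<in>A. lin (a + k)) * (\<Sum>a\<in>A. fps_const (w a) * geo a)) $ (K + card A)"
    using assms by (simp add: I_def r_def prod.Plus card_Plus)
  also have "\<dots> = ((\<Prod>s<K. lin (c s)) * (\<Prod>a\<in>A. lin (a + k) * geo a)) $ (K + 1)"
  proof -
    have "card A > 0" using assms by (simp add: card_gt_0_iff)
    have "(\<Sum>a\<in>A. fps_const (w a) * geo a) = fps_X ^ (card A - 1) * (\<Prod>a\<in>A. geo a)"
      unfolding w_def by (rule partial_fractions[OF assms])
    then have "(\<Prod>s<K. lin (c s)) * (\<Prod>a\<in>A. lin (a + k)) * (\<Sum>a\<in>A. fps_const (w a) * geo a)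
       = fps_X ^ (card A - 1) * ((\<Prod>s<K. lin (c s)) * (\<Prod>a\<in>A. lin (a + k) * geo a))"
      by (simp add: prod.distrib mult_ac)
    then show ?thesis using \<open>card A > 0\<close>
      by (simp only: fps_X_power_mult_nth) (simp add: Suc_diff_le)
  qed
  finally show ?thesis .
qed

section \<open>The weight filtration\<close>

text \<open>The bound is strict because it describes error terms: a function of weight at most
  \<open>v\<close> is \<open>lower_weight (Suc v)\<close>.\<close>

definition lower_weight :: "nat \<Rightarrow> (nat list \<Rightarrow> complex) \<Rightarrow> bool" where
  "lower_weight w f \<longleftrightarrow> (\<exists>c. \<forall>\<mu>. is_partition \<mu> \<longrightarrow>
     f \<mu> = (\<Sum>\<eta> | is_partition \<eta> \<and> weight \<eta> < w. c \<eta> * p_prod \<eta> \<mu>))"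

lemma finite_partitions_weight_less: "finite {\<eta>. is_partition \<eta> \<and> weight \<eta> < w}"
  by (rule finite_subset[OF _ finite_partitions_weight_le[of w]]) auto

lemma lower_weight_cong:
  assumes "\<And>\<mu>. is_partition \<mu> \<Longrightarrow> f \<mu> = g \<mu>" "lower_weight w f" shows "lower_weight w g"
proof -
  obtain c where "\<And>\<mu>. is_partition \<mu> \<Longrightarrow>
      f \<mu> = (\<Sum>\<eta> | is_partition \<eta> \<and> weight \<eta> < w. c \<eta> * p_prod \<eta> \<mu>)"
    using assms(2) unfolding lower_weight_def by blast
  then show ?thesis unfolding lower_weight_def by (intro exI[of _ c]) (simp flip: assms(1))
qed

lemma lower_weight_zero: "lower_weight w (\<lambda>\<mu>. 0)"
  unfolding lower_weight_def by (rule exI[of _ "\<lambda>_. 0"]) simp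

lemma lower_weight_add:
  assumes "lower_weight w f" "lower_weight w g" shows "lower_weight w (\<lambda>\<mu>. f \<mu> + g \<mu>)"
proof -
  obtain c d where
    "\<And>\<mu>. is_partition \<mu> \<Longrightarrow> f \<mu> = (\<Sum>\<eta> | is_partition \<eta> \<and> weight \<eta> < w. c \<eta> * p_prod \<eta> \<mu>)"
    "\<And>\<mu>. is_partition \<mu> \<Longrightarrow> g \<mu> = (\<Sum>\<eta> | is_partition \<eta> \<and> weight \<eta> < w. d \<eta> * p_prod \<eta> \<mu>)"
    using assms unfolding lower_weight_def by blast
  then show ?thesis unfolding lower_weight_def
    by (intro exI[of _ "\<lambda>\<eta>. c \<eta> + d \<eta>"]) (simp add: distrib_right sum.distrib)
qed

lemma lower_weight_scale:
  assumes "lower_weight w f" shows "lower_weight w (\<lambda>\<mu>. a * f \<mu>)"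
proof -
  obtain c where
    "\<And>\<mu>. is_partition \<mu> \<Longrightarrow> f \<mu> = (\<Sum>\<eta> | is_partition \<eta> \<and> weight \<eta> < w. c \<eta> * p_prod \<eta> \<mu>)"
    using assms unfolding lower_weight_def by blast
  then show ?thesis unfolding lower_weight_def
    by (intro exI[of _ "\<lambda>\<eta>. a * c \<eta>"]) (simp add: sum_distrib_left mult.assoc)
qed

lemma lower_weight_diff: "lower_weight w f \<Longrightarrow> lower_weight w g \<Longrightarrow> lower_weight w (\<lambda>\<mu>. f \<mu> - g \<mu>)"
  using lower_weight_add[of w f "\<lambda>\<mu>. -1 * g \<mu>"] lower_weight_scale[of w g "-1"] by simp

lemma lower_weight_sum: "(\<And>i. i \<in> I \<Longrightarrow> lower_weight w (f i)) \<Longrightarrow> lower_weight w (\<lambda>\<mu>. \<Sum>i\<in>I. f i \<mu>)"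
  by (induction I rule: infinite_finite_induct) (auto intro: lower_weight_zero lower_weight_add)

lemma lower_weight_p_prod:
  assumes "is_partition \<eta>" "weight \<eta> < w" shows "lower_weight w (p_prod \<eta>)"
  unfolding lower_weight_def
proof (intro exI allI impI)
  fix \<mu>
  have "(\<Sum>\<theta> | is_partition \<theta> \<and> weight \<theta> < w. (if \<theta> = \<eta> then 1 else 0) * p_prod \<theta> \<mu>)
    = (\<Sum>\<theta> | is_partition \<theta> \<and> weight \<theta> < w. if \<theta> = \<eta> then p_prod \<eta> \<mu> else 0)"
    by (rule sum.cong) auto
  then show "p_prod \<eta> \<mu> = (\<Sum>\<theta> | is_partition \<theta> \<and> weight \<theta> < w. (if \<theta> = \<eta> then 1 else 0) * p_prod \<theta> \<mu>)"
    using assms finite_partitions_weight_less[of w] by (simp add: sum.delta)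
qed

lemma lower_weight_mono:
  assumes "lower_weight v f" "v \<le> w" shows "lower_weight w f"
proof -
  obtain c where c:
    "\<And>\<mu>. is_partition \<mu> \<Longrightarrow> f \<mu> = (\<Sum>\<eta> | is_partition \<eta> \<and> weight \<eta> < v. c \<eta> * p_prod \<eta> \<mu>)"
    using assms unfolding lower_weight_def by blast
  have "lower_weight w (\<lambda>\<mu>. \<Sum>\<eta> | is_partition \<eta> \<and> weight \<eta> < v. c \<eta> * p_prod \<eta> \<mu>)"
    using assms(2) by (intro lower_weight_sum lower_weight_scale lower_weight_p_prod) auto
  then show ?thesis by (rule lower_weight_cong[rotated]) (simp add: c)
qed

text \<open>Weight and product depend only on the multiset of parts, so the parts of both partitions
  may be joined and sorted.\<close>

lemma p_prod_merge:
  assumes "is_partition \<eta>" "is_partition \<theta>"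
  obtains \<rho> where "is_partition \<rho>" "weight \<rho> = weight \<eta> + weight \<theta>"
    "\<And>\<mu>. p_prod \<rho> \<mu> = p_prod \<eta> \<mu> * p_prod \<theta> \<mu>"
proof
  let ?\<rho> = "rev (sort (\<eta> @ \<theta>))"
  have m: "mset ?\<rho> = mset \<eta> + mset \<theta>" by simp
  show "is_partition ?\<rho>"
    using assms by (auto simp: is_partition_def sorted_wrt_rev)
  show "weight ?\<rho> = weight \<eta> + weight \<theta>"
    unfolding weight_def sum_mset_sum_list[symmetric] size_mset[symmetric] m by simp
  show "p_prod ?\<rho> \<mu> = p_prod \<eta> \<mu> * p_prod \<theta> \<mu>" for \<mu>
    unfolding p_prod_def prod_mset_prod_list[symmetric] mset_map m by simp
qed

text \<open>Weight at most \<open>v\<close> times weight below \<open>w\<close> is below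
  \<open>v + w\<close>: the shape of a leading term times an error term.\<close>

lemma lower_weight_mult:
  assumes "lower_weight (Suc v) f" "lower_weight w g" shows "lower_weight (v + w) (\<lambda>\<mu>. f \<mu> * g \<mu>)"
proof -
  obtain c d where
    cd: "\<And>\<mu>. is_partition \<mu> \<Longrightarrow> f \<mu> = (\<Sum>\<eta> | is_partition \<eta> \<and> weight \<eta> < Suc v. c \<eta> * p_prod \<eta> \<mu>)"
    "\<And>\<mu>. is_partition \<mu> \<Longrightarrow> g \<mu> = (\<Sum>\<eta> | is_partition \<eta> \<and> weight \<eta> < w. d \<eta> * p_prod \<eta> \<mu>)"
    using assms unfolding lower_weight_def by blast
  have "lower_weight (v + w) (\<lambda>\<mu>. \<Sum>\<eta> | is_partition \<eta> \<and> weight \<eta> < Suc v.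
      \<Sum>\<theta> | is_partition \<theta> \<and> weight \<theta> < w. (c \<eta> * p_prod \<eta> \<mu>) * (d \<theta> * p_prod \<theta> \<mu>))"
  proof (intro lower_weight_sum)
    fix \<eta> \<theta> assume *: "\<eta> \<in> {\<eta>. is_partition \<eta> \<and> weight \<eta> < Suc v}"
      "\<theta> \<in> {\<theta>. is_partition \<theta> \<and> weight \<theta> < w}"
    then have "is_partition \<eta>" "is_partition \<theta>" by auto
    then obtain \<rho> where \<rho>: "is_partition \<rho>" "weight \<rho> = weight \<eta> + weight \<theta>"
      "\<And>\<mu>. p_prod \<rho> \<mu> = p_prod \<eta> \<mu> * p_prod \<theta> \<mu>"
      by (rule p_prod_merge) blast
    have "lower_weight (v + w) (\<lambda>\<mu>. c \<eta> * d \<theta> * p_prod \<rho> \<mu>)"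
      using * \<rho> by (intro lower_weight_scale lower_weight_p_prod) auto
    then show "lower_weight (v + w) (\<lambda>\<mu>. (c \<eta> * p_prod \<eta> \<mu>) * (d \<theta> * p_prod \<theta> \<mu>))"
      by (rule lower_weight_cong[rotated]) (simp add: \<rho>)
  qed
  then show ?thesis
    by (rule lower_weight_cong[rotated]) (simp only: cd sum_product)
qed

lemma lower_weight_const: "lower_weight (Suc w) (\<lambda>\<mu>. a)"
  using lower_weight_scale[OF lower_weight_p_prod[of "[]" "Suc w"], of a]
  by (simp add: is_partition_def weight_def p_prod_def)

lemma lower_weight_p_fun: "m \<ge> 1 \<Longrightarrow> lower_weight (m + 2) (p_fun m)"
  using lower_weight_p_prod[of "[m]" "m + 2"]
  by (simp add: is_partition_def weight_def p_prod_def [abs_def])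

section \<open>Leading terms as coefficients of an exponential, summed over multisets of
  parts\<close>

definition part_sets :: "nat \<Rightarrow> nat multiset set" where
  "part_sets w = {M. (\<forall>j\<in>#M. 1 \<le> j) \<and> \<Sum>\<^sub># M + size M = w}"

definition mterm :: "complex \<Rightarrow> (nat \<Rightarrow> complex) \<Rightarrow> nat multiset \<Rightarrow> complex" where
  "mterm a p M = a ^ size M / (\<Prod>j\<in>set_mset M. fact (count M j)) * (\<Prod>j\<in>#M. p j)"

text \<open>The coefficient of t^w in the exponential of \<open>a\<close> times the sum of
  \<open>p j\<close> t^(j+1) over j >= 1. Multisets replace partitions so that a part can be deleted
  without reordering.\<close>

definition top_sum :: "complex \<Rightarrow> (nat \<Rightarrow> complex) \<Rightarrow> nat \<Rightarrow> complex" where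
  "top_sum a p w = (\<Sum>M\<in>part_sets w. mterm a p M)"

lemma bij_betw_mset_partitions:
  "bij_betw mset {\<rho>. is_partition \<rho> \<and> weight \<rho> = w} (part_sets w)"
proof (rule bij_betw_byWitness[where f' = "\<lambda>M. rev (sorted_list_of_multiset M)"])
  have "rev (sorted_list_of_multiset (mset \<rho>)) = \<rho>" if "is_partition \<rho>" for \<rho>
  proof -
    have "sorted (rev \<rho>)" using that by (simp add: is_partition_def sorted_wrt_rev)
    then show ?thesis
      by (metis mset_rev rev_rev_ident sorted_list_of_multiset_mset sorted_sort_id)
  qed
  then show "\<forall>\<rho>\<in>{\<rho>. is_partition \<rho> \<and> weight \<rho> = w}. rev (sorted_list_of_multiset (mset \<rho>)) = \<rho>"
    by blast
  show "\<forall>M\<in>part_sets w. mset (rev (sorted_list_of_multiset M)) = M" by simp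
  show "mset ` {\<rho>. is_partition \<rho> \<and> weight \<rho> = w} \<subseteq> part_sets w"
    by (auto simp: part_sets_def is_partition_def weight_def sum_mset_sum_list)
  have "sum_list (sorted_list_of_multiset M) = \<Sum>\<^sub># M" "length (sorted_list_of_multiset M) = size M"
    for M :: "nat multiset"
    by (metis mset_sorted_list_of_multiset sum_mset_sum_list)
      (metis mset_sorted_list_of_multiset size_mset)
  then show "(\<lambda>M. rev (sorted_list_of_multiset M)) ` part_sets w \<subseteq> {\<rho>. is_partition \<rho> \<and> weight \<rho> = w}"
    by (auto simp: part_sets_def is_partition_def weight_def sorted_wrt_rev sum_list_rev
        sorted_sorted_list_of_multiset)
qed

lemma finite_part_sets: "finite (part_sets w)"
proof -
  have "finite {\<rho>. is_partition \<rho> \<and> weight \<rho> = w}"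
    by (rule finite_subset[OF _ finite_partitions_weight_le[of w]]) auto
  then show ?thesis using bij_betw_finite[OF bij_betw_mset_partitions] by blast
qed

lemma mterm_mset:
  "mterm a (\<lambda>j. p_fun j \<mu>) (mset \<rho>) = a ^ length \<rho> / of_nat (mult_fact \<rho>) * p_prod \<rho> \<mu>"
  by (simp add: mterm_def mult_fact_def p_prod_def count_mset flip: mset_map prod_mset_prod_list)

lemma top_sum_eq:
  "top_sum a (\<lambda>j. p_fun j \<mu>) w = (\<Sum>\<rho> | is_partition \<rho> \<and> weight \<rho> = w.
     a ^ length \<rho> / of_nat (mult_fact \<rho>) * p_prod \<rho> \<mu>)"
  unfolding top_sum_def
  by (subst sum.reindex_bij_betw[OF bij_betw_mset_partitions, symmetric]) (simp add: mterm_mset)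

text \<open>Lowering the multiplicity of \<open>j\<close> by one cancels the factor
  \<open>count M j\<close> of its factorial.\<close>

lemma mterm_remove:
  assumes "j \<in># M"
  shows "of_nat (count M j) * mterm a p M = a * p j * mterm a p (M - {#j#})"
proof -
  define L where "L = M - {#j#}"
  have M: "M = add_mset j L" using assms by (simp add: L_def)
  have "(\<Prod>i\<in>set_mset M. fact (count M i) :: complex)
     = fact (count M j) * (\<Prod>i\<in>set_mset M - {j}. fact (count L i))"
    using assms by (subst prod.remove[of _ j]) (auto simp: M intro!: prod.cong)
  also have "\<dots> = of_nat (count M j) * (fact (count L j) * (\<Prod>i\<in>set_mset M - {j}. fact (count L i)))"
    by (simp add: M)
  also have "fact (count L j) * (\<Prod>i\<in>set_mset M - {j}. fact (count L i))
     = (\<Prod>i\<in>set_mset M. fact (count L i) :: complex)"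
    using assms by (subst prod.remove[of _ j]) auto
  also have "\<dots> = (\<Prod>i\<in>set_mset L. fact (count L i))"
    by (rule prod.mono_neutral_right) (auto simp: M not_in_iff)
  finally have "(\<Prod>i\<in>set_mset M. fact (count M i) :: complex)
    = of_nat (count M j) * (\<Prod>i\<in>set_mset L. fact (count L i))" .
  moreover have "count M j \<noteq> 0" using assms by simp
  ultimately show ?thesis
    unfolding mterm_def L_def[symmetric] by (simp add: M[symmetric])
      (simp add: M)
qed

lemma sum_mset_plus_size:
  assumes "finite A" "set_mset M \<subseteq> A"
  shows "(\<Sum>j\<in>A. (j + 1) * count M j) = \<Sum>\<^sub># M + size M"
  using assms(2)
proof (induction M)
  case (add x M)
  have "(\<Sum>j\<in>A. (j + 1) * count (add_mset x M) j)
    = (\<Sum>j\<in>A. (j + 1) * count M j + (if j = x then j + 1 else 0))"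
    by (rule sum.cong) auto
  then show ?case using add assms(1) by (simp add: sum.distrib)
qed simp

text \<open>Coefficient form of F' = F (log F)'. The weight \<open>w\<close> is the sum of
  \<open>j + 1\<close> over all occurrences of parts \<open>j\<close>, and the marked occurrence is
  then removed.\<close>

lemma top_sum_rec:
  "of_nat w * top_sum a p w = (\<Sum>j | 1 \<le> j \<and> j < w. of_nat (j + 1) * a * p j * top_sum a p (w - (j + 1)))"
proof -
  have "of_nat w * top_sum a p w
    = (\<Sum>M\<in>part_sets w. \<Sum>j\<in>set_mset M. of_nat (j + 1) * (of_nat (count M j) * mterm a p M))"
    unfolding top_sum_def sum_distrib_left
  proof (rule sum.cong[OF refl])
    fix M assume M: "M \<in> part_sets w"
    have "w = (\<Sum>j\<in>set_mset M. (j + 1) * count M j)"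
      using M sum_mset_plus_size[of "set_mset M" M] by (simp add: part_sets_def)
    then have "of_nat w = (\<Sum>j\<in>set_mset M. of_nat (j + 1) * of_nat (count M j) :: complex)"
      by (metis (mono_tags, lifting) of_nat_mult of_nat_sum sum.cong)
    then show "of_nat w * mterm a p M
      = (\<Sum>j\<in>set_mset M. of_nat (j + 1) * (of_nat (count M j) * mterm a p M))"
      by (simp add: sum_distrib_right mult.assoc)
  qed
  also have "\<dots> = (\<Sum>M\<in>part_sets w. \<Sum>j\<in>set_mset M. of_nat (j + 1) * a * p j * mterm a p (M - {#j#}))"
    by (intro sum.cong refl) (simp add: mterm_remove mult.assoc)
  also have "\<dots> = (\<Sum>(M, j)\<in>(SIGMA M:part_sets w. set_mset M). of_nat (j + 1) * a * p j * mterm a p (M - {#j#}))"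
    by (simp add: sum.Sigma finite_part_sets)
  also have "\<dots> = (\<Sum>(j, M)\<in>(SIGMA j:{j. 1 \<le> j \<and> j < w}. part_sets (w - (j + 1))).
      of_nat (j + 1) * a * p j * mterm a p M)"
  proof (rule sum.reindex_bij_witness[of _ "\<lambda>(j, M). (add_mset j M, j)" "\<lambda>(M, j). (j, M - {#j#})"])
    fix x assume "x \<in> (SIGMA M:part_sets w. set_mset M)"
    then obtain M j where x: "x = (M, j)" "M \<in> part_sets w" "j \<in># M" by auto
    define L where "L = M - {#j#}"
    have M: "M = add_mset j L" using x by (simp add: L_def)
    show "(case x of (M, j) \<Rightarrow> (j, M - {#j#})) \<in> (SIGMA j:{j. 1 \<le> j \<and> j < w}. part_sets (w - (j + 1)))"
      using x(2) by (auto simp: x(1) M part_sets_def)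
  qed (auto simp: part_sets_def)
  also have "\<dots> = (\<Sum>j | 1 \<le> j \<and> j < w. of_nat (j + 1) * a * p j * top_sum a p (w - (j + 1)))"
    by (simp add: sum.Sigma[symmetric] finite_part_sets top_sum_def sum_distrib_left)
  finally show ?thesis .
qed

lemma part_sets_0 [simp]: "part_sets 0 = {{#}}"
  by (auto simp: part_sets_def)

lemma top_sum_0 [simp]: "top_sum a p 0 = 1"
  by (simp add: top_sum_def mterm_def)

section \<open>Shifted power sums as logarithmic derivatives\<close>

text \<open>Here \<open>j\<close> counts from 0, so this is \<open>- i + 1/2\<close> for
  \<open>i = j + 1\<close>, the value belonging to an empty row.\<close>

definition e_shift :: "nat \<Rightarrow> complex" where
  "e_shift j = - of_nat j - 1/2"

definition l_shift :: "nat list \<Rightarrow> nat \<Rightarrow> complex" where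
  "l_shift \<mu> j = of_nat (part \<mu> (Suc j)) + e_shift j"

definition power_diff :: "nat \<Rightarrow> nat list \<Rightarrow> complex" where
  "power_diff i \<mu> = (\<Sum>j<length \<mu>. l_shift \<mu> j ^ i - e_shift j ^ i)"

lemma l_shift_beyond: "length \<mu> \<le> j \<Longrightarrow> l_shift \<mu> j = e_shift j"
  by (simp add: l_shift_def part_def)

lemma p_fun_eq: "p_fun i \<mu> = power_diff i \<mu> + (1 - 1 / 2 ^ i) * riemann_zeta (- of_nat i)"
proof -
  have "(\<Sum>m. let i' = Suc m in
        (of_nat (part \<mu> i') - of_nat i' + 1/2) ^ i - (- of_nat i' + 1/2) ^ i)
     = (\<Sum>m. l_shift \<mu> m ^ i - e_shift m ^ i)"
    by (simp add: l_shift_def e_shift_def Let_def algebra_simps)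
  also have "\<dots> = power_diff i \<mu>"
    unfolding power_diff_def by (rule suminf_finite) (auto simp: l_shift_beyond)
  finally show ?thesis by (simp add: p_fun_def)
qed

text \<open>The difference from \<open>p_fun i\<close>, which has weight \<open>i + 1\<close>, is a
  zeta constant of weight 0.\<close>

lemma lower_weight_pt: "lower_weight (i + 2) (power_diff i)"
proof (cases "i = 0")
  case True
  then have "power_diff i = (\<lambda>\<mu>. 0)" by (auto simp: power_diff_def)
  then show ?thesis by (simp add: lower_weight_zero)
next
  case False
  then have "lower_weight (i + 2) (\<lambda>\<mu>. p_fun i \<mu> - (1 - 1 / 2 ^ i) * riemann_zeta (- of_nat i))"
    by (intro lower_weight_diff lower_weight_p_fun lower_weight_mono[OF lower_weight_const[of 0]]) auto
  then show ?thesis by (simp add: p_fun_eq)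
qed

section \<open>The generating series and its logarithmic derivative\<close>

definition U_ser :: "complex \<Rightarrow> nat list \<Rightarrow> complex fps" where
  "U_ser h \<mu> = (\<Prod>j<length \<mu>. lin (l_shift \<mu> j + h) * geo (l_shift \<mu> j - h) *
     lin (e_shift j - h) * geo (e_shift j + h))"

text \<open>The logarithmic derivative of \<open>U_ser\<close>: a factor \<open>lin a\<close>
  contributes - a / (1 - a t), a factor \<open>geo a\<close> the opposite.\<close>

definition W_ser :: "complex \<Rightarrow> nat list \<Rightarrow> complex fps" where
  "W_ser h \<mu> = (\<Sum>j<length \<mu>.
     fps_const (l_shift \<mu> j - h) * geo (l_shift \<mu> j - h) - fps_const (l_shift \<mu> j + h) * geo (l_shift \<mu> j + h)
     + fps_const (e_shift j + h) * geo (e_shift j + h) - fps_const (e_shift j - h) * geo (e_shift j - h))"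

lemma deriv_lin: "fps_deriv (lin a) = - fps_const a"
  by (simp add: lin_def)

lemma deriv_geo: "fps_deriv (geo a) = fps_const a * geo a * geo a"
proof -
  have "fps_deriv (lin a * geo a) = 0" by (simp only: lin_mult_geo fps_deriv_1)
  then have "lin a * fps_deriv (geo a) + - fps_const a * geo a = 0"
    by (simp only: fps_deriv_mult deriv_lin)
  then have "lin a * fps_deriv (geo a) = fps_const a * geo a"
    by (simp only: mult_minus_left add_eq_0_iff neg_equal_iff_equal minus_minus)
  then have "geo a * (lin a * fps_deriv (geo a)) = geo a * (fps_const a * geo a)" by simp
  then show ?thesis by (simp only: mult.assoc[symmetric] geo_mult_lin mult_1_left)
      (simp only: mult_ac)
qed

lemma deriv_lin_geo:
  "fps_deriv (lin a * geo b) = lin a * geo b * (fps_const b * geo b - fps_const a * geo a)"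
proof -
  have "fps_deriv (lin a * geo b) = lin a * (fps_const b * geo b * geo b) - 1 * (fps_const a * geo b)"
    by (simp only: fps_deriv_mult deriv_lin deriv_geo mult_minus_left mult_1_left) simp
  also have "\<dots> = lin a * (fps_const b * geo b * geo b) - (lin a * geo a) * (fps_const a * geo b)"
    by (simp only: lin_mult_geo)
  also have "\<dots> = lin a * geo b * (fps_const b * geo b - fps_const a * geo a)"
    by (simp only: right_diff_distrib mult_ac)
  finally show ?thesis .
qed

lemma deriv_prod_log:
  fixes F :: "nat \<Rightarrow> complex fps"
  assumes "\<And>j. j < n \<Longrightarrow> fps_deriv (F j) = F j * G j"
  shows "fps_deriv (\<Prod>j<n. F j) = (\<Prod>j<n. F j) * (\<Sum>j<n. G j)"
  using assms by (induction n) (simp_all add: algebra_simps)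

lemma deriv_U_ser: "fps_deriv (U_ser h \<mu>) = U_ser h \<mu> * W_ser h \<mu>"
  unfolding U_ser_def W_ser_def
proof (rule deriv_prod_log)
  fix j
  let ?l = "l_shift \<mu> j" and ?e = "e_shift j"
  have "fps_deriv ((lin (?l + h) * geo (?l - h)) * (lin (?e - h) * geo (?e + h)))
    = (lin (?l + h) * geo (?l - h)) * (lin (?e - h) * geo (?e + h)) *
      ((fps_const (?l - h) * geo (?l - h) - fps_const (?l + h) * geo (?l + h))
      + (fps_const (?e + h) * geo (?e + h) - fps_const (?e - h) * geo (?e - h)))"
    by (subst fps_deriv_mult, subst (1 2) deriv_lin_geo) (simp only: distrib_left distrib_right mult_ac add.commute)
  then show "fps_deriv (lin (?l + h) * geo (?l - h) * lin (?e - h) * geo (?e + h))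
    = lin (?l + h) * geo (?l - h) * lin (?e - h) * geo (?e + h) *
      (fps_const (?l - h) * geo (?l - h) - fps_const (?l + h) * geo (?l + h)
      + fps_const (?e + h) * geo (?e + h) - fps_const (?e - h) * geo (?e - h))"
    by (simp only: mult.assoc add_diff_eq)
qed

lemma power_plus_minus_power_minus:
  "(x + h) ^ m - (x - h) ^ m = (\<Sum>r\<le>m. of_nat (m choose r) * h ^ r * (1 - (-1) ^ r) * x ^ (m - r))"
  for x h :: complex
proof -
  have "(h + x) ^ m - (-h + x) ^ m = (\<Sum>r\<le>m. of_nat (m choose r) * h ^ r * (1 - (-1) ^ r) * x ^ (m - r))"
    by (simp only: binomial_ring flip: sum_subtractf)
      (simp add: power_minus[of h] algebra_simps)
  then show ?thesis by (simp add: add.commute)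
qed

text \<open>Expanding the powers of \<open>x + h\<close> and \<open>x - h\<close> leaves only odd
  powers of \<open>h\<close>; their coefficients are the differences of power sums collected in
  \<open>power_diff\<close>.\<close>

lemma W_ser_nth:
  "W_ser h \<mu> $ m = - (\<Sum>r\<le>Suc m. of_nat (Suc m choose r) * h ^ r * (1 - (-1) ^ r) * power_diff (Suc m - r) \<mu>)"
proof -
  have "W_ser h \<mu> $ m = - (\<Sum>j<length \<mu>. ((l_shift \<mu> j + h) ^ Suc m - (l_shift \<mu> j - h) ^ Suc m)
      - ((e_shift j + h) ^ Suc m - (e_shift j - h) ^ Suc m))"
    by (simp add: W_ser_def fps_sum_nth algebra_simps flip: sum_negf)
  also have "\<dots> = - (\<Sum>j<length \<mu>. \<Sum>r\<le>Suc m. of_nat (Suc m choose r) * h ^ r * (1 - (-1) ^ r)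
      * (l_shift \<mu> j ^ (Suc m - r) - e_shift j ^ (Suc m - r)))"
    by (simp only: power_plus_minus_power_minus right_diff_distrib sum_subtractf)
  also have "\<dots> = - (\<Sum>r\<le>Suc m. of_nat (Suc m choose r) * h ^ r * (1 - (-1) ^ r) * power_diff (Suc m - r) \<mu>)"
    unfolding power_diff_def sum_distrib_left by (subst sum.swap) simp
  finally show ?thesis .
qed

text \<open>The term \<open>r = 1\<close> is the leading one, \<open>- 2 * h * (m + 1)\<close> times
  \<open>power_diff m\<close>. Terms with \<open>r \<ge> 2\<close> have weight at most
  \<open>m\<close>, and passing from \<open>power_diff m\<close> to \<open>p_fun m\<close> costs a
  constant.\<close>

lemma lower_weight_W_ser:
  "lower_weight (m + 1) (\<lambda>\<mu>. W_ser h \<mu> $ m + of_nat (m + 1) * (2 * h) * p_fun m \<mu>)"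
proof -
  define cf where "cf r = of_nat (Suc m choose r) * h ^ r * (1 - (-1) ^ r)" for r
  define C where "C = (1 - 1 / 2 ^ m) * riemann_zeta (- of_nat m)"
  \<comment> \<open>The index 0 contributes nothing because of the factor
    \<open>1 - (-1) ^ r\<close>.\<close>
  have "{..Suc m} = insert 0 (insert 1 {2..Suc m})" by auto
  then have "W_ser h \<mu> $ m = - (of_nat (m + 1) * (2 * h) * power_diff m \<mu>) - (\<Sum>r=2..Suc m. cf r * power_diff (Suc m - r) \<mu>)"
    for \<mu>
    unfolding W_ser_nth by (simp add: cf_def del: sum.cl_ivl_Suc)
  note W = this
  have eq: "W_ser h \<mu> $ m + of_nat (m + 1) * (2 * h) * p_fun m \<mu>
    = of_nat (m + 1) * (2 * h) * C - (\<Sum>r=2..Suc m. cf r * power_diff (Suc m - r) \<mu>)" for \<mu>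
    unfolding W by (simp add: p_fun_eq C_def algebra_simps del: sum.cl_ivl_Suc)
  have "lower_weight (m + 1) (\<lambda>\<mu>. of_nat (m + 1) * (2 * h) * C - (\<Sum>r=2..Suc m. cf r * power_diff (Suc m - r) \<mu>))"
  proof (intro lower_weight_diff lower_weight_sum lower_weight_scale)
    show "lower_weight (m + 1) (\<lambda>\<mu>. C)" using lower_weight_const by simp
    fix r assume "r \<in> {2..Suc m}"
    then show "lower_weight (m + 1) (power_diff (Suc m - r))" by (intro lower_weight_mono[OF lower_weight_pt]) auto
  qed
  then show ?thesis by (simp only: eq)
qed

lemma lower_weight_top_sum: "lower_weight (w + 1) (\<lambda>\<mu>. top_sum a (\<lambda>j. p_fun j \<mu>) w)"
  unfolding top_sum_eq by (intro lower_weight_sum lower_weight_scale lower_weight_p_prod) auto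

lemma power_diff_0: "power_diff 0 \<mu> = 0"
  by (simp add: power_diff_def)

lemma W_ser_0: "W_ser h \<mu> $ 0 = 0"
  by (simp add: W_ser_nth power_diff_0)

lemma U_ser_nth_0: "U_ser h \<mu> $ 0 = 1"
proof -
  have "(\<Prod>j<n. F j) $ 0 = (\<Prod>j<n. F j $ 0)" for F :: "nat \<Rightarrow> complex fps" and n :: nat
    by (induction n) simp_all
  then show ?thesis by (simp add: U_ser_def)
qed

text \<open>Both sequences satisfy the recurrence of an exponential, and their logarithmic
  derivatives agree up to lower weight. Strong induction on \<open>m\<close> transports the
  error.\<close>

lemma U_ser_top:
  "lower_weight m (\<lambda>\<mu>. U_ser h \<mu> $ m - top_sum (- 2 * h) (\<lambda>j. p_fun j \<mu>) m)"
proof (induction m rule: less_induct)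
  case (less m)
  define E where "E i \<mu> = top_sum (- 2 * h) (\<lambda>j. p_fun j \<mu>) i" for i \<mu>
  have IH: "lower_weight i (\<lambda>\<mu>. U_ser h \<mu> $ i - E i \<mu>)" if "i < m" for i
    using less[OF that] by (simp add: E_def)
  show ?case
  proof (cases m)
    case 0
    then show ?thesis by (simp add: U_ser_nth_0 lower_weight_zero)
  next
    case (Suc m')
    have U: "of_nat m * (U_ser h \<mu> $ m) = (\<Sum>i=1..m'. W_ser h \<mu> $ i * U_ser h \<mu> $ (m' - i))" for \<mu>
    proof -
      have "of_nat m * (U_ser h \<mu> $ m) = fps_deriv (U_ser h \<mu>) $ m'"
        by (simp add: Suc)
      also have "\<dots> = (\<Sum>i\<le>m'. W_ser h \<mu> $ i * U_ser h \<mu> $ (m' - i))"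
        by (simp add: deriv_U_ser mult.commute[of "U_ser h \<mu>"] fps_mult_nth atLeast0AtMost)
      also have "\<dots> = (\<Sum>i=1..m'. W_ser h \<mu> $ i * U_ser h \<mu> $ (m' - i))"
        by (intro sum.mono_neutral_right) (auto simp: W_ser_0 not_less_eq_eq)
      finally show ?thesis .
    qed
    have E: "of_nat m * E m \<mu> = (\<Sum>i=1..m'. of_nat (i + 1) * (- 2 * h) * p_fun i \<mu> * E (m' - i) \<mu>)" for \<mu>
    proof -
      have "{j. 1 \<le> j \<and> j < m} = {1..m'}" using Suc by auto
      then show ?thesis unfolding E_def using top_sum_rec[of m "- 2 * h" "\<lambda>j. p_fun j \<mu>"] by (simp add: Suc)
    qed
    have "lower_weight m (\<lambda>\<mu>. W_ser h \<mu> $ i * U_ser h \<mu> $ (m' - i)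
        - of_nat (i + 1) * (- 2 * h) * p_fun i \<mu> * E (m' - i) \<mu>)" if i: "i \<in> {1..m'}" for i
    proof -
      have D: "lower_weight (m' - i) (\<lambda>\<mu>. U_ser h \<mu> $ (m' - i) - E (m' - i) \<mu>)"
        using i Suc by (intro IH) auto
      have E': "lower_weight (m' - i + 1) (\<lambda>\<mu>. E (m' - i) \<mu>)"
        unfolding E_def by (rule lower_weight_top_sum)
      have U': "lower_weight (Suc (m' - i)) (\<lambda>\<mu>. U_ser h \<mu> $ (m' - i))"
        using lower_weight_add[OF lower_weight_mono[OF D, of "m' - i + 1"] E'] by simp
      have "lower_weight (i + 1) (\<lambda>\<mu>. W_ser h \<mu> $ i + of_nat (i + 1) * (2 * h) * p_fun i \<mu>)"
        by (rule lower_weight_W_ser)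
      then have 1: "lower_weight (m' - i + (i + 1)) (\<lambda>\<mu>. U_ser h \<mu> $ (m' - i) * (W_ser h \<mu> $ i + of_nat (i + 1) * (2 * h) * p_fun i \<mu>))"
        using lower_weight_mult[OF U'] by blast
      have "lower_weight (Suc (i + 1)) (p_fun i)" using lower_weight_p_fun[of i] i by simp
      then have 2: "lower_weight (i + 1 + (m' - i)) (\<lambda>\<mu>. p_fun i \<mu> * (U_ser h \<mu> $ (m' - i) - E (m' - i) \<mu>))"
        using lower_weight_mult D by blast
      have s: "m' - i + (i + 1) = m" "i + 1 + (m' - i) = m" using i Suc by auto
      \<comment> \<open>W U - W' E = U (W - W') + W' (U - E), where W' is the leading term of W and
        E that of U; each product has one factor of lower weight.\<close>
      have "lower_weight m (\<lambda>\<mu>. U_ser h \<mu> $ (m' - i) * (W_ser h \<mu> $ i + of_nat (i + 1) * (2 * h) * p_fun i \<mu>)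
        + of_nat (i + 1) * (- 2 * h) * (p_fun i \<mu> * (U_ser h \<mu> $ (m' - i) - E (m' - i) \<mu>)))"
        using 1 2 unfolding s by (intro lower_weight_add lower_weight_scale)
      then show ?thesis
        by (rule lower_weight_cong[rotated]) (simp add: algebra_simps)
    qed
    then have "lower_weight m (\<lambda>\<mu>. 1 / of_nat m * (\<Sum>i=1..m'. W_ser h \<mu> $ i * U_ser h \<mu> $ (m' - i)
        - of_nat (i + 1) * (- 2 * h) * p_fun i \<mu> * E (m' - i) \<mu>))"
      by (intro lower_weight_scale lower_weight_sum)
    moreover have "(\<Sum>i=1..m'. W_ser h \<mu> $ i * U_ser h \<mu> $ (m' - i)
        - of_nat (i + 1) * (- 2 * h) * p_fun i \<mu> * E (m' - i) \<mu>)
        = of_nat m * U_ser h \<mu> $ m - of_nat m * E m \<mu>" for \<mu>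
      by (simp only: sum_subtractf U E)
    ultimately have "lower_weight m (\<lambda>\<mu>. 1 / of_nat m * (of_nat m * U_ser h \<mu> $ m - of_nat m * E m \<mu>))"
      by (simp only:)
    moreover have "of_nat m \<noteq> (0 :: complex)" using Suc by (simp del: of_nat_Suc)
    ultimately show ?thesis
      by (simp add: E_def flip: right_diff_distrib)
  qed
qed

text \<open>The first product runs over a window of \<open>K\<close> consecutive numbers. Raising
  \<open>N\<close> by one moves the window down by one: \<open>e_shift N - h\<close> enters and
  \<open>e_shift N + h\<close> leaves, because the window has length
  \<open>K = 2 * h\<close>.\<close>

lemma prod_lin_shift:
  assumes "k = 2 * h" "k = of_nat K"
  shows "(\<Prod>s<K. lin (of_nat s - of_nat N + 1/2 - h)) * (\<Prod>j<N. lin (e_shift j + h))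
    = (\<Prod>s<K. lin (of_nat s + 1/2 - h)) * (\<Prod>j<N. lin (e_shift j - h))"
proof (induction N)
  case (Suc N)
  define c where "c s = of_nat s - of_nat (Suc N) + 1/2 - h" for s
  have "(\<Prod>s<K. lin (c s)) * lin (e_shift N + h) = (\<Prod>s<Suc K. lin (c s))"
  proof -
    have "e_shift N + h = c K" using assms by (simp add: e_shift_def c_def field_simps)
    then show ?thesis by simp
  qed
  also have "\<dots> = (\<Prod>s<K. lin (of_nat s - of_nat N + 1/2 - h)) * lin (e_shift N - h)"
  proof -
    have "c 0 = e_shift N - h" by (simp add: c_def e_shift_def)
    moreover have "c (Suc s) = of_nat s - of_nat N + 1/2 - h" for s by (simp add: c_def)
    ultimately show ?thesis by (simp only: prod.lessThan_Suc_shift mult.commute)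
  qed
  finally have *: "(\<Prod>s<K. lin (c s)) * lin (e_shift N + h) = \<dots>" .
  have "(\<Prod>s<K. lin (c s)) * (\<Prod>j<Suc N. lin (e_shift j + h))
    = (\<Prod>s<K. lin (c s)) * lin (e_shift N + h) * (\<Prod>j<N. lin (e_shift j + h))"
    by (simp only: prod.lessThan_Suc mult_ac)
  then have "(\<Prod>s<K. lin (c s)) * (\<Prod>j<Suc N. lin (e_shift j + h))
    = ((\<Prod>s<K. lin (of_nat s - of_nat N + 1/2 - h)) * (\<Prod>j<N. lin (e_shift j + h))) * lin (e_shift N - h)"
    unfolding * by (simp only: mult_ac)
  then show ?case unfolding Suc.IH by (simp add: c_def mult.assoc)
qed simp

text \<open>In rows beyond the partition \<open>l_shift\<close> equals \<open>e_shift\<close>, and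
  the four factors cancel in pairs.\<close>

lemma U_ser_extend:
  assumes "length \<mu> \<le> N"
  shows "(\<Prod>j<N. lin (l_shift \<mu> j + h) * geo (l_shift \<mu> j - h) * lin (e_shift j - h) * geo (e_shift j + h))
    = U_ser h \<mu>"
proof -
  have "lin (e_shift j + h) * geo (e_shift j - h) * lin (e_shift j - h) * geo (e_shift j + h)
    = (lin (e_shift j + h) * geo (e_shift j + h)) * (lin (e_shift j - h) * geo (e_shift j - h))" for j
    by (simp only: mult_ac)
  then show ?thesis
    unfolding U_ser_def using assms
    by (intro prod.mono_neutral_right) (auto simp: l_shift_beyond)
qed

text \<open>Frobenius' expression for the normalised character at a \<open>k\<close>-cycle, in terms of
  \<open>m\<^sub>j = \<mu>\<^sub>j + N - j\<close> (with \<open>j\<close> counted from 1).\<close>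

definition frob :: "nat \<Rightarrow> nat \<Rightarrow> (nat \<Rightarrow> complex) \<Rightarrow> complex" where
  "frob k N m = 1 / of_nat k * (\<Sum>j<N. (\<Prod>s<k. m j - of_nat s) *
     (\<Prod>i\<in>{..<N}-{j}. (m j - m i - of_nat k) / (m j - m i)))"

text \<open>\<open>residue_sum\<close> is applied to the points \<open>l_shift \<mu> j - h\<close>,
  which are the \<open>m j\<close> moved by a constant; centred in this way, the dependence on
  \<open>N\<close> is absorbed by \<open>prod_lin_shift\<close>. In the prefactor,
  \<open>- k\<close> comes from the residue sum and a second \<open>k\<close> from the denominator
  in \<open>frob\<close>.\<close>

lemma frob_eq_coeff:
  assumes "is_partition \<mu>" "length \<mu> \<le> N" "0 < N" "k \<ge> 1"
  defines "m \<equiv> \<lambda>j. of_nat (part \<mu> (Suc j) + (N - 1 - j))"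
  shows "frob k N m = - 1 / of_nat k ^ 2 *
    ((\<Prod>s<k. lin (of_nat s + 1/2 - of_nat k / 2)) * U_ser (of_nat k / 2) \<mu>) $ (k + 1)"
proof -
  define h :: complex where "h = of_nat k / 2"
  define a where "a j = l_shift \<mu> j - h" for j
  define c where "c s = of_nat s - of_nat N + 1/2 - h" for s :: nat
  have am: "a j = m j + (1/2 - of_nat N - h)" if "j < N" for j
    using that by (simp add: a_def l_shift_def e_shift_def m_def of_nat_diff algebra_simps)
  have dec: "part \<mu> (Suc j) \<le> part \<mu> (Suc i)" if "i < j" for i j
    using assms(1) that sorted_wrt_nth_less[of "(\<ge>)" \<mu> i j]
    by (auto simp: part_def is_partition_def)
  have inj: "inj_on a {..<N}"
  proof (rule linorder_inj_onI)
    fix i j assume ij: "i < j" "i \<in> {..<N}" "j \<in> {..<N}"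
    then have "part \<mu> (Suc j) + (N - 1 - j) < part \<mu> (Suc i) + (N - 1 - i)"
      using dec[of i j] by auto
    then have "m i \<noteq> m j" unfolding m_def of_nat_eq_iff by simp
    then show "a i \<noteq> a j" using ij am by auto
  qed auto
  define A where "A = a ` {..<N}"
  have A: "finite A" "A \<noteq> {}" using assms(3) by (auto simp: A_def)
  have "(\<Sum>x\<in>A. (\<Prod>s<k. x - c s) * (\<Prod>b\<in>A-{x}. (x - b - of_nat k) / (x - b)))
    = (\<Sum>j<N. (\<Prod>s<k. a j - c s) * (\<Prod>b\<in>A-{a j}. (a j - b - of_nat k) / (a j - b)))"
    unfolding A_def by (subst sum.reindex[OF inj]) simp
  also have "\<dots> = (\<Sum>j<N. (\<Prod>s<k. m j - of_nat s) *
     (\<Prod>i\<in>{..<N}-{j}. (m j - m i - of_nat k) / (m j - m i)))"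
  proof (rule sum.cong[OF refl])
    fix j assume j: "j \<in> {..<N}"
    have "A - {a j} = a ` ({..<N} - {j})"
      unfolding A_def using inj j by (auto simp: inj_on_def)
    moreover have "inj_on a ({..<N} - {j})" using inj by (rule inj_on_subset) auto
    ultimately have "(\<Prod>b\<in>A-{a j}. (a j - b - of_nat k) / (a j - b))
       = (\<Prod>i\<in>{..<N}-{j}. (a j - a i - of_nat k) / (a j - a i))"
      by (simp add: prod.reindex)
    also have "\<dots> = (\<Prod>i\<in>{..<N}-{j}. (m j - m i - of_nat k) / (m j - m i))"
      using j by (intro prod.cong) (auto simp: am)
    moreover have "a j - c s = m j - of_nat s" for s
      using j by (simp add: am c_def)
    ultimately show "(\<Prod>s<k. a j - c s) * (\<Prod>b\<in>A-{a j}. (a j - b - of_nat k) / (a j - b))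
       = (\<Prod>s<k. m j - of_nat s) * (\<Prod>i\<in>{..<N}-{j}. (m j - m i - of_nat k) / (m j - m i))"
      by simp
  qed
  finally have "- of_nat k * (of_nat k * frob k N m)
    = ((\<Prod>s<k. lin (c s)) * (\<Prod>x\<in>A. lin (x + of_nat k) * geo x)) $ (k + 1)"
    using residue_sum[OF A, where k = "of_nat k" and K = k and c = c] assms(4) by (simp add: frob_def)
  also have "(\<Prod>x\<in>A. lin (x + of_nat k) * geo x) = (\<Prod>j<N. lin (l_shift \<mu> j + h) * geo (l_shift \<mu> j - h))"
    unfolding A_def by (subst prod.reindex[OF inj]) (simp add: a_def h_def field_simps)
  also have "(\<Prod>s<k. lin (c s)) * (\<Prod>j<N. lin (l_shift \<mu> j + h) * geo (l_shift \<mu> j - h))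
    = (\<Prod>s<k. lin (of_nat s + 1/2 - h)) * U_ser h \<mu>"
  proof -
    let ?X = "\<Prod>j<N. lin (l_shift \<mu> j + h) * geo (l_shift \<mu> j - h)"
    \<comment> \<open>Multiplying and dividing by the factors of the empty partition brings out
      \<open>U_ser\<close>.\<close>
    have "(\<Prod>j<N. lin (e_shift j + h)) * (\<Prod>j<N. geo (e_shift j + h)) = 1"
      by (simp flip: prod.distrib)
    moreover have "((\<Prod>s<k. lin (c s)) * (\<Prod>j<N. lin (e_shift j + h))) * (?X * (\<Prod>j<N. geo (e_shift j + h)))
      = (\<Prod>s<k. lin (c s)) * ?X * ((\<Prod>j<N. lin (e_shift j + h)) * (\<Prod>j<N. geo (e_shift j + h)))"
      by (simp only: mult_ac)
    ultimately have "(\<Prod>s<k. lin (c s)) * ?X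
      = ((\<Prod>s<k. lin (c s)) * (\<Prod>j<N. lin (e_shift j + h))) * (?X * (\<Prod>j<N. geo (e_shift j + h)))"
      by simp
    also have "(\<Prod>s<k. lin (c s)) * (\<Prod>j<N. lin (e_shift j + h))
      = (\<Prod>s<k. lin (of_nat s + 1/2 - h)) * (\<Prod>j<N. lin (e_shift j - h))"
      unfolding c_def by (rule prod_lin_shift[where k = "of_nat k"]) (simp_all add: h_def)
    also have "\<dots> * (?X * (\<Prod>j<N. geo (e_shift j + h)))
      = (\<Prod>s<k. lin (of_nat s + 1/2 - h)) * (\<Prod>j<N. lin (l_shift \<mu> j + h) * geo (l_shift \<mu> j - h)
          * lin (e_shift j - h) * geo (e_shift j + h))"
      by (simp only: prod.distrib mult_ac)
    finally show ?thesis by (simp only: U_ser_extend[OF assms(2)])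
  qed
  finally have *: "- of_nat k * (of_nat k * frob k N m)
    = ((\<Prod>s<k. lin (of_nat s + 1/2 - h)) * U_ser h \<mu>) $ (k + 1)" .
  have "F = - 1 / x ^ 2 * X" if "- x * (x * F) = X" "x \<noteq> 0" for x F X :: complex
    using that by (auto simp: power2_eq_square)
  from this[OF *] show ?thesis using assms(4) by (simp add: h_def)
qed

text \<open>The fixed series \<open>L\<close> has constant term 1, so only the top coefficient of
  \<open>U_ser\<close> reaches weight \<open>k + 1\<close>. The prefactor \<open>- 1 / k ^ 2\<close>
  turns \<open>(- k) ^ l\<close> into \<open>(- k) ^ (l - 1) / k\<close>. The coefficients
  \<open>c\<close> are uniform in \<open>N\<close> because the coefficient expression no longer
  mentions it.\<close>

theorem frob_expansion:
  assumes "k \<ge> 1"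
  shows "\<exists>c. \<forall>\<mu> N. is_partition \<mu> \<longrightarrow> length \<mu> \<le> N \<longrightarrow> 0 < N \<longrightarrow>
    frob k N (\<lambda>j. of_nat (part \<mu> (Suc j) + (N - 1 - j))) =
      1 / of_nat k *
        (\<Sum>\<rho> | is_partition \<rho> \<and> weight \<rho> = k + 1.
           (- of_nat k) ^ (length \<rho> - 1) / of_nat (mult_fact \<rho>) * p_prod \<rho> \<mu>)
      + (\<Sum>\<eta> | is_partition \<eta> \<and> weight \<eta> < k + 1. c \<eta> * p_prod \<eta> \<mu>)"
proof -
  define h :: complex where "h = of_nat k / 2"
  define L where "L = (\<Prod>s<k. lin (of_nat s + 1/2 - h))"
  have L0: "L $ 0 = 1"
  proof -
    have "(\<Prod>j<n. lin (f j)) $ 0 = 1" for f and n :: nat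
      by (induction n) simp_all
    then show ?thesis by (simp add: L_def)
  qed
  define T where "T \<mu> = top_sum (- of_nat k) (\<lambda>j. p_fun j \<mu>) (k + 1)" for \<mu>
  have top: "lower_weight (k + 1) (\<lambda>\<mu>. U_ser h \<mu> $ (k + 1) - T \<mu>)"
    using U_ser_top[of "k + 1" h] by (simp add: h_def T_def)
  have low: "lower_weight (k + 1) (\<lambda>\<mu>. U_ser h \<mu> $ (k + 1 - i))" if "i \<ge> 1" "i \<le> k + 1" for i
  proof -
    have "lower_weight (k + 2 - i) (\<lambda>\<mu>. (U_ser h \<mu> $ (k + 1 - i) - top_sum (- 2 * h) (\<lambda>j. p_fun j \<mu>) (k + 1 - i))
       + top_sum (- 2 * h) (\<lambda>j. p_fun j \<mu>) (k + 1 - i))"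
      using that by (intro lower_weight_add lower_weight_mono[OF U_ser_top] lower_weight_mono[OF lower_weight_top_sum]) auto
    then have "lower_weight (k + 2 - i) (\<lambda>\<mu>. U_ser h \<mu> $ (k + 1 - i))" by simp
    then show ?thesis by (rule lower_weight_mono) (use that in auto)
  qed
  have coeff: "(L * U_ser h \<mu>) $ (k + 1) - T \<mu>
     = (U_ser h \<mu> $ (k + 1) - T \<mu>) + (\<Sum>i=1..k+1. L $ i * U_ser h \<mu> $ (k + 1 - i))" for \<mu>
  proof -
    have "{0..k+1} = insert 0 {1..k+1}" by auto
    then show ?thesis by (simp add: fps_mult_nth L0 del: sum.cl_ivl_Suc)
  qed
  have "lower_weight (k + 1) (\<lambda>\<mu>. - 1 / of_nat k ^ 2 * ((L * U_ser h \<mu>) $ (k + 1) - T \<mu>))"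
    unfolding coeff by (intro lower_weight_scale lower_weight_add lower_weight_sum top low) auto
  then obtain c where c: "\<And>\<mu>. is_partition \<mu> \<Longrightarrow> - 1 / of_nat k ^ 2 * ((L * U_ser h \<mu>) $ (k + 1) - T \<mu>)
     = (\<Sum>\<eta> | is_partition \<eta> \<and> weight \<eta> < k + 1. c \<eta> * p_prod \<eta> \<mu>)"
    unfolding lower_weight_def by blast
  have T: "- 1 / of_nat k ^ 2 * T \<mu> = 1 / of_nat k *
        (\<Sum>\<rho> | is_partition \<rho> \<and> weight \<rho> = k + 1.
           (- of_nat k) ^ (length \<rho> - 1) / of_nat (mult_fact \<rho>) * p_prod \<rho> \<mu>)" for \<mu>
    unfolding T_def top_sum_eq sum_distrib_left
  proof (rule sum.cong[OF refl])
    fix \<rho> assume "\<rho> \<in> {\<rho>. is_partition \<rho> \<and> weight \<rho> = k + 1}"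
    then have "length \<rho> \<noteq> 0" by (auto simp: weight_def)
    then obtain l where "length \<rho> = Suc l" by (cases "length \<rho>") auto
    then show "- 1 / of_nat k ^ 2 * ((- of_nat k) ^ length \<rho> / of_nat (mult_fact \<rho>) * p_prod \<rho> \<mu>)
      = 1 / of_nat k * ((- of_nat k) ^ (length \<rho> - 1) / of_nat (mult_fact \<rho>) * p_prod \<rho> \<mu>)"
      using assms by (simp add: power2_eq_square)
  qed
  show ?thesis
  proof (intro exI allI impI)
    fix \<mu> N assume *: "is_partition \<mu>" "length \<mu> \<le> N" "0 < N"
    then have "frob k N (\<lambda>j. of_nat (part \<mu> (Suc j) + (N - 1 - j)))
      = - 1 / of_nat k ^ 2 * (L * U_ser h \<mu>) $ (k + 1)"
      by (subst frob_eq_coeff[OF _ _ _ assms]) (simp_all add: L_def h_def)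
    also have "\<dots> = - 1 / of_nat k ^ 2 * T \<mu> + - 1 / of_nat k ^ 2 * ((L * U_ser h \<mu>) $ (k + 1) - T \<mu>)"
      by (simp only: right_diff_distrib) simp
    finally show "frob k N (\<lambda>j. of_nat (part \<mu> (Suc j) + (N - 1 - j))) =
      1 / of_nat k *
        (\<Sum>\<rho> | is_partition \<rho> \<and> weight \<rho> = k + 1.
           (- of_nat k) ^ (length \<rho> - 1) / of_nat (mult_fact \<rho>) * p_prod \<rho> \<mu>)
      + (\<Sum>\<eta> | is_partition \<eta> \<and> weight \<eta> < k + 1. c \<eta> * p_prod \<eta> \<mu>)"
      unfolding T c[OF *(1)] .
  qed
qed

section \<open>Words fixed by a permutation\<close>

definition words :: "nat set \<Rightarrow> nat \<Rightarrow> (nat \<Rightarrow> nat) set" where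
  "words S N = S \<rightarrow>\<^sub>E {..<N}"

text \<open>Integer valued, since contents are compared with differences of arbitrary exponent
  vectors.\<close>

definition cont :: "nat set \<Rightarrow> (nat \<Rightarrow> nat) \<Rightarrow> nat \<Rightarrow> int" where
  "cont S w i = int (card {x\<in>S. w x = i})"

text \<open>Words constant on the cycles of \<open>g\<close>. Their generating function by content
  is the product of the power sums for the cycle lengths of \<open>g\<close> on \<open>S\<close>;
  \<open>fix_count\<close> is its coefficient.\<close>

definition fixw :: "nat set \<Rightarrow> nat \<Rightarrow> (nat \<Rightarrow> nat) \<Rightarrow> (nat \<Rightarrow> nat) set" where
  "fixw S N g = {w\<in>words S N. w \<circ> g = w}"

definition fix_count :: "nat set \<Rightarrow> nat \<Rightarrow> (nat \<Rightarrow> nat) \<Rightarrow> (nat \<Rightarrow> int) \<Rightarrow> int" where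
  "fix_count S N g \<beta> = int (card {w\<in>fixw S N g. cont S w = \<beta>})"

text \<open>For \<open>i \<noteq> j\<close>, the contribution to the sum over transpositions in
  which the transposed positions carry the letters \<open>i\<close> and \<open>j\<close>.\<close>

definition swap_count :: "nat set \<Rightarrow> nat \<Rightarrow> (nat \<Rightarrow> nat) \<Rightarrow> nat \<Rightarrow> nat \<Rightarrow> (nat \<Rightarrow> int) \<Rightarrow> int" where
  "swap_count S N g i j \<beta> = int (card {(a, b, w). a \<in> S \<and> b \<in> S \<and> w \<in> words S N \<and> cont S w = \<beta> \<and>
     w a = i \<and> w b = j \<and> w \<circ> Transposition.transpose a b \<circ> g = w})"

definition move_parts :: "nat \<Rightarrow> nat \<Rightarrow> int \<Rightarrow> (nat \<Rightarrow> int) \<Rightarrow> nat \<Rightarrow> int" where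
  "move_parts i j s \<beta> = \<beta>(i := \<beta> i + s, j := \<beta> j - s)"

lemma finite_words [simp]: "finite S \<Longrightarrow> finite (words S N)"
  by (simp add: words_def finite_PiE)

lemma finite_fixw [simp]: "finite S \<Longrightarrow> finite (fixw S N g)"
  by (simp add: fixw_def)

section \<open>Editing letters of a word, and the resulting recurrence for
  \<open>swap_count\<close>\<close>

lemma cont_upd:
  assumes "finite S" "a \<in> S" "w a = i" "i \<noteq> j"
  shows "cont S (w(a := j)) = move_parts j i 1 (cont S w)"
proof
  fix x
  have "{y\<in>S. (w(a := j)) y = i} = {y\<in>S. w y = i} - {a}" using assms by auto
  moreover have "{y\<in>S. (w(a := j)) y = j} = insert a {y\<in>S. w y = j}" using assms by auto
  moreover have "{y\<in>S. (w(a := j)) y = x} = {y\<in>S. w y = x}" if "x \<noteq> i" "x \<noteq> j"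
    using that assms by auto
  moreover have "card {y\<in>S. w y = i} > 0" using assms by (auto simp: card_gt_0_iff)
  ultimately show "cont S (w(a := j)) x = move_parts j i 1 (cont S w) x"
    using assms by (auto simp: cont_def move_parts_def card_Diff_singleton_if)
qed

lemma cont_comp:
  assumes "g permutes S" shows "cont S (w \<circ> g) = cont S w"
proof
  fix i
  have "bij_betw g {x\<in>S. (w \<circ> g) x = i} {x\<in>S. w x = i}"
    using assms permutes_in_image[OF assms] permutes_inverses[OF assms]
    by (intro bij_betw_byWitness[where f' = "inv g"]) (auto simp: permutes_inv permutes_in_image)
  then show "cont S (w \<circ> g) i = cont S w i"
    by (simp add: cont_def bij_betw_same_card)
qed

lemma words_comp: "g permutes S \<Longrightarrow> w \<in> words S N \<Longrightarrow> w \<circ> g \<in> words S N"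
  unfolding words_def PiE_def extensional_def
  by (auto simp: permutes_in_image permutes_not_in)

lemma words_upd: "a \<in> S \<Longrightarrow> j < N \<Longrightarrow> w \<in> words S N \<Longrightarrow> w(a := j) \<in> words S N"
  by (auto simp: words_def PiE_def extensional_def)

text \<open>A word is edited twice, from \<open>i\<close> to \<open>j\<close> at \<open>a\<close>
  and from \<open>j\<close> back to \<open>i\<close> at \<open>b\<close>, and composition with
  \<open>g\<close> must then restore it. Admitting \<open>a = b\<close> lets one set account for
  both terms of \<open>card_shifts\<close>.\<close>

definition shifts :: "nat set \<Rightarrow> nat \<Rightarrow> (nat \<Rightarrow> nat) \<Rightarrow> nat \<Rightarrow> nat \<Rightarrow> (nat \<Rightarrow> int) \<Rightarrow> ((nat \<Rightarrow> nat) \<times> nat \<times> nat) set" where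
  "shifts S N g i j \<beta> = {(w, a, b). w \<in> words S N \<and> cont S w = \<beta> \<and> a \<in> S \<and> b \<in> S \<and> w a = i \<and>
     (w(a := j)) b = j \<and> w(a := j, b := i) \<circ> g = w}"

lemma card_shifts:
  assumes "finite S" "i \<noteq> j"
  shows "int (card (shifts S N g i j \<beta>)) = swap_count S N g i j \<beta> + \<beta> i * fix_count S N g \<beta>"
proof -
  define X where "X = (SIGMA w:{w\<in>fixw S N g. cont S w = \<beta>}. {a\<in>S. w a = i})"
  define Y where "Y = {(a, b, w). a \<in> S \<and> b \<in> S \<and> w \<in> words S N \<and> cont S w = \<beta> \<and>
     w a = i \<and> w b = j \<and> w \<circ> Transposition.transpose a b \<circ> g = w}"
  have fX: "finite X" using assms by (auto simp: X_def)
  have fY: "finite Y"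
    by (rule finite_subset[of _ "S \<times> S \<times> words S N"]) (use assms in \<open>auto simp: Y_def\<close>)
  have tr: "w(a := j, b := i) = w \<circ> Transposition.transpose a b" if "w a = i" "w b = j" "a \<noteq> b" for w and a b :: nat
    using that by (auto simp: fun_eq_iff Transposition.transpose_def)
  have eq: "shifts S N g i j \<beta> = (\<lambda>(w, a). (w, a, a)) ` X \<union> (\<lambda>(a, b, w). (w, a, b)) ` Y"
  proof (intro equalityI subsetI)
    fix t assume t: "t \<in> shifts S N g i j \<beta>"
    obtain w a b where tt: "t = (w, a, b)" by (cases t)
    show "t \<in> (\<lambda>(w, a). (w, a, a)) ` X \<union> (\<lambda>(a, b, w). (w, a, b)) ` Y"
    proof (cases "a = b")
      case True
      have "w(a := i) = w" using t by (auto simp: tt shifts_def)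
      then have "(w, a) \<in> X" using t True by (auto simp: tt shifts_def X_def fixw_def)
      then show ?thesis using True tt by force
    next
      case False
      then have "(a, b, w) \<in> Y" using t tr[of w a b] by (auto simp: tt shifts_def Y_def)
      then show ?thesis using tt by force
    qed
  next
    fix t assume "t \<in> (\<lambda>(w, a). (w, a, a)) ` X \<union> (\<lambda>(a, b, w). (w, a, b)) ` Y"
    then consider w a where "t = (w, a, a)" "(w, a) \<in> X"
      | a b w where "t = (w, a, b)" "(a, b, w) \<in> Y" by auto
    then show "t \<in> shifts S N g i j \<beta>"
    proof cases
      case 1
      then have "w(a := i) = w" by (auto simp: X_def)
      then show ?thesis using 1 by (auto simp: X_def shifts_def fixw_def)
    next
      case 2
      then have "a \<noteq> b" using assms by (auto simp: Y_def)
      then show ?thesis using 2 tr[of w a b] by (auto simp: Y_def shifts_def)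
    qed
  qed
  have "card (shifts S N g i j \<beta>) = card X + card Y"
    unfolding eq using fX fY assms(2)
    by (subst card_Un_disjoint) (auto simp: card_image inj_on_def X_def Y_def)
  moreover have "int (card X) = \<beta> i * fix_count S N g \<beta>"
  proof -
    have "card X = (\<Sum>w\<in>{w\<in>fixw S N g. cont S w = \<beta>}. card {a\<in>S. w a = i})"
      unfolding X_def using assms by (intro card_SigmaI) auto
    then have "int (card X) = (\<Sum>w\<in>{w\<in>fixw S N g. cont S w = \<beta>}. cont S w i)"
      unfolding cont_def[of S _ i] by (simp only: of_nat_sum)
    also have "\<dots> = (\<Sum>w\<in>{w\<in>fixw S N g. cont S w = \<beta>}. \<beta> i)"
      by (rule sum.cong) auto
    finally show ?thesis by (simp add: fix_count_def)
  qed
  ultimately show ?thesis by (simp add: swap_count_def Y_def)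
qed

text \<open>The two edits and the composition with \<open>g\<close> form a closed cycle, which may
  be started after the first edit. Moving the edit at \<open>a\<close> past \<open>g\<close> places
  it at \<open>g a\<close>, and the roles of \<open>i\<close> and \<open>j\<close> are
  exchanged.\<close>

lemma shifts_move:
  assumes "finite S" "i \<noteq> j" "i < N" "j < N" "g permutes S"
  shows "card (shifts S N g i j \<beta>) = card (shifts S N g j i (move_parts j i 1 \<beta>))"
proof -
  note gp = permutes_inverses[OF assms(5)] permutes_in_image[OF assms(5)]
  have "bij_betw (\<lambda>(w, a, b). (w(a := j), b, g a)) (shifts S N g i j \<beta>) (shifts S N g j i (move_parts j i 1 \<beta>))"
  proof (rule bij_betw_byWitness[where f' = "\<lambda>(u, b, c). (u(b := i) \<circ> g, inv g c, b)"])
    show "\<forall>t\<in>shifts S N g i j \<beta>. (\<lambda>(u, b, c). (u(b := i) \<circ> g, inv g c, b)) ((\<lambda>(w, a, b). (w(a := j), b, g a)) t) = t"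
      by (auto simp: shifts_def gp)
    have upd: "v(g a := x) \<circ> g = (v \<circ> g)(a := x)" for v :: "nat \<Rightarrow> nat" and a x
      using permutes_inj[OF assms(5)] by (auto simp: fun_eq_iff inj_eq)
    show "\<forall>t\<in>shifts S N g j i (move_parts j i 1 \<beta>). (\<lambda>(w, a, b). (w(a := j), b, g a)) ((\<lambda>(u, b, c). (u(b := i) \<circ> g, inv g c, b)) t) = t"
    proof
      fix t assume "t \<in> shifts S N g j i (move_parts j i 1 \<beta>)"
      moreover obtain u b c where t: "t = (u, b, c)" by (cases t)
      ultimately have "u(b := i, c := j) \<circ> g = u" by (simp add: shifts_def)
      then have "(u(b := i) \<circ> g)(inv g c := j) = u"
        using upd[of "u(b := i)" "inv g c" j] by (simp add: gp)
      then show "(\<lambda>(w, a, b). (w(a := j), b, g a)) ((\<lambda>(u, b, c). (u(b := i) \<circ> g, inv g c, b)) t) = t"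
        by (simp add: t gp)
    qed
    show "(\<lambda>(w, a, b). (w(a := j), b, g a)) ` shifts S N g i j \<beta> \<subseteq> shifts S N g j i (move_parts j i 1 \<beta>)"
    proof (rule image_subsetI)
      fix t assume *: "t \<in> shifts S N g i j \<beta>"
      obtain w a b where t: "t = (w, a, b)" by (cases t)
      have w: "w \<in> words S N" "cont S w = \<beta>" "a \<in> S" "b \<in> S" "w a = i" "(w(a := j)) b = j"
        "w(a := j, b := i) \<circ> g = w" using * by (auto simp: t shifts_def)
      have "(w(a := j, b := i)) (g a) = i" using w(5,7) by (metis comp_apply)
      moreover have "w(a := j, b := i, g a := j) \<circ> g = w(a := j)"
        by (simp only: upd w(7))
      ultimately show "(\<lambda>(w, a, b). (w(a := j), b, g a)) t \<in> shifts S N g j i (move_parts j i 1 \<beta>)"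
        using w assms by (simp add: t shifts_def words_upd gp cont_upd)
    qed
    show "(\<lambda>(u, b, c). (u(b := i) \<circ> g, inv g c, b)) ` shifts S N g j i (move_parts j i 1 \<beta>) \<subseteq> shifts S N g i j \<beta>"
    proof (rule image_subsetI)
      fix t assume *: "t \<in> shifts S N g j i (move_parts j i 1 \<beta>)"
      obtain u b c where t: "t = (u, b, c)" by (cases t)
      have u: "u \<in> words S N" "cont S u = move_parts j i 1 \<beta>" "c \<in> S" "b \<in> S" "u b = j" "(u(b := i)) c = i"
        "u(b := i, c := j) \<circ> g = u" using * by (auto simp: t shifts_def)
      define w where "w = u(b := i) \<circ> g"
      have "w(inv g c := j) = u"
        using upd[of "u(b := i)" "inv g c" j] u(7) by (simp add: gp w_def)
      moreover have "w \<in> words S N"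
        unfolding w_def using u assms by (intro words_comp words_upd) auto
      moreover have "cont S w = \<beta>"
        unfolding w_def using u assms by (simp add: cont_comp cont_upd[of S b u j i]) (auto simp: move_parts_def)
      moreover have "inv g c \<in> S" using u gp by metis
      moreover have "w (inv g c) = i" using u(6) by (simp add: w_def gp)
      moreover have "b \<noteq> inv g c \<longrightarrow> w b = j" using u(5) calculation(1) by (metis fun_upd_other)
      ultimately have "(w, inv g c, b) \<in> shifts S N g i j \<beta>"
        using u(4) by (simp add: shifts_def flip: w_def)
      then show "(\<lambda>(u, b, c). (u(b := i) \<circ> g, inv g c, b)) t \<in> shifts S N g i j \<beta>"
        by (simp add: t w_def)
    qed
  qed
  then show ?thesis by (rule bij_betw_same_card)
qed

lemma swap_count_sym:
  shows "swap_count S N g i j \<beta> = swap_count S N g j i \<beta>"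
proof -
  have "bij_betw (\<lambda>(a, b, w). (b, a, w))
    {(a, b, w). a \<in> S \<and> b \<in> S \<and> w \<in> words S N \<and> cont S w = \<beta> \<and>
     w a = i \<and> w b = j \<and> w \<circ> Transposition.transpose a b \<circ> g = w}
    {(a, b, w). a \<in> S \<and> b \<in> S \<and> w \<in> words S N \<and> cont S w = \<beta> \<and>
     w a = j \<and> w b = i \<and> w \<circ> Transposition.transpose a b \<circ> g = w}"
    by (rule bij_betw_byWitness[where f' = "\<lambda>(a, b, w). (b, a, w)"]) (auto simp: transpose_commute)
  then show ?thesis unfolding swap_count_def by (simp only: bij_betw_same_card)
qed

text \<open>Both sets matched by \<open>shifts_move\<close> are counted by
  \<open>card_shifts\<close>. This first-order recurrence in \<open>\<beta>\<close> is what the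
  telescoping below uses.\<close>

lemma swap_count_move:
  assumes "finite S" "i \<noteq> j" "i < N" "j < N" "g permutes S"
  shows "swap_count S N g i j \<beta> + \<beta> i * fix_count S N g \<beta>
    = swap_count S N g i j (move_parts j i 1 \<beta>) + (\<beta> j + 1) * fix_count S N g (move_parts j i 1 \<beta>)"
proof -
  have "int (card (shifts S N g j i (move_parts j i 1 \<beta>)))
    = swap_count S N g j i (move_parts j i 1 \<beta>) + (move_parts j i 1 \<beta>) j * fix_count S N g (move_parts j i 1 \<beta>)"
    using assms by (intro card_shifts) auto
  moreover have "(move_parts j i 1 \<beta>) j = \<beta> j + 1" using assms by (simp add: move_parts_def)
  ultimately show ?thesis
    using shifts_move[OF assms] card_shifts[OF assms(1,2), of N g \<beta>] swap_count_sym[of S N g j i] by metis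
qed

lemma sum_cont: 
  assumes "finite S" "w \<in> words S N" shows "(\<Sum>i<N. cont S w i) = int (card S)"
proof -
  have "S = (\<Union>i<N. {x\<in>S. w x = i})" using assms by (auto simp: words_def)
  then have "card S = card (\<Union>i<N. {x\<in>S. w x = i})" by simp
  also have "\<dots> = (\<Sum>i<N. card {x\<in>S. w x = i})"
    using assms by (intro card_UN_disjoint) auto
  finally show ?thesis by (simp add: cont_def)
qed

lemma cont_beyond: "w \<in> words S N \<Longrightarrow> N \<le> i \<Longrightarrow> cont S w i = 0"
proof -
  assume "w \<in> words S N" "N \<le> i"
  then have "{x\<in>S. w x = i} = {}" by (auto simp: words_def dest: PiE_mem)
  then show ?thesis by (simp only: cont_def card.empty of_nat_0)
qed

text \<open>Transposing equal letters leaves a word unchanged, and the letter \<open>i\<close> has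
  \<open>\<beta> i * (\<beta> i - 1)\<close> ordered pairs of positions; pairs of different letters
  are the ones in \<open>swap_count\<close>.\<close>

lemma fix_count_transpose_sum:
  assumes "finite S" "g permutes S"
  shows "(\<Sum>(a, b) | a \<in> S \<and> b \<in> S \<and> a \<noteq> b. fix_count S N (Transposition.transpose a b \<circ> g) \<beta>)
    = (\<Sum>i<N. \<beta> i * (\<beta> i - 1)) * fix_count S N g \<beta>
      + (\<Sum>(i, j) | i < N \<and> j < N \<and> i \<noteq> j. swap_count S N g i j \<beta>)"
proof -
  define P where "P = {(a, b). a \<in> S \<and> b \<in> S \<and> a \<noteq> b}"
  have fP: "finite P" by (rule finite_subset[of _ "S \<times> S"]) (use assms in \<open>auto simp: P_def\<close>)
  define W where "W = {w\<in>words S N. cont S w = \<beta>}"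
  have fW: "finite W" using assms by (simp add: W_def)
  have fi: "(if w \<circ> h = w then 1 else 0 :: int) = of_bool (w \<circ> h = w)" for w h :: "nat \<Rightarrow> nat" by simp
  have fix_count: "fix_count S N h \<beta> = (\<Sum>w\<in>W. of_bool (w \<circ> h = w))" for h
  proof -
    have "{w\<in>fixw S N h. cont S w = \<beta>} = W \<inter> {w. w \<circ> h = w}" by (auto simp: fixw_def W_def)
    then show ?thesis using fW by (simp add: fix_count_def)
  qed
  have "(\<Sum>(a, b)\<in>P. fix_count S N (Transposition.transpose a b \<circ> g) \<beta>)
    = (\<Sum>(a, b)\<in>P. \<Sum>w\<in>W. of_bool (w \<circ> Transposition.transpose a b \<circ> g = w))"
    by (simp add: fix_count comp_assoc)
  also have "\<dots> = (\<Sum>w\<in>W. \<Sum>(a, b)\<in>P. of_bool (w \<circ> Transposition.transpose a b \<circ> g = w))"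
    unfolding case_prod_beta by (rule sum.swap)
  also have "\<dots> = (\<Sum>w\<in>W. (\<Sum>(a, b)\<in>P. of_bool (w a = w b \<and> w \<circ> g = w))
       + (\<Sum>(a, b)\<in>P. of_bool (w a \<noteq> w b \<and> w \<circ> Transposition.transpose a b \<circ> g = w)))"
    unfolding case_prod_beta sum.distrib[symmetric]
  proof (intro sum.cong refl)
    fix w :: "nat \<Rightarrow> nat" and p :: "nat \<times> nat"
    have "w \<circ> Transposition.transpose (fst p) (snd p) = w" if "w (fst p) = w (snd p)"
      using that by (auto simp: fun_eq_iff Transposition.transpose_def)
    then show "of_bool (w \<circ> Transposition.transpose (fst p) (snd p) \<circ> g = w)
      = (of_bool (w (fst p) = w (snd p) \<and> w \<circ> g = w)
      + of_bool (w (fst p) \<noteq> w (snd p) \<and> w \<circ> Transposition.transpose (fst p) (snd p) \<circ> g = w) :: int)"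
      by (cases "w (fst p) = w (snd p)") auto
  qed
  also have "\<dots> = (\<Sum>w\<in>W. of_bool (w \<circ> g = w) * (\<Sum>i<N. \<beta> i * (\<beta> i - 1)))
     + (\<Sum>w\<in>W. \<Sum>(i, j) | i < N \<and> j < N \<and> i \<noteq> j. \<Sum>(a, b)\<in>P.
          of_bool (w a = i \<and> w b = j \<and> w \<circ> Transposition.transpose a b \<circ> g = w))"
  proof -
    have 1: "(\<Sum>(a, b)\<in>P. of_bool (w a = w b \<and> w \<circ> g = w)) = of_bool (w \<circ> g = w) * (\<Sum>i<N. \<beta> i * (\<beta> i - 1))"
      if w: "w \<in> W" for w
    proof -
      have c: "card {x\<in>S. w x = i} = nat (\<beta> i)" "\<beta> i \<ge> 0" for i
        using w by (auto simp: W_def cont_def)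
      have "(\<Sum>(a, b)\<in>P. of_bool (w a = w b)) = int (card (P \<inter> {p. w (fst p) = w (snd p)}))"
        using fP by (simp add: case_prod_beta)
      also have "P \<inter> {p. w (fst p) = w (snd p)} = (\<Union>i<N. SIGMA a:{x\<in>S. w x = i}. {x\<in>S. w x = i} - {a})"
        using w by (auto simp: P_def W_def words_def)
      also have "int (card \<dots>) = int (\<Sum>i<N. card (SIGMA a:{x\<in>S. w x = i}. {x\<in>S. w x = i} - {a}))"
        using assms by (subst card_UN_disjoint) auto
      also have "\<dots> = (\<Sum>i<N. \<beta> i * (\<beta> i - 1))"
        unfolding of_nat_sum
      proof (rule sum.cong[OF refl])
        fix i
        have "card (SIGMA a:{x\<in>S. w x = i}. {x\<in>S. w x = i} - {a}) = (\<Sum>a\<in>{x\<in>S. w x = i}. nat (\<beta> i) - 1)"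
          using assms by (subst card_SigmaI) (auto simp: c)
        then show "int (card (SIGMA a:{x\<in>S. w x = i}. {x\<in>S. w x = i} - {a})) = \<beta> i * (\<beta> i - 1)"
          using c[of i] by (cases "\<beta> i = 0") (auto simp: of_nat_diff nat_diff_distrib)
      qed
      finally have *: "(\<Sum>(a, b)\<in>P. of_bool (w a = w b)) = (\<Sum>i<N. \<beta> i * (\<beta> i - 1))" .
      show ?thesis by (cases "w \<circ> g = w") (use * in auto)
    qed
    have 2: "(\<Sum>(a, b)\<in>P. of_bool (w a \<noteq> w b \<and> w \<circ> Transposition.transpose a b \<circ> g = w))
      = (\<Sum>(i, j) | i < N \<and> j < N \<and> i \<noteq> j. \<Sum>(a, b)\<in>P.
          of_bool (w a = i \<and> w b = j \<and> w \<circ> Transposition.transpose a b \<circ> g = w) :: int)"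
      if w: "w \<in> W" for w
    proof -
      have f: "finite {(i, j). i < N \<and> j < N \<and> i \<noteq> j}"
        by (rule finite_subset[of _ "{..<N} \<times> {..<N}"]) auto
      have "(\<Sum>p\<in>{(i, j). i < N \<and> j < N \<and> i \<noteq> j}. \<Sum>x\<in>P.
          of_bool (w (fst x) = fst p \<and> w (snd x) = snd p \<and> w \<circ> Transposition.transpose (fst x) (snd x) \<circ> g = w) :: int)
        = (\<Sum>x\<in>P. \<Sum>p\<in>{(i, j). i < N \<and> j < N \<and> i \<noteq> j}.
          of_bool (w (fst x) = fst p \<and> w (snd x) = snd p \<and> w \<circ> Transposition.transpose (fst x) (snd x) \<circ> g = w))"
        by (rule sum.swap)
      also have "\<dots> = (\<Sum>x\<in>P. of_bool (w (fst x) \<noteq> w (snd x) \<and> w \<circ> Transposition.transpose (fst x) (snd x) \<circ> g = w))"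
      proof (rule sum.cong[OF refl])
        fix x assume x: "x \<in> P"
        have lt: "w (fst x) < N" "w (snd x) < N" using x w by (auto simp: P_def W_def words_def)
        have "(\<Sum>p\<in>{(i, j). i < N \<and> j < N \<and> i \<noteq> j}.
          of_bool (w (fst x) = fst p \<and> w (snd x) = snd p \<and> w \<circ> Transposition.transpose (fst x) (snd x) \<circ> g = w) :: int)
          = (\<Sum>p\<in>{(i, j). i < N \<and> j < N \<and> i \<noteq> j}. if p = (w (fst x), w (snd x))
             then of_bool (w \<circ> Transposition.transpose (fst x) (snd x) \<circ> g = w) else 0)"
          by (rule sum.cong) auto
        also have "\<dots> = of_bool (w (fst x) \<noteq> w (snd x) \<and> w \<circ> Transposition.transpose (fst x) (snd x) \<circ> g = w)"
          using f lt by (simp add: sum.delta)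
        finally show "(\<Sum>p\<in>{(i, j). i < N \<and> j < N \<and> i \<noteq> j}.
          of_bool (w (fst x) = fst p \<and> w (snd x) = snd p \<and> w \<circ> Transposition.transpose (fst x) (snd x) \<circ> g = w) :: int)
          = of_bool (w (fst x) \<noteq> w (snd x) \<and> w \<circ> Transposition.transpose (fst x) (snd x) \<circ> g = w)" .
      qed
      finally show ?thesis by (simp add: case_prod_beta)
    qed
    show ?thesis by (simp only: sum.distrib) (simp add: 1 2)
  qed
  also have "(\<Sum>w\<in>W. of_bool (w \<circ> g = w) * (\<Sum>i<N. \<beta> i * (\<beta> i - 1)))
    = (\<Sum>i<N. \<beta> i * (\<beta> i - 1)) * fix_count S N g \<beta>"
    unfolding fix_count sum_distrib_right[symmetric] by (rule mult.commute)
  also have "(\<Sum>w\<in>W. \<Sum>(i, j) | i < N \<and> j < N \<and> i \<noteq> j. \<Sum>(a, b)\<in>P.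
          of_bool (w a = i \<and> w b = j \<and> w \<circ> Transposition.transpose a b \<circ> g = w))
     = (\<Sum>(i, j) | i < N \<and> j < N \<and> i \<noteq> j. swap_count S N g i j \<beta>)"
    unfolding case_prod_beta
  proof (subst sum.swap, rule sum.cong[OF refl])
    fix p assume "p \<in> {p. fst p < N \<and> snd p < N \<and> fst p \<noteq> snd p}"
    then have p: "fst p \<noteq> snd p" by auto
    have "(\<Sum>w\<in>W. \<Sum>x\<in>P. of_bool (w (fst x) = fst p \<and> w (snd x) = snd p \<and> w \<circ> Transposition.transpose (fst x) (snd x) \<circ> g = w) :: int)
      = (\<Sum>y\<in>P \<times> W. of_bool (snd y (fst (fst y)) = fst p \<and> snd y (snd (fst y)) = snd p \<and>
           snd y \<circ> Transposition.transpose (fst (fst y)) (snd (fst y)) \<circ> g = snd y))"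
      by (subst sum.swap) (simp add: sum.cartesian_product case_prod_beta)
    also have "\<dots> = int (card {y\<in>P \<times> W. snd y (fst (fst y)) = fst p \<and> snd y (snd (fst y)) = snd p \<and>
           snd y \<circ> Transposition.transpose (fst (fst y)) (snd (fst y)) \<circ> g = snd y})"
      using fP fW by (simp add: Int_def)
    also have "card {y\<in>P \<times> W. snd y (fst (fst y)) = fst p \<and> snd y (snd (fst y)) = snd p \<and>
           snd y \<circ> Transposition.transpose (fst (fst y)) (snd (fst y)) \<circ> g = snd y}
      = card {(a, b, w). a \<in> S \<and> b \<in> S \<and> w \<in> words S N \<and> cont S w = \<beta> \<and>
          w a = fst p \<and> w b = snd p \<and> w \<circ> Transposition.transpose a b \<circ> g = w}"
      by (rule bij_betw_same_card[OF bij_betw_byWitness[where f = "\<lambda>((a, b), w). (a, b, w)"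
          and f' = "\<lambda>(a, b, w). ((a, b), w)"]]) (use p in \<open>auto simp: P_def W_def\<close>)
    finally show "(\<Sum>w\<in>W. \<Sum>x\<in>P. of_bool (w (fst x) = fst p \<and> w (snd x) = snd p \<and> w \<circ> Transposition.transpose (fst x) (snd x) \<circ> g = w))
      = swap_count S N g (fst p) (snd p) \<beta>" by (simp only: swap_count_def)
  qed
  finally show ?thesis by (simp only: P_def)
qed

section \<open>The sum over transpositions\<close>

lemma sum_involution:
  fixes f :: "'a \<Rightarrow> int"
  assumes "\<And>x. x \<in> X \<Longrightarrow> h x \<in> X" "\<And>x. x \<in> X \<Longrightarrow> h (h x) = x" "\<And>x. x \<in> X \<Longrightarrow> f (h x) = - f x"
  shows "sum f X = 0"
proof -
  have "bij_betw h X X" by (rule bij_betw_byWitness[where f' = h]) (use assms in auto)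
  then have "sum f X = (\<Sum>x\<in>X. f (h x))" by (simp add: sum.reindex_bij_betw)
  also have "\<dots> = - sum f X" by (simp add: assms(3) sum_negf)
  finally show ?thesis by simp
qed

text \<open>What remains of the exponent \<open>\<gamma>\<close> once the term x^\<sigma> of a_delta
  is split off. The staircase delta is 0, 1, 2, ..., that is, \<open>int\<close>.\<close>

definition sub :: "(nat \<Rightarrow> int) \<Rightarrow> (nat \<Rightarrow> nat) \<Rightarrow> nat \<Rightarrow> int" where
  "sub \<gamma> \<sigma> = (\<lambda>i. \<gamma> i - int (\<sigma> i))"

lemma finite_sym_grp [simp]: "finite (sym_grp N)"
  by (simp add: sym_grp_def finite_permutations)

lemma sym_grp_transpose:
  "\<sigma> \<in> sym_grp N \<Longrightarrow> i < N \<Longrightarrow> j < N \<Longrightarrow> \<sigma> \<circ> Transposition.transpose i j \<in> sym_grp N"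
  by (simp add: sym_grp_def permutes_compose permutes_swap_id)

lemma sign_sym_grp_transpose:
  assumes "\<sigma> \<in> sym_grp N" "i \<noteq> j"
  shows "sign (\<sigma> \<circ> Transposition.transpose i j) = - sign \<sigma>"
proof -
  have "permutation \<sigma>" using assms(1) permutation_permutes[of \<sigma>] by (auto simp: sym_grp_def)
  then show ?thesis using assms(2) by (simp add: sign_compose permutation_swap_id sign_swap_id)
qed

text \<open>The intermediate terms of the telescoping sums of \<open>telescope\<close> below cancel: the second
  coordinate \<open>j\<close> is exchanged with the position at which \<open>\<sigma>\<close> takes the value that \<open>j\<close> reaches
  after the move.\<close>

lemma cancel_moves_fst:
  fixes \<pi> :: "(nat \<Rightarrow> int) \<Rightarrow> int" and N :: nat
  defines "X \<equiv> {(\<sigma>, i, j, s). \<sigma> \<in> sym_grp N \<and> i < N \<and> j < N \<and> 0 < s \<and> \<sigma> j + s < \<sigma> i}"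
  defines "\<eta> \<equiv> \<lambda>\<gamma> \<sigma> i j s. move_parts i j (int s) (sub \<gamma> \<sigma>)"
  shows "(\<Sum>(\<sigma>, i, j, s)\<in>X. sign \<sigma> * (\<eta> \<gamma> \<sigma> i j s i * \<pi> (\<eta> \<gamma> \<sigma> i j s))) = 0"
proof -
  define h :: "(nat \<Rightarrow> nat) \<times> nat \<times> nat \<times> nat \<Rightarrow> _" where "h = (\<lambda>(\<sigma>, i, j, s). let l = inv \<sigma> (\<sigma> j + s) in (\<sigma> \<circ> Transposition.transpose j l, i, l, s))"
  show ?thesis
  proof (rule sum_involution[where h = h])
  fix x assume "x \<in> X"
  then obtain \<sigma> i j s where x: "x = (\<sigma>, i, j, s)" "\<sigma> \<in> sym_grp N" "i < N" "j < N" "0 < s" "\<sigma> j + s < \<sigma> i"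
    by (auto simp: X_def)
  have p: "\<sigma> permutes {..<N}" using x by (simp add: sym_grp_def)
  note gp = permutes_inverses[OF p] permutes_in_image[OF p]
  define l where "l = inv \<sigma> (\<sigma> j + s)"
  have l: "\<sigma> l = \<sigma> j + s" by (simp add: l_def gp)
  have "\<sigma> i < N" using gp(3)[of i] x by simp
  then have "\<sigma> l < N" using l x by simp
  then have "l < N" using gp(3)[of l] by simp
  have ne: "i \<noteq> j" "l \<noteq> j" "l \<noteq> i" using x l by auto
  define \<tau> where "\<tau> = \<sigma> \<circ> Transposition.transpose j l"
  have \<tau>: "\<tau> \<in> sym_grp N" unfolding \<tau>_def using x \<open>l < N\<close> by (intro sym_grp_transpose)
  have \<tau>v: "\<tau> j = \<sigma> j + s" "\<tau> l = \<sigma> j" "\<tau> i = \<sigma> i" "\<And>m. m \<noteq> j \<Longrightarrow> m \<noteq> l \<Longrightarrow> \<tau> m = \<sigma> m"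
    using ne l by (auto simp: \<tau>_def Transposition.transpose_def)
  have hx: "h x = (\<tau>, i, l, s)" by (simp add: h_def x l_def \<tau>_def Let_def)
  show "h x \<in> X" unfolding hx using x \<tau> \<open>l < N\<close> by (simp add: X_def \<tau>v)
  have "inv \<tau> (\<tau> l + s) = j"
    using \<tau> \<tau>v by (metis (mono_tags) mem_Collect_eq permutes_inverses(2) sym_grp_def)
  moreover have "\<tau> \<circ> Transposition.transpose l j = \<sigma>"
    by (auto simp: \<tau>_def fun_eq_iff Transposition.transpose_def)
  ultimately show "h (h x) = x" by (simp add: hx) (simp add: h_def Let_def x)
  have "\<eta> \<gamma> \<tau> i l s = \<eta> \<gamma> \<sigma> i j s"
  proof
    fix m
    consider "m = i" | "m = j" | "m = l" | "m \<noteq> i" "m \<noteq> j" "m \<noteq> l" by blast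
    then show "\<eta> \<gamma> \<tau> i l s m = \<eta> \<gamma> \<sigma> i j s m"
      by cases (use ne l in \<open>auto simp: \<eta>_def move_parts_def sub_def \<tau>v\<close>)
  qed
  moreover have "sign \<tau> = - sign \<sigma>"
    unfolding \<tau>_def using x(2) ne by (intro sign_sym_grp_transpose) auto
  ultimately show "(case h x of (\<sigma>, i, j, s) \<Rightarrow> sign \<sigma> * (\<eta> \<gamma> \<sigma> i j s i * \<pi> (\<eta> \<gamma> \<sigma> i j s)))
      = - (case x of (\<sigma>, i, j, s) \<Rightarrow> sign \<sigma> * (\<eta> \<gamma> \<sigma> i j s i * \<pi> (\<eta> \<gamma> \<sigma> i j s)))"
    unfolding hx by (simp add: x(1))
  qed
qed

text \<open>Now the coordinate \<open>j\<close> has to stay, so \<open>i\<close> is exchanged with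
  the position at which \<open>\<sigma>\<close> takes the value
  \<open>\<sigma> i - s\<close>.\<close>

lemma cancel_moves_snd:
  fixes \<pi> :: "(nat \<Rightarrow> int) \<Rightarrow> int" and N :: nat
  defines "X \<equiv> {(\<sigma>, i, j, s). \<sigma> \<in> sym_grp N \<and> i < N \<and> j < N \<and> 0 < s \<and> \<sigma> j + s < \<sigma> i}"
  defines "\<eta> \<equiv> \<lambda>\<gamma> \<sigma> i j s. move_parts i j (int s) (sub \<gamma> \<sigma>)"
  shows "(\<Sum>(\<sigma>, i, j, s)\<in>X. sign \<sigma> * (\<eta> \<gamma> \<sigma> i j s j * \<pi> (\<eta> \<gamma> \<sigma> i j s))) = 0"
proof -
  define h :: "(nat \<Rightarrow> nat) \<times> nat \<times> nat \<times> nat \<Rightarrow> _" where "h = (\<lambda>(\<sigma>, i, j, s). let l = inv \<sigma> (\<sigma> i - s) in (\<sigma> \<circ> Transposition.transpose i l, l, j, s))"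
  show ?thesis
  proof (rule sum_involution[where h = h])
  fix x assume "x \<in> X"
  then obtain \<sigma> i j s where x: "x = (\<sigma>, i, j, s)" "\<sigma> \<in> sym_grp N" "i < N" "j < N" "0 < s" "\<sigma> j + s < \<sigma> i"
    by (auto simp: X_def)
  have p: "\<sigma> permutes {..<N}" using x by (simp add: sym_grp_def)
  note gp = permutes_inverses[OF p] permutes_in_image[OF p]
  define l where "l = inv \<sigma> (\<sigma> i - s)"
  have l: "\<sigma> l = \<sigma> i - s" by (simp add: l_def gp)
  have "\<sigma> i < N" using gp(3)[of i] x by simp
  then have "\<sigma> l < N" using l x by simp
  then have "l < N" using gp(3)[of l] by simp
  have ne: "i \<noteq> j" "l \<noteq> j" "l \<noteq> i" using x l by auto
  define \<tau> where "\<tau> = \<sigma> \<circ> Transposition.transpose i l"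
  have \<tau>: "\<tau> \<in> sym_grp N" unfolding \<tau>_def using x \<open>l < N\<close> by (intro sym_grp_transpose)
  have \<tau>v: "\<tau> i = \<sigma> i - s" "\<tau> l = \<sigma> i" "\<tau> j = \<sigma> j" "\<And>m. m \<noteq> i \<Longrightarrow> m \<noteq> l \<Longrightarrow> \<tau> m = \<sigma> m"
    using ne l by (auto simp: \<tau>_def Transposition.transpose_def)
  have hx: "h x = (\<tau>, l, j, s)" by (simp add: h_def x l_def \<tau>_def Let_def)
  show "h x \<in> X" unfolding hx using x \<tau> \<open>l < N\<close> by (simp add: X_def \<tau>v)
  have "inv \<tau> (\<tau> l - s) = i"
    using \<tau> \<tau>v by (metis (mono_tags) mem_Collect_eq permutes_inverses(2) sym_grp_def)
  moreover have "\<tau> \<circ> Transposition.transpose l i = \<sigma>"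
    by (auto simp: \<tau>_def fun_eq_iff Transposition.transpose_def)
  ultimately show "h (h x) = x" by (simp add: hx) (simp add: h_def Let_def x)
  have "\<eta> \<gamma> \<tau> l j s = \<eta> \<gamma> \<sigma> i j s"
  proof
    fix m
    have "int (\<sigma> i - s) = int (\<sigma> i) - int s" using x by simp
    moreover consider "m = i" | "m = j" | "m = l" | "m \<noteq> i" "m \<noteq> j" "m \<noteq> l" by blast
    ultimately show "\<eta> \<gamma> \<tau> l j s m = \<eta> \<gamma> \<sigma> i j s m"
      by cases (use ne l in \<open>auto simp: \<eta>_def move_parts_def sub_def \<tau>v\<close>)
  qed
  moreover have "sign \<tau> = - sign \<sigma>"
    unfolding \<tau>_def using x(2) ne by (intro sign_sym_grp_transpose) auto
  ultimately show "(case h x of (\<sigma>, i, j, s) \<Rightarrow> sign \<sigma> * (\<eta> \<gamma> \<sigma> i j s j * \<pi> (\<eta> \<gamma> \<sigma> i j s)))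
      = - (case x of (\<sigma>, i, j, s) \<Rightarrow> sign \<sigma> * (\<eta> \<gamma> \<sigma> i j s j * \<pi> (\<eta> \<gamma> \<sigma> i j s)))"
    unfolding hx by (simp add: x(1))
  qed
qed

lemma move_parts_mv: "i \<noteq> j \<Longrightarrow> move_parts j i s (move_parts i j t \<beta>) = move_parts i j (t - s) \<beta>"
  by (auto simp: move_parts_def fun_eq_iff)

lemma move_parts_0 [simp]: "move_parts i j 0 \<beta> = \<beta>"
  by (auto simp: move_parts_def fun_eq_iff)

text \<open>The recurrence is iterated along the \<open>d\<close> single steps that move
  \<open>d\<close> units from \<open>j\<close> to \<open>i\<close>.\<close>

lemma telescope:
  fixes \<pi> \<kappa> :: "(nat \<Rightarrow> int) \<Rightarrow> int"
  assumes "i \<noteq> j"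
    and move: "\<And>\<beta>. \<kappa> \<beta> + \<beta> i * \<pi> \<beta> = \<kappa> (move_parts j i 1 \<beta>) + (\<beta> j + 1) * \<pi> (move_parts j i 1 \<beta>)"
  shows "\<kappa> \<beta> - \<kappa> (move_parts i j (int d) \<beta>)
    = (\<Sum>s=1..d. (\<beta> i + int s) * \<pi> (move_parts i j (int s) \<beta>)) - (\<Sum>s<d. (\<beta> j - int s) * \<pi> (move_parts i j (int s) \<beta>))"
proof (induction d)
  case (Suc d)
  define \<beta>' where "\<beta>' = move_parts i j (int (Suc d)) \<beta>"
  have "\<kappa> \<beta>' + \<beta>' i * \<pi> \<beta>' = \<kappa> (move_parts i j (int d) \<beta>) + (\<beta>' j + 1) * \<pi> (move_parts i j (int d) \<beta>)"
    using move[of \<beta>'] assms(1) by (simp add: \<beta>'_def move_parts_mv)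
  moreover have "\<beta>' i = \<beta> i + int (Suc d)" "\<beta>' j + 1 = \<beta> j - int d"
    using assms(1) by (auto simp: \<beta>'_def move_parts_def)
  ultimately have "\<kappa> (move_parts i j (int d) \<beta>) - \<kappa> (move_parts i j (int (Suc d)) \<beta>)
     = (\<beta> i + int (Suc d)) * \<pi> (move_parts i j (int (Suc d)) \<beta>) - (\<beta> j - int d) * \<pi> (move_parts i j (int d) \<beta>)"
    by (simp add: \<beta>'_def)
  then show ?case using Suc by (simp add: algebra_simps)
qed simp

text \<open>The end points are separated from the interior \<open>0 < s < d\<close>; the interior
  terms are those that cancel in the signed sum over \<open>\<sigma>\<close>.\<close>

lemma telescope':
  fixes \<pi> \<kappa> :: "(nat \<Rightarrow> int) \<Rightarrow> int"
  assumes "i \<noteq> j" "0 < d"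
    and move: "\<And>\<beta>. \<kappa> \<beta> + \<beta> i * \<pi> \<beta> = \<kappa> (move_parts j i 1 \<beta>) + (\<beta> j + 1) * \<pi> (move_parts j i 1 \<beta>)"
  shows "\<kappa> \<beta> - \<kappa> (move_parts i j (int d) \<beta>)
    = (move_parts i j (int d) \<beta>) i * \<pi> (move_parts i j (int d) \<beta>) - \<beta> j * \<pi> \<beta>
     + (\<Sum>s\<in>{0<..<d}. (move_parts i j (int s) \<beta> i - move_parts i j (int s) \<beta> j) * \<pi> (move_parts i j (int s) \<beta>))"
proof -
  have "{1..d} = insert d {0<..<d}" "{..<d} = insert 0 {0<..<d}" using assms(2) by auto
  then have "\<kappa> \<beta> - \<kappa> (move_parts i j (int d) \<beta>)
    = (\<beta> i + int d) * \<pi> (move_parts i j (int d) \<beta>) - \<beta> j * \<pi> \<beta>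
     + ((\<Sum>s\<in>{0<..<d}. (\<beta> i + int s) * \<pi> (move_parts i j (int s) \<beta>)) - (\<Sum>s\<in>{0<..<d}. (\<beta> j - int s) * \<pi> (move_parts i j (int s) \<beta>)))"
    by (subst telescope[OF assms(1) move]) simp
  also have "(\<Sum>s\<in>{0<..<d}. (\<beta> i + int s) * \<pi> (move_parts i j (int s) \<beta>)) - (\<Sum>s\<in>{0<..<d}. (\<beta> j - int s) * \<pi> (move_parts i j (int s) \<beta>))
     = (\<Sum>s\<in>{0<..<d}. (move_parts i j (int s) \<beta> i - move_parts i j (int s) \<beta> j) * \<pi> (move_parts i j (int s) \<beta>))"
    using assms(1) by (simp add: move_parts_def algebra_simps flip: sum_subtractf)
  moreover have "move_parts i j (int d) \<beta> i = \<beta> i + int d" using assms(1) by (simp add: move_parts_def)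
  ultimately show ?thesis by (simp only:)
qed

lemma sub_transpose:
  assumes "i \<noteq> j" "\<sigma> j < \<sigma> i"
  shows "sub \<gamma> (\<sigma> \<circ> Transposition.transpose i j) = move_parts i j (int (\<sigma> i - \<sigma> j)) (sub \<gamma> \<sigma>)"
  using assms by (auto simp: sub_def move_parts_def fun_eq_iff Transposition.transpose_def of_nat_diff)

lemma bij_betw_sym_grp_transpose:
  assumes "i < N" "j < N"
  shows "bij_betw (\<lambda>\<sigma>. \<sigma> \<circ> Transposition.transpose i j) {\<sigma>\<in>sym_grp N. \<sigma> i < \<sigma> j} {\<sigma>\<in>sym_grp N. \<sigma> j < \<sigma> i}"
proof -
  have "\<sigma> \<circ> Transposition.transpose i j \<circ> Transposition.transpose i j = \<sigma>" for \<sigma> :: "nat \<Rightarrow> nat"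
    by (simp add: fun_eq_iff)
  then show ?thesis
    using assms
    by (intro bij_betw_byWitness[where f' = "\<lambda>\<sigma>. \<sigma> \<circ> Transposition.transpose i j"]) (auto simp: sym_grp_transpose)
qed

text \<open>Composing \<open>\<sigma>\<close> with the transposition of \<open>i\<close> and
  \<open>j\<close> reverses the sign and moves \<open>\<sigma> i - \<sigma> j\<close> units of
  \<open>sub \<gamma> \<sigma>\<close> from \<open>j\<close> to \<open>i\<close>. Each such pair of
  permutations is a telescoping difference.\<close>

lemma moves_sum_pair:
  fixes \<pi> \<kappa> :: "(nat \<Rightarrow> int) \<Rightarrow> int"
  assumes ij: "i \<noteq> j" "i < N" "j < N"
    and move: "\<And>\<beta>. \<kappa> \<beta> + \<beta> i * \<pi> \<beta> = \<kappa> (move_parts j i 1 \<beta>) + (\<beta> j + 1) * \<pi> (move_parts j i 1 \<beta>)"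
  shows "(\<Sum>\<sigma>\<in>sym_grp N. sign \<sigma> * \<kappa> (sub \<gamma> \<sigma>))
    = (\<Sum>\<sigma> | \<sigma> \<in> sym_grp N \<and> \<sigma> j < \<sigma> i. \<Sum>s\<in>{0<..<\<sigma> i - \<sigma> j}. sign \<sigma> *
         ((move_parts i j (int s) (sub \<gamma> \<sigma>) i - move_parts i j (int s) (sub \<gamma> \<sigma>) j) * \<pi> (move_parts i j (int s) (sub \<gamma> \<sigma>))))
      - (\<Sum>\<sigma>\<in>sym_grp N. sign \<sigma> * (of_bool (\<sigma> i < \<sigma> j) * sub \<gamma> \<sigma> i + of_bool (\<sigma> j < \<sigma> i) * sub \<gamma> \<sigma> j) * \<pi> (sub \<gamma> \<sigma>))"
proof -
  define P where "P = {\<sigma>\<in>sym_grp N. \<sigma> j < \<sigma> i}"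
  define M where "M = {\<sigma>\<in>sym_grp N. \<sigma> i < \<sigma> j}"
  have fin: "finite P" "finite M" by (auto simp: P_def M_def)
  have split: "sym_grp N = P \<union> M" "P \<inter> M = {}"
  proof -
    have "\<sigma> i \<noteq> \<sigma> j" if "\<sigma> \<in> sym_grp N" for \<sigma>
      using that ij permutes_inj[of \<sigma> "{..<N}"] by (auto simp: sym_grp_def inj_eq)
    then show "sym_grp N = P \<union> M" "P \<inter> M = {}" by (auto simp: P_def M_def neq_iff)
  qed
  have swap: "(\<Sum>\<sigma>\<in>M. sign \<sigma> * f (sub \<gamma> \<sigma>)) = - (\<Sum>\<sigma>\<in>P. sign \<sigma> * f (move_parts i j (int (\<sigma> i - \<sigma> j)) (sub \<gamma> \<sigma>)))"
    for f :: "(nat \<Rightarrow> int) \<Rightarrow> int"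
  proof -
    have "(\<Sum>\<sigma>\<in>M. sign \<sigma> * f (sub \<gamma> \<sigma>)) = (\<Sum>\<sigma>\<in>P. sign (\<sigma> \<circ> Transposition.transpose i j) * f (sub \<gamma> (\<sigma> \<circ> Transposition.transpose i j)))"
      using sum.reindex_bij_betw[OF bij_betw_sym_grp_transpose[OF ij(3,2)], of "\<lambda>\<sigma>. sign \<sigma> * f (sub \<gamma> \<sigma>)"]
      by (simp add: P_def M_def transpose_commute)
    also have "\<dots> = (\<Sum>\<sigma>\<in>P. - (sign \<sigma> * f (move_parts i j (int (\<sigma> i - \<sigma> j)) (sub \<gamma> \<sigma>))))"
      using ij by (intro sum.cong refl) (auto simp: P_def sign_sym_grp_transpose sub_transpose)
    finally show ?thesis by (simp only: sum_negf)
  qed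
  have "(\<Sum>\<sigma>\<in>sym_grp N. sign \<sigma> * \<kappa> (sub \<gamma> \<sigma>))
    = (\<Sum>\<sigma>\<in>P. sign \<sigma> * \<kappa> (sub \<gamma> \<sigma>)) + (\<Sum>\<sigma>\<in>M. sign \<sigma> * \<kappa> (sub \<gamma> \<sigma>))"
    unfolding split(1) using fin split(2) by (rule sum.union_disjoint)
  also have "\<dots> = (\<Sum>\<sigma>\<in>P. sign \<sigma> * (\<kappa> (sub \<gamma> \<sigma>) - \<kappa> (move_parts i j (int (\<sigma> i - \<sigma> j)) (sub \<gamma> \<sigma>))))"
    by (simp add: swap right_diff_distrib sum_subtractf)
  also have "\<dots> = (\<Sum>\<sigma>\<in>P. sign \<sigma> * ((move_parts i j (int (\<sigma> i - \<sigma> j)) (sub \<gamma> \<sigma>)) i * \<pi> (move_parts i j (int (\<sigma> i - \<sigma> j)) (sub \<gamma> \<sigma>)) - sub \<gamma> \<sigma> j * \<pi> (sub \<gamma> \<sigma>)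
     + (\<Sum>s\<in>{0<..<\<sigma> i - \<sigma> j}. (move_parts i j (int s) (sub \<gamma> \<sigma>) i - move_parts i j (int s) (sub \<gamma> \<sigma>) j) * \<pi> (move_parts i j (int s) (sub \<gamma> \<sigma>)))))"
    by (intro sum.cong refl arg_cong2[where f = "(*)"] telescope'[OF ij(1) _ move]) (auto simp: P_def)
  also have "\<dots> = (\<Sum>\<sigma>\<in>P. sign \<sigma> * ((move_parts i j (int (\<sigma> i - \<sigma> j)) (sub \<gamma> \<sigma>)) i * \<pi> (move_parts i j (int (\<sigma> i - \<sigma> j)) (sub \<gamma> \<sigma>))))
     - (\<Sum>\<sigma>\<in>P. sign \<sigma> * (sub \<gamma> \<sigma> j * \<pi> (sub \<gamma> \<sigma>)))
     + (\<Sum>\<sigma>\<in>P. \<Sum>s\<in>{0<..<\<sigma> i - \<sigma> j}. sign \<sigma> * ((move_parts i j (int s) (sub \<gamma> \<sigma>) i - move_parts i j (int s) (sub \<gamma> \<sigma>) j) * \<pi> (move_parts i j (int s) (sub \<gamma> \<sigma>))))"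
    by (simp add: distrib_left right_diff_distrib sum.distrib sum_subtractf sum_distrib_left)
  also have "(\<Sum>\<sigma>\<in>P. sign \<sigma> * ((move_parts i j (int (\<sigma> i - \<sigma> j)) (sub \<gamma> \<sigma>)) i * \<pi> (move_parts i j (int (\<sigma> i - \<sigma> j)) (sub \<gamma> \<sigma>))))
     = - (\<Sum>\<sigma>\<in>M. sign \<sigma> * (sub \<gamma> \<sigma> i * \<pi> (sub \<gamma> \<sigma>)))"
    using swap[of "\<lambda>\<beta>. \<beta> i * \<pi> \<beta>"] by simp
  also have "- (\<Sum>\<sigma>\<in>M. sign \<sigma> * (sub \<gamma> \<sigma> i * \<pi> (sub \<gamma> \<sigma>))) - (\<Sum>\<sigma>\<in>P. sign \<sigma> * (sub \<gamma> \<sigma> j * \<pi> (sub \<gamma> \<sigma>)))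
    = - (\<Sum>\<sigma>\<in>sym_grp N. sign \<sigma> * (of_bool (\<sigma> i < \<sigma> j) * sub \<gamma> \<sigma> i + of_bool (\<sigma> j < \<sigma> i) * sub \<gamma> \<sigma> j) * \<pi> (sub \<gamma> \<sigma>))"
  proof -
    let ?F = "\<lambda>\<sigma>. sign \<sigma> * (of_bool (\<sigma> i < \<sigma> j) * sub \<gamma> \<sigma> i + of_bool (\<sigma> j < \<sigma> i) * sub \<gamma> \<sigma> j) * \<pi> (sub \<gamma> \<sigma>)"
    have "sum ?F (sym_grp N) = sum ?F P + sum ?F M"
      unfolding split(1) using fin split(2) by (rule sum.union_disjoint)
    moreover have "sum ?F P = (\<Sum>\<sigma>\<in>P. sign \<sigma> * (sub \<gamma> \<sigma> j * \<pi> (sub \<gamma> \<sigma>)))"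
      by (rule sum.cong) (auto simp: P_def)
    moreover have "sum ?F M = (\<Sum>\<sigma>\<in>M. sign \<sigma> * (sub \<gamma> \<sigma> i * \<pi> (sub \<gamma> \<sigma>)))"
      by (rule sum.cong) (auto simp: M_def)
    ultimately show ?thesis by simp
  qed
  finally show ?thesis by (simp add: P_def)
qed

definition offdiag :: "nat \<Rightarrow> (nat \<times> nat) set" where
  "offdiag N = {(i, j). i < N \<and> j < N \<and> i \<noteq> j}"

lemma finite_offdiag [simp]: "finite (offdiag N)"
  by (rule finite_subset[of _ "{..<N} \<times> {..<N}"]) (auto simp: offdiag_def)

lemma sum_offdiag: "(\<Sum>(i, j)\<in>offdiag N. f i j) = (\<Sum>i<N. \<Sum>j\<in>{..<N}-{i}. f i j)"
proof -
  have "offdiag N = (SIGMA i:{..<N}. {..<N} - {i})" by (auto simp: offdiag_def)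
  then show ?thesis by (simp add: sum.Sigma)
qed

lemma sum_offdiag_swap: "(\<Sum>(i, j)\<in>offdiag N. f i j) = (\<Sum>(i, j)\<in>offdiag N. f j i)"
  by (rule sum.reindex_bij_witness[of _ prod.swap prod.swap]) (auto simp: offdiag_def)

lemma card_greater_perm:
  assumes "\<sigma> \<in> sym_grp N" "i < N"
  shows "int (card {j\<in>{..<N}-{i}. \<sigma> i < \<sigma> j}) = int N - 1 - int (\<sigma> i)"
proof -
  have p: "\<sigma> permutes {..<N}" using assms by (simp add: sym_grp_def)
  have "bij_betw \<sigma> {j\<in>{..<N}-{i}. \<sigma> i < \<sigma> j} {\<sigma> i<..<N}"
    using permutes_in_image[OF p] permutes_inverses[OF p] permutes_in_image[OF permutes_inv[OF p]]
    by (intro bij_betw_byWitness[where f' = "inv \<sigma>"]) auto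
  moreover have "\<sigma> i < N" using permutes_in_image[OF p, of i] assms by simp
  ultimately show ?thesis by (simp add: bij_betw_same_card of_nat_diff)
qed

text \<open>Only end points survive. A pair of coordinates contributes the one at which
  \<open>\<sigma>\<close> is smaller, and \<open>N - 1 - \<sigma> i\<close> values exceed
  \<open>\<sigma> i\<close>; the factor 2 comes from ordered pairs.\<close>

lemma moves_sum:
  fixes \<pi> :: "(nat \<Rightarrow> int) \<Rightarrow> int" and \<kappa> :: "nat \<Rightarrow> nat \<Rightarrow> (nat \<Rightarrow> int) \<Rightarrow> int"
  assumes move: "\<And>i j \<beta>. i \<noteq> j \<Longrightarrow> i < N \<Longrightarrow> j < N \<Longrightarrow>
    \<kappa> i j \<beta> + \<beta> i * \<pi> \<beta> = \<kappa> i j (move_parts j i 1 \<beta>) + (\<beta> j + 1) * \<pi> (move_parts j i 1 \<beta>)"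
  shows "(\<Sum>\<sigma>\<in>sym_grp N. sign \<sigma> * (\<Sum>(i, j)\<in>offdiag N. \<kappa> i j (sub \<gamma> \<sigma>)))
    = - 2 * (\<Sum>\<sigma>\<in>sym_grp N. sign \<sigma> * (\<Sum>i<N. sub \<gamma> \<sigma> i * (int N - 1 - int (\<sigma> i))) * \<pi> (sub \<gamma> \<sigma>))"
proof -
  define Z where "Z i j \<sigma> s = sign \<sigma> *
         ((move_parts i j (int s) (sub \<gamma> \<sigma>) i - move_parts i j (int s) (sub \<gamma> \<sigma>) j) * \<pi> (move_parts i j (int s) (sub \<gamma> \<sigma>)))" for i j \<sigma> s
  define B where "B i j \<sigma> = of_bool (\<sigma> i < \<sigma> j) * sub \<gamma> \<sigma> i + of_bool (\<sigma> j < \<sigma> i) * sub \<gamma> \<sigma> j" for i j and \<sigma> :: "nat \<Rightarrow> nat"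
  have "(\<Sum>\<sigma>\<in>sym_grp N. sign \<sigma> * (\<Sum>(i, j)\<in>offdiag N. \<kappa> i j (sub \<gamma> \<sigma>)))
    = (\<Sum>(i, j)\<in>offdiag N. \<Sum>\<sigma>\<in>sym_grp N. sign \<sigma> * \<kappa> i j (sub \<gamma> \<sigma>))"
    unfolding sum_distrib_left case_prod_beta by (rule sum.swap)
  also have "\<dots> = (\<Sum>(i, j)\<in>offdiag N. (\<Sum>\<sigma> | \<sigma> \<in> sym_grp N \<and> \<sigma> j < \<sigma> i. \<Sum>s\<in>{0<..<\<sigma> i - \<sigma> j}. Z i j \<sigma> s)
      - (\<Sum>\<sigma>\<in>sym_grp N. sign \<sigma> * B i j \<sigma> * \<pi> (sub \<gamma> \<sigma>)))"
    unfolding Z_def B_def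
    by (rule sum.cong[OF refl]) (auto simp: offdiag_def intro!: moves_sum_pair move)
  also have "\<dots> = (\<Sum>(i, j)\<in>offdiag N. \<Sum>\<sigma> | \<sigma> \<in> sym_grp N \<and> \<sigma> j < \<sigma> i. \<Sum>s\<in>{0<..<\<sigma> i - \<sigma> j}. Z i j \<sigma> s)
      - (\<Sum>(i, j)\<in>offdiag N. \<Sum>\<sigma>\<in>sym_grp N. sign \<sigma> * B i j \<sigma> * \<pi> (sub \<gamma> \<sigma>))"
    by (simp add: case_prod_beta sum_subtractf)
  also have "(\<Sum>(i, j)\<in>offdiag N. \<Sum>\<sigma> | \<sigma> \<in> sym_grp N \<and> \<sigma> j < \<sigma> i. \<Sum>s\<in>{0<..<\<sigma> i - \<sigma> j}. Z i j \<sigma> s) = 0"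
  proof -
    define X where "X = {(\<sigma>, i, j, s). \<sigma> \<in> sym_grp N \<and> i < N \<and> j < N \<and> 0 < s \<and> \<sigma> j + s < \<sigma> i}"
    have "(\<Sum>(i, j)\<in>offdiag N. \<Sum>\<sigma> | \<sigma> \<in> sym_grp N \<and> \<sigma> j < \<sigma> i. \<Sum>s\<in>{0<..<\<sigma> i - \<sigma> j}. Z i j \<sigma> s)
      = (\<Sum>(p, \<sigma>, s)\<in>(SIGMA p:offdiag N. SIGMA \<sigma>:{\<sigma>\<in>sym_grp N. \<sigma> (snd p) < \<sigma> (fst p)}. {0<..<\<sigma> (fst p) - \<sigma> (snd p)}).
           Z (fst p) (snd p) \<sigma> s)"
      by (simp add: sum.Sigma case_prod_beta)
    also have "\<dots> = (\<Sum>(\<sigma>, i, j, s)\<in>X. Z i j \<sigma> s)"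
      by (rule sum.reindex_bij_witness[of _ "\<lambda>(\<sigma>, i, j, s). ((i, j), \<sigma>, s)" "\<lambda>(p, \<sigma>, s). (\<sigma>, fst p, snd p, s)"])
        (auto simp: X_def offdiag_def)
    also have "\<dots> = (\<Sum>(\<sigma>, i, j, s)\<in>X. sign \<sigma> * (move_parts i j (int s) (sub \<gamma> \<sigma>) i * \<pi> (move_parts i j (int s) (sub \<gamma> \<sigma>))))
       - (\<Sum>(\<sigma>, i, j, s)\<in>X. sign \<sigma> * (move_parts i j (int s) (sub \<gamma> \<sigma>) j * \<pi> (move_parts i j (int s) (sub \<gamma> \<sigma>))))"
      unfolding sum_subtractf[symmetric]
      by (rule sum.cong) (auto simp: Z_def left_diff_distrib right_diff_distrib)
    also have "\<dots> = 0"
      unfolding X_def cancel_moves_fst cancel_moves_snd by simp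
    finally show ?thesis .
  qed
  also have "(\<Sum>(i, j)\<in>offdiag N. \<Sum>\<sigma>\<in>sym_grp N. sign \<sigma> * B i j \<sigma> * \<pi> (sub \<gamma> \<sigma>))
    = (\<Sum>\<sigma>\<in>sym_grp N. sign \<sigma> * (\<Sum>(i, j)\<in>offdiag N. B i j \<sigma>) * \<pi> (sub \<gamma> \<sigma>))"
    unfolding sum_distrib_left sum_distrib_right case_prod_beta by (rule sum.swap)
  also have "\<dots> = (\<Sum>\<sigma>\<in>sym_grp N. sign \<sigma> * (2 * (\<Sum>i<N. sub \<gamma> \<sigma> i * (int N - 1 - int (\<sigma> i)))) * \<pi> (sub \<gamma> \<sigma>))"
  proof (intro sum.cong refl arg_cong2[where f = "(*)"])
    fix \<sigma> assume \<sigma>: "\<sigma> \<in> sym_grp N"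
    have "(\<Sum>(i, j)\<in>offdiag N. B i j \<sigma>)
      = (\<Sum>(i, j)\<in>offdiag N. of_bool (\<sigma> i < \<sigma> j) * sub \<gamma> \<sigma> i) + (\<Sum>(i, j)\<in>offdiag N. of_bool (\<sigma> j < \<sigma> i) * sub \<gamma> \<sigma> j)"
      by (simp add: B_def case_prod_beta sum.distrib)
    also have "(\<Sum>(i, j)\<in>offdiag N. of_bool (\<sigma> j < \<sigma> i) * sub \<gamma> \<sigma> j) = (\<Sum>(i, j)\<in>offdiag N. of_bool (\<sigma> i < \<sigma> j) * sub \<gamma> \<sigma> i)"
      by (rule sum_offdiag_swap)
    also have "(\<Sum>(i, j)\<in>offdiag N. of_bool (\<sigma> i < \<sigma> j) * sub \<gamma> \<sigma> i) = (\<Sum>i<N. sub \<gamma> \<sigma> i * (int N - 1 - int (\<sigma> i)))"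
      unfolding sum_offdiag
    proof (rule sum.cong[OF refl])
      fix i assume "i \<in> {..<N}"
      then have "int (card {j\<in>{..<N}-{i}. \<sigma> i < \<sigma> j}) = int N - 1 - int (\<sigma> i)"
        using card_greater_perm[OF \<sigma>] by simp
      moreover have "(\<Sum>j\<in>{..<N}-{i}. of_bool (\<sigma> i < \<sigma> j)) = int (card {j\<in>{..<N}-{i}. \<sigma> i < \<sigma> j})"
        by (simp add: Int_def)
      ultimately show "(\<Sum>j\<in>{..<N}-{i}. of_bool (\<sigma> i < \<sigma> j) * sub \<gamma> \<sigma> i) = sub \<gamma> \<sigma> i * (int N - 1 - int (\<sigma> i))"
        by (simp flip: sum_distrib_right)
    qed
    finally show "(\<Sum>(i, j)\<in>offdiag N. B i j \<sigma>) = 2 * (\<Sum>i<N. sub \<gamma> \<sigma> i * (int N - 1 - int (\<sigma> i)))" by simp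
  qed
  also have "\<dots> = 2 * (\<Sum>\<sigma>\<in>sym_grp N. sign \<sigma> * (\<Sum>i<N. sub \<gamma> \<sigma> i * (int N - 1 - int (\<sigma> i))) * \<pi> (sub \<gamma> \<sigma>))"
    unfolding sum_distrib_left[of 2 _ "sym_grp N"] by (rule sum.cong) simp_all
  finally show ?thesis by simp
qed

text \<open>The coefficient of \<open>x\<^sup>\<gamma>\<close> in \<open>a\<^sub>\<delta>\<close> times the power sum product of the cycle type
  of \<open>g\<close>, in \<open>N\<close> variables.\<close>

definition psi :: "nat set \<Rightarrow> nat \<Rightarrow> (nat \<Rightarrow> nat) \<Rightarrow> (nat \<Rightarrow> int) \<Rightarrow> int" where
  "psi S N g \<gamma> = (\<Sum>\<sigma>\<in>sym_grp N. sign \<sigma> * fix_count S N g (sub \<gamma> \<sigma>))"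

lemma fix_count_nonzero:
  assumes "finite S" "fix_count S N g \<beta> \<noteq> 0"
  obtains w where "w \<in> fixw S N g" "cont S w = \<beta>"
  using assms by (auto simp: fix_count_def)

lemma sum_sym_grp:
  assumes "\<sigma> \<in> sym_grp N" shows "(\<Sum>i<N. f (\<sigma> i)) = (\<Sum>i<N. f i)"
  using assms sum.permute[of \<sigma> "{..<N}" f] by (simp add: sym_grp_def comp_def)

text \<open>With \<open>\<beta> = \<gamma> - \<sigma>\<close> the two contributions combine to the
  sum of \<gamma>^2 - \<sigma>^2 - (2 N - 1) \<beta>. The squares of a permutation have a fixed sum
  and \<beta> sums to \<open>card S\<close>, so \<open>\<sigma>\<close> drops out and
  \<open>psi\<close> satisfies an eigenvalue equation.\<close>

lemma psi_transpose_sum: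
  assumes "finite S" "g permutes S"
  shows "(\<Sum>(a, b) | a \<in> S \<and> b \<in> S \<and> a \<noteq> b. psi S N (Transposition.transpose a b \<circ> g) \<gamma>)
    = ((\<Sum>i<N. (\<gamma> i)^2) - (\<Sum>i<N. (int i)^2) - (2 * int N - 1) * int (card S)) * psi S N g \<gamma>"
proof -
  have "(\<Sum>(a, b) | a \<in> S \<and> b \<in> S \<and> a \<noteq> b. psi S N (Transposition.transpose a b \<circ> g) \<gamma>)
    = (\<Sum>\<sigma>\<in>sym_grp N. sign \<sigma> * (\<Sum>(a, b) | a \<in> S \<and> b \<in> S \<and> a \<noteq> b. fix_count S N (Transposition.transpose a b \<circ> g) (sub \<gamma> \<sigma>)))"
    unfolding psi_def case_prod_beta sum_distrib_left by (rule sum.swap)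
  also have "\<dots> = (\<Sum>\<sigma>\<in>sym_grp N. sign \<sigma> * ((\<Sum>i<N. sub \<gamma> \<sigma> i * (sub \<gamma> \<sigma> i - 1)) * fix_count S N g (sub \<gamma> \<sigma>)))
     + (\<Sum>\<sigma>\<in>sym_grp N. sign \<sigma> * (\<Sum>(i, j)\<in>offdiag N. swap_count S N g i j (sub \<gamma> \<sigma>)))"
    by (simp only: fix_count_transpose_sum[OF assms] distrib_left sum.distrib offdiag_def)
  also have "(\<Sum>\<sigma>\<in>sym_grp N. sign \<sigma> * (\<Sum>(i, j)\<in>offdiag N. swap_count S N g i j (sub \<gamma> \<sigma>)))
     = - 2 * (\<Sum>\<sigma>\<in>sym_grp N. sign \<sigma> * (\<Sum>i<N. sub \<gamma> \<sigma> i * (int N - 1 - int (\<sigma> i))) * fix_count S N g (sub \<gamma> \<sigma>))"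
    using swap_count_move[OF assms(1) _ _ _ assms(2)] by (intro moves_sum) auto
  also have "(\<Sum>\<sigma>\<in>sym_grp N. sign \<sigma> * ((\<Sum>i<N. sub \<gamma> \<sigma> i * (sub \<gamma> \<sigma> i - 1)) * fix_count S N g (sub \<gamma> \<sigma>))) + \<dots>
    = (\<Sum>\<sigma>\<in>sym_grp N. sign \<sigma> * (((\<Sum>i<N. sub \<gamma> \<sigma> i * (sub \<gamma> \<sigma> i - 1)) -
         2 * (\<Sum>i<N. sub \<gamma> \<sigma> i * (int N - 1 - int (\<sigma> i)))) * fix_count S N g (sub \<gamma> \<sigma>)))"
    by (simp add: sum_distrib_left algebra_simps flip: sum.distrib sum_subtractf)
  also have "\<dots> = (\<Sum>\<sigma>\<in>sym_grp N. ((\<Sum>i<N. (\<gamma> i)^2) - (\<Sum>i<N. (int i)^2) - (2 * int N - 1) * int (card S)) *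
      (sign \<sigma> * fix_count S N g (sub \<gamma> \<sigma>)))"
  proof (rule sum.cong[OF refl])
    fix \<sigma> assume \<sigma>: "\<sigma> \<in> sym_grp N"
    show "sign \<sigma> * (((\<Sum>i<N. sub \<gamma> \<sigma> i * (sub \<gamma> \<sigma> i - 1)) -
         2 * (\<Sum>i<N. sub \<gamma> \<sigma> i * (int N - 1 - int (\<sigma> i)))) * fix_count S N g (sub \<gamma> \<sigma>))
      = ((\<Sum>i<N. (\<gamma> i)^2) - (\<Sum>i<N. (int i)^2) - (2 * int N - 1) * int (card S)) *
      (sign \<sigma> * fix_count S N g (sub \<gamma> \<sigma>))"
    proof (cases "fix_count S N g (sub \<gamma> \<sigma>) = 0")
      case False
      then obtain w where "w \<in> words S N" "cont S w = sub \<gamma> \<sigma>"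
        using assms by (auto simp: fixw_def elim!: fix_count_nonzero)
      then have s: "(\<Sum>i<N. sub \<gamma> \<sigma> i) = int (card S)"
        using sum_cont[OF assms(1), of w N] by simp
      have "(\<Sum>i<N. sub \<gamma> \<sigma> i * (sub \<gamma> \<sigma> i - 1)) - 2 * (\<Sum>i<N. sub \<gamma> \<sigma> i * (int N - 1 - int (\<sigma> i)))
        = (\<Sum>i<N. (\<gamma> i)^2 - (int (\<sigma> i))^2 - (2 * int N - 1) * sub \<gamma> \<sigma> i)"
        unfolding sum_distrib_left sum_subtractf[symmetric]
        by (rule sum.cong) (auto simp: sub_def algebra_simps power2_eq_square)
      also have "\<dots> = (\<Sum>i<N. (\<gamma> i)^2) - (\<Sum>i<N. (int (\<sigma> i))^2) - (2 * int N - 1) * (\<Sum>i<N. sub \<gamma> \<sigma> i)"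
        by (simp add: sum_subtractf sum_distrib_left)
      also have "\<dots> = (\<Sum>i<N. (\<gamma> i)^2) - (\<Sum>i<N. (int i)^2) - (2 * int N - 1) * int (card S)"
        using sum_sym_grp[OF \<sigma>, of "\<lambda>i. (int i)^2"] by (simp add: s)
      finally show ?thesis by simp
    qed simp
  qed
  finally show ?thesis by (simp only: psi_def sum_distrib_left)
qed

section \<open>Lowering operators\<close>

text \<open>The coefficient of x^\<gamma> in the alternant with exponent vector
  \<open>\<mu>\<close>.\<close>

definition alternant :: "nat \<Rightarrow> (nat \<Rightarrow> int) \<Rightarrow> (nat \<Rightarrow> int) \<Rightarrow> int" where
  "alternant N \<mu> \<gamma> = (\<Sum>\<sigma>\<in>sym_grp N. if \<gamma> = \<mu> \<circ> \<sigma> then sign \<sigma> else 0)"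

definition antisym_fun :: "nat \<Rightarrow> ((nat \<Rightarrow> int) \<Rightarrow> int) \<Rightarrow> bool" where
  "antisym_fun N f \<longleftrightarrow> (\<forall>\<rho>\<in>sym_grp N. \<forall>\<gamma>. f (\<gamma> \<circ> \<rho>) = sign \<rho> * f \<gamma>)"

text \<open>In contrast to \<open>permutes\<close>, \<open>g\<close> may move points outside
  \<open>S\<close>, so the same \<open>g\<close> remains in use after cycles have been removed from
  \<open>S\<close>.\<close>

definition stable :: "(nat \<Rightarrow> nat) \<Rightarrow> nat set \<Rightarrow> bool" where
  "stable g S \<longleftrightarrow> (\<forall>x. g x \<in> S \<longleftrightarrow> x \<in> S)"

text \<open>On coefficient functions, the adjoint of multiplication by the \<open>k\<close>-th power sum.\<close>

definition Yop :: "nat \<Rightarrow> nat \<Rightarrow> ((nat \<Rightarrow> int) \<Rightarrow> int) \<Rightarrow> (nat \<Rightarrow> int) \<Rightarrow> int" where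
  "Yop N k f \<gamma> = (\<Sum>i<N. f (\<gamma>(i := \<gamma> i + int k)))"

definition orbs :: "(nat \<Rightarrow> nat) \<Rightarrow> nat set \<Rightarrow> nat set set" where
  "orbs g S = orbit g ` S"

lemma sym_grp_permutation: "\<sigma> \<in> sym_grp N \<Longrightarrow> permutation \<sigma>"
  using permutation_permutes[of \<sigma>] by (auto simp: sym_grp_def)

lemma sym_grp_comp: "\<sigma> \<in> sym_grp N \<Longrightarrow> \<tau> \<in> sym_grp N \<Longrightarrow> \<sigma> \<circ> \<tau> \<in> sym_grp N"
  by (simp add: sym_grp_def permutes_compose)

lemma sign_sym_grp_comp: "\<sigma> \<in> sym_grp N \<Longrightarrow> \<tau> \<in> sym_grp N \<Longrightarrow> sign (\<sigma> \<circ> \<tau>) = sign \<sigma> * sign \<tau>"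
  by (simp add: sign_compose sym_grp_permutation)

lemma sym_grp_surj: "\<rho> \<in> sym_grp N \<Longrightarrow> surj \<rho>"
  by (simp add: sym_grp_def permutes_surj)

lemma sum_sym_grp_right: "\<rho> \<in> sym_grp N \<Longrightarrow> (\<Sum>\<sigma>\<in>sym_grp N. f \<sigma>) = (\<Sum>\<sigma>\<in>sym_grp N. f (\<sigma> \<circ> \<rho>))"
  using sum_permutations_compose_right[of \<rho> "{..<N}" f] by (simp add: sym_grp_def)

lemma sum_sym_grp_left: "\<rho> \<in> sym_grp N \<Longrightarrow> (\<Sum>\<sigma>\<in>sym_grp N. f \<sigma>) = (\<Sum>\<sigma>\<in>sym_grp N. f (\<rho> \<circ> \<sigma>))"
  using setum_permutations_compose_left[of \<rho> "{..<N}" f] by (simp add: sym_grp_def)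

lemma comp_right_cancel: "surj \<rho> \<Longrightarrow> a \<circ> \<rho> = b \<circ> \<rho> \<longleftrightarrow> a = b"
  by (auto simp: fun_eq_iff) (metis surjD)

lemma antisym_alternant: "antisym_fun N (alternant N \<mu>)"
  unfolding antisym_fun_def
proof (intro ballI allI)
  fix \<rho> \<gamma> assume \<rho>: "\<rho> \<in> sym_grp N"
  have "alternant N \<mu> (\<gamma> \<circ> \<rho>) = (\<Sum>\<sigma>\<in>sym_grp N. if \<gamma> \<circ> \<rho> = \<mu> \<circ> \<sigma> \<circ> \<rho> then sign (\<sigma> \<circ> \<rho>) else 0)"
    unfolding alternant_def by (subst sum_sym_grp_right[OF \<rho>]) (simp add: o_assoc)
  also have "\<dots> = (\<Sum>\<sigma>\<in>sym_grp N. sign \<rho> * (if \<gamma> = \<mu> \<circ> \<sigma> then sign \<sigma> else 0))"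
    using \<rho> by (intro sum.cong refl) (simp add: comp_right_cancel[OF sym_grp_surj] sign_sym_grp_comp)
  finally show "alternant N \<mu> (\<gamma> \<circ> \<rho>) = sign \<rho> * alternant N \<mu> \<gamma>"
    by (simp only: alternant_def sum_distrib_left)
qed

lemma alternant_permute: 
  assumes \<rho>: "\<rho> \<in> sym_grp N" shows "alternant N (\<mu> \<circ> \<rho>) \<gamma> = sign \<rho> * alternant N \<mu> \<gamma>"
proof -
  have "alternant N \<mu> \<gamma> = (\<Sum>\<sigma>\<in>sym_grp N. if \<gamma> = \<mu> \<circ> \<rho> \<circ> \<sigma> then sign (\<rho> \<circ> \<sigma>) else 0)"
    unfolding alternant_def by (subst sum_sym_grp_left[OF \<rho>]) (simp add: o_assoc)
  also have "\<dots> = (\<Sum>\<sigma>\<in>sym_grp N. sign \<rho> * (if \<gamma> = \<mu> \<circ> \<rho> \<circ> \<sigma> then sign \<sigma> else 0))"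
    using \<rho> by (intro sum.cong refl) (simp add: sign_sym_grp_comp)
  also have "\<dots> = sign \<rho> * alternant N (\<mu> \<circ> \<rho>) \<gamma>"
    by (simp only: alternant_def sum_distrib_left)
  finally show ?thesis by (simp flip: mult.assoc)
qed

lemma antisym_fun_zero:
  assumes "antisym_fun N f" "i < N" "j < N" "i \<noteq> j" "\<gamma> i = \<gamma> j"
  shows "f \<gamma> = 0"
proof -
  have "\<gamma> \<circ> Transposition.transpose i j = \<gamma>"
    using assms(5) by (auto simp: fun_eq_iff Transposition.transpose_def)
  moreover have "Transposition.transpose i j \<in> sym_grp N"
    using assms by (simp add: sym_grp_def permutes_swap_id)
  ultimately have "f \<gamma> = sign (Transposition.transpose i j) * f \<gamma>"
    using assms(1) unfolding antisym_fun_def by metis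
  then have "f \<gamma> = - f \<gamma>" using assms(4) by (simp add: sign_swap_id)
  then show ?thesis by simp
qed

lemma antisym_fun_noninj:
  "antisym_fun N f \<Longrightarrow> \<not> inj_on \<gamma> {..<N} \<Longrightarrow> f \<gamma> = 0"
  by (auto simp: inj_on_def intro: antisym_fun_zero)

lemma antisym_Yop:
  assumes "antisym_fun N f" shows "antisym_fun N (Yop N k f)"
  unfolding antisym_fun_def
proof (intro ballI allI)
  fix \<rho> \<gamma> assume \<rho>: "\<rho> \<in> sym_grp N"
  then have "inj \<rho>" by (simp add: sym_grp_def permutes_inj)
  then have "(\<gamma> \<circ> \<rho>)(i := (\<gamma> \<circ> \<rho>) i + int k) = (\<gamma>(\<rho> i := \<gamma> (\<rho> i) + int k)) \<circ> \<rho>" for i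
    by (auto simp: fun_eq_iff inj_eq)
  then have "Yop N k f (\<gamma> \<circ> \<rho>) = (\<Sum>i<N. sign \<rho> * f (\<gamma>(\<rho> i := \<gamma> (\<rho> i) + int k)))"
    using assms \<rho> by (simp only: Yop_def antisym_fun_def)
  also have "\<dots> = sign \<rho> * Yop N k f \<gamma>"
    unfolding Yop_def sum_distrib_left
    using sum_sym_grp[OF \<rho>, of "\<lambda>i. sign \<rho> * f (\<gamma>(i := \<gamma> i + int k))"] .
  finally show "Yop N k f (\<gamma> \<circ> \<rho>) = sign \<rho> * Yop N k f \<gamma>" .
qed

text \<open>The product a_delta p_g expanded over words: removing a cycle and relabelling letters
  are operations on words.\<close>

lemma psi_words:
  assumes "finite S"
  shows "psi S N g \<gamma> = (\<Sum>w\<in>fixw S N g. alternant N int (\<lambda>i. \<gamma> i - cont S w i))"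
proof -
  have fix_count: "fix_count S N g \<beta> = (\<Sum>w\<in>fixw S N g. if cont S w = \<beta> then 1 else 0)" for \<beta>
    using assms by (simp add: fix_count_def sum.If_cases Int_def)
  have "psi S N g \<gamma> = (\<Sum>w\<in>fixw S N g. \<Sum>\<sigma>\<in>sym_grp N. sign \<sigma> * (if cont S w = sub \<gamma> \<sigma> then 1 else 0))"
    unfolding psi_def fix_count sum_distrib_left by (rule sum.swap)
  also have "\<dots> = (\<Sum>w\<in>fixw S N g. alternant N int (\<lambda>i. \<gamma> i - cont S w i))"
    unfolding alternant_def
  proof (intro sum.cong refl)
    fix w \<sigma>
    have "cont S w = sub \<gamma> \<sigma> \<longleftrightarrow> (\<lambda>i. \<gamma> i - cont S w i) = int \<circ> \<sigma>"
      by (auto simp: fun_eq_iff sub_def algebra_simps)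
    then show "sign \<sigma> * (if cont S w = sub \<gamma> \<sigma> then 1 else 0)
      = (if (\<lambda>i. \<gamma> i - cont S w i) = int \<circ> \<sigma> then sign \<sigma> else 0)" by simp
  qed
  finally show ?thesis .
qed

lemma stable_fixw:
  assumes "stable g S" "w \<in> words S N"
  shows "w \<in> fixw S N g \<longleftrightarrow> (\<forall>x\<in>S. w (g x) = w x)"
  using assms by (auto simp: fixw_def fun_eq_iff stable_def words_def PiE_def extensional_def)

text \<open>The power sum product is symmetric: relabelling letters by \<open>\<rho>\<close> maps
  fixed words to fixed words and permutes their contents, while the alternant supplies the
  sign.\<close>

lemma antisym_psi:
  assumes "finite S" "stable g S" shows "antisym_fun N (psi S N g)"
  unfolding antisym_fun_def
proof (intro ballI allI)
  fix \<rho> \<gamma> assume \<rho>: "\<rho> \<in> sym_grp N"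
  then have p: "\<rho> permutes {..<N}" by (simp add: sym_grp_def)
  note gp = permutes_inverses[OF p] permutes_in_image[OF p] permutes_in_image[OF permutes_inv[OF p]]
  define R where "R = (\<lambda>w. restrict (\<rho> \<circ> w) S)"
  define R' where "R' = (\<lambda>w. restrict (inv \<rho> \<circ> w) S)"
  have words: "R w \<in> words S N" "R' w \<in> words S N" if "w \<in> words S N" for w
  proof -
    have "w x < N" if "x \<in> S" for x using \<open>w \<in> words S N\<close> that by (auto simp: words_def)
    then show "R w \<in> words S N" "R' w \<in> words S N"
      using gp(3)[of "w x" for x] gp(4)[of "w x" for x]
      by (simp_all add: R_def R'_def words_def restrict_PiE_iff)
  qed
  have inS: "g x \<in> S \<longleftrightarrow> x \<in> S" for x using assms(2) by (simp add: stable_def)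
  have fixed: "R w \<in> fixw S N g" "R' w \<in> fixw S N g" if "w \<in> fixw S N g" for w
  proof -
    have w: "w \<in> words S N" "\<forall>x\<in>S. w (g x) = w x"
      using that stable_fixw[OF assms(2)] by (auto simp: fixw_def)
    then show "R w \<in> fixw S N g" "R' w \<in> fixw S N g"
      using words[OF w(1)] stable_fixw[OF assms(2)] by (auto simp: R_def R'_def inS)
  qed
  have inv: "R' (R w) = w" "R (R' w) = w" if "w \<in> fixw S N g" for w
  proof -
    have "w x = undefined" if "x \<notin> S" for x
      using \<open>w \<in> fixw S N g\<close> that by (auto simp: fixw_def words_def)
    then show "R' (R w) = w" "R (R' w) = w"
      by (auto simp: R_def R'_def fun_eq_iff gp(1,2))
  qed
  have bij: "bij_betw R (fixw S N g) (fixw S N g)"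
    by (rule bij_betw_byWitness[where f' = R']) (use fixed inv in auto)
  have cont: "cont S w i = cont S (R w) (\<rho> i)" for w i
  proof -
    have "{x\<in>S. w x = i} = {x\<in>S. R w x = \<rho> i}"
      using permutes_inj[OF p] by (auto simp: R_def inj_eq)
    then show ?thesis by (simp add: cont_def)
  qed
  have "psi S N g (\<gamma> \<circ> \<rho>) = (\<Sum>w\<in>fixw S N g. alternant N int ((\<lambda>i. \<gamma> i - cont S (R w) i) \<circ> \<rho>))"
  proof -
    have "(\<lambda>i. (\<gamma> \<circ> \<rho>) i - cont S w i) = (\<lambda>i. \<gamma> i - cont S (R w) i) \<circ> \<rho>" for w
      by (rule ext) (simp only: comp_def cont[of w])
    then show ?thesis by (simp only: psi_words[OF assms(1)])
  qed
  also have "\<dots> = (\<Sum>w\<in>fixw S N g. sign \<rho> * alternant N int (\<lambda>i. \<gamma> i - cont S (R w) i))"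
    using antisym_alternant[of N int] \<rho> by (simp only: antisym_fun_def)
  also have "\<dots> = (\<Sum>w\<in>fixw S N g. sign \<rho> * alternant N int (\<lambda>i. \<gamma> i - cont S w i))"
    using sum.reindex_bij_betw[OF bij, of "\<lambda>w. sign \<rho> * alternant N int (\<lambda>i. \<gamma> i - cont S w i)"] .
  finally show "psi S N g (\<gamma> \<circ> \<rho>) = sign \<rho> * psi S N g \<gamma>"
    by (simp add: psi_words[OF assms(1)] sum_distrib_left)
qed

text \<open>Homogeneity: a_delta p_g has the degree of a_delta plus \<open>card S\<close>. Beyond
  the \<open>N\<close> variables the exponents are those of \<open>int\<close>, since
  \<open>sym_grp N\<close> fixes these indices and words do not use them.\<close>

lemma psi_nonzero:
  assumes "finite S" "psi S N g \<gamma> \<noteq> 0"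
  shows "\<And>i. 0 \<le> \<gamma> i" "(\<Sum>i<N. \<gamma> i) = (\<Sum>i<N. int i) + int (card S)" "\<And>i. N \<le> i \<Longrightarrow> \<gamma> i = int i"
proof -
  have "(\<Sum>\<sigma>\<in>sym_grp N. sign \<sigma> * fix_count S N g (sub \<gamma> \<sigma>)) \<noteq> 0" using assms(2) by (simp add: psi_def)
  then obtain \<sigma> where "\<sigma> \<in> sym_grp N" "sign \<sigma> * fix_count S N g (sub \<gamma> \<sigma>) \<noteq> 0"
    by (rule sum.not_neutral_contains_not_neutral)
  then have \<sigma>: "\<sigma> \<in> sym_grp N" "fix_count S N g (sub \<gamma> \<sigma>) \<noteq> 0" by auto
  then obtain w where w: "w \<in> words S N" "cont S w = sub \<gamma> \<sigma>"
    using assms by (auto simp: fixw_def elim!: fix_count_nonzero)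
  then have \<gamma>: "\<gamma> i = cont S w i + int (\<sigma> i)" for i by (simp add: sub_def)
  show "0 \<le> \<gamma> i" for i by (simp add: \<gamma> cont_def)
  show "(\<Sum>i<N. \<gamma> i) = (\<Sum>i<N. int i) + int (card S)"
    using sum_sym_grp[OF \<sigma>(1), of int] sum_cont[OF assms(1) w(1)] by (simp add: \<gamma> sum.distrib)
  show "\<gamma> i = int i" if "N \<le> i" for i
    using that \<sigma>(1) cont_beyond[OF w(1)] by (simp add: \<gamma> sym_grp_def permutes_not_in)
qed

lemma sum_card_le:
  assumes "finite A" shows "(\<Sum>i<card A. i) \<le> \<Sum>(A :: nat set)"
  using assms
proof (induction "card A" arbitrary: A)
  case (Suc n)
  define M where "M = Max A"
  have "A \<noteq> {}" using Suc by auto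
  then have A: "A \<noteq> {}" "M \<in> A" using Suc.prems unfolding M_def by (auto intro: Max_in)
  have "A \<subseteq> {..M}" using Suc by (auto simp: M_def)
  then have "card A \<le> Suc M" using card_mono[of "{..M}" A] by simp
  then have "n \<le> M" using Suc by simp
  moreover have "card (A - {M}) = n" using Suc A by simp
  ultimately have "(\<Sum>i<Suc n. i) \<le> \<Sum>(A - {M}) + M"
    using Suc.hyps(1)[of "A - {M}"] Suc.prems by simp
  then show ?case using Suc A by (simp add: sum.remove[of A M])
qed simp

lemma sum_inj_ge:
  assumes "inj_on \<gamma> {..<N}" "\<And>i. i < N \<Longrightarrow> 0 \<le> \<gamma> i"
  shows "(\<Sum>i<N. int i) \<le> (\<Sum>i<N. \<gamma> i)"
proof -
  define f where "f i = nat (\<gamma> i)" for i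
  have inj: "inj_on f {..<N}" using assms by (auto simp: inj_on_def eq_nat_nat_iff f_def)
  have "card (f ` {..<N}) = N" using card_image[OF inj] by simp
  then have "(\<Sum>i<N. i) \<le> \<Sum>(f ` {..<N})"
    using sum_card_le[of "f ` {..<N}"] by simp
  then have "(\<Sum>i<N. i) \<le> (\<Sum>i<N. f i)"
    by (simp add: sum.reindex[OF inj])
  then have "int (\<Sum>i<N. i) \<le> int (\<Sum>i<N. f i)" by (simp only: of_nat_le_iff)
  also have "\<dots> = (\<Sum>i<N. \<gamma> i)"
    unfolding of_nat_sum by (rule sum.cong) (use assms(2) in \<open>auto simp: f_def\<close>)
  finally show ?thesis by simp
qed

text \<open>If \<open>v\<close> were missing, appending it would give \<open>N + 1\<close> distinct
  nonnegative values, whose sum is at least 0 + ... + N; this contradicts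
  \<open>v + m < N\<close>.\<close>

lemma small_values:
  assumes "inj_on \<gamma> {..<N}" "\<And>i. i < N \<Longrightarrow> 0 \<le> \<gamma> i"
    "(\<Sum>i<N. \<gamma> i) = (\<Sum>i<N. int i) + int m" "v + m < N"
  shows "\<exists>l<N. \<gamma> l = int v"
proof (rule ccontr)
  assume *: "\<not> ?thesis"
  have "inj_on (\<gamma>(N := int v)) {..<Suc N}"
    using assms(1) * by (auto simp: inj_on_def less_Suc_eq)
  moreover have "0 \<le> (\<gamma>(N := int v)) i" if "i < Suc N" for i
    using assms(2) that by (auto simp: less_Suc_eq)
  ultimately have "(\<Sum>i<Suc N. int i) \<le> (\<Sum>i<Suc N. (\<gamma>(N := int v)) i)"
    by (rule sum_inj_ge)
  then show False using assms(3,4) by simp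
qed

section \<open>Cycles as orbits, and their removal\<close>

lemma orbit_in_stable:
  assumes "stable g S" "x \<in> S" shows "orbit g x \<subseteq> S"
proof
  fix y assume "y \<in> orbit g x"
  then show "y \<in> S" by induction (use assms in \<open>auto simp: stable_def\<close>)
qed

lemma orbit_eq_or_disjoint:
  assumes "permutation g" "y \<in> orbit g x" shows "orbit g y = orbit g x"
  using cyclic_on_orbit'[OF assms(1)] assms(2) by (rule orbit_cyclic_eq3)

lemma stable_diff_orbit:
  assumes "permutation g" "stable g S" shows "stable g (S - orbit g x)"
  unfolding stable_def
proof
  fix y
  have "g y \<in> orbit g x \<longleftrightarrow> y \<in> orbit g x"
  proof
    assume "g y \<in> orbit g x"
    then have "orbit g y = orbit g x"
      using orbit_eq_or_disjoint[OF assms(1)] permutation_orbit_step[OF assms(1)] by metis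
    then show "y \<in> orbit g x" using permutation_self_in_orbit[OF assms(1), of y] by simp
  qed (rule orbit.step)
  then show "g y \<in> S - orbit g x \<longleftrightarrow> y \<in> S - orbit g x"
    using assms(2) by (simp add: stable_def)
qed

lemma orbs_remove:
  assumes "permutation g" "stable g S" "x \<in> S"
  shows "orbs g S = insert (orbit g x) (orbs g (S - orbit g x))"
    "orbit g x \<notin> orbs g (S - orbit g x)"
    "A \<in> orbs g (S - orbit g x) \<Longrightarrow> A \<inter> orbit g x = {}"
proof -
  have "S \<subseteq> orbit g x \<union> (S - orbit g x)" "S - orbit g x \<subseteq> S" by auto
  moreover have "orbit g y = orbit g x" if "y \<in> orbit g x" for y
    using orbit_eq_or_disjoint[OF assms(1) that] .
  ultimately show "orbs g S = insert (orbit g x) (orbs g (S - orbit g x))"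
    using assms(3) unfolding orbs_def by (intro equalityI) blast+
  have self: "y \<in> orbit g y" for y by (rule permutation_self_in_orbit[OF assms(1)])
  show "orbit g x \<notin> orbs g (S - orbit g x)"
  proof
    assume "orbit g x \<in> orbs g (S - orbit g x)"
    then obtain y where "y \<in> S - orbit g x" "orbit g x = orbit g y" unfolding orbs_def by blast
    then show False using self[of y] by simp
  qed
  show "A \<inter> orbit g x = {}" if "A \<in> orbs g (S - orbit g x)"
  proof (rule ccontr)
    assume "A \<inter> orbit g x \<noteq> {}"
    then obtain z where z: "z \<in> A" "z \<in> orbit g x" by blast
    obtain y where y: "y \<in> S - orbit g x" "A = orbit g y" using \<open>A \<in> _\<close> unfolding orbs_def by blast
    then have "orbit g z = orbit g y" "orbit g z = orbit g x"
      using z y(2) orbit_eq_or_disjoint[OF assms(1), of z y] orbit_eq_or_disjoint[OF assms(1), of z x]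
      by blast+
    then show False using y(1) self[of y] by simp
  qed
qed

text \<open>A fixed word is one letter for the cycle together with a fixed word on the rest, so p_g
  splits off the power sum of the cycle length.\<close>

lemma psi_remove_orbit:
  assumes "finite S" "permutation g" "stable g S" "x \<in> S"
  shows "psi S N g \<gamma> = (\<Sum>l<N. psi (S - orbit g x) N g (\<gamma>(l := \<gamma> l - int (card (orbit g x)))))"
proof -
  define A where "A = orbit g x"
  have AS: "A \<subseteq> S" unfolding A_def by (rule orbit_in_stable) (use assms in auto)
  have xA: "x \<in> A" unfolding A_def by (rule permutation_self_in_orbit[OF assms(2)])
  have finA: "finite A" using AS assms(1) finite_subset by blast
  have st: "stable g (S - A)" unfolding A_def by (rule stable_diff_orbit) fact+
  have inA: "g y \<in> A \<longleftrightarrow> y \<in> A" for y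
    using st assms(3) AS unfolding stable_def by blast
  define F where "F = (\<lambda>(c, w) y. if y \<in> A then c else w y :: nat)"
  have const: "w y = w x" if "w \<in> fixw S N g" "y \<in> A" for w y
  proof -
    have w: "w (g z) = w z" for z using that(1) unfolding fixw_def by (metis (mono_tags) comp_apply mem_Collect_eq)
    show ?thesis using that(2) unfolding A_def by induction (auto simp: w)
  qed
  have "bij_betw F ({..<N} \<times> fixw (S - A) N g) (fixw S N g)"
  proof (rule bij_betw_byWitness[where f' = "\<lambda>w. (w x, restrict w (S - A))"])
    show "\<forall>p\<in>{..<N} \<times> fixw (S - A) N g. (F p x, restrict (F p) (S - A)) = p"
      using xA by (auto simp: F_def fixw_def words_def PiE_def extensional_def restrict_def fun_eq_iff)
    show "\<forall>w\<in>fixw S N g. F (w x, restrict w (S - A)) = w"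
    proof
      fix w assume w: "w \<in> fixw S N g"
      then have "\<And>y. y \<notin> S \<Longrightarrow> w y = undefined" by (auto simp: fixw_def words_def)
      then show "F (w x, restrict w (S - A)) = w"
        using const[OF w] AS by (auto simp: F_def fun_eq_iff restrict_def)
    qed
    show "F ` ({..<N} \<times> fixw (S - A) N g) \<subseteq> fixw S N g"
    proof (rule image_subsetI)
      fix p assume "p \<in> {..<N} \<times> fixw (S - A) N g"
      then obtain c w where p: "p = (c, w)" "c < N" "w \<in> words (S - A) N" "w \<in> fixw (S - A) N g"
        by (auto simp: fixw_def)
      then have "F p \<in> words S N" using AS by (auto simp: F_def words_def PiE_def extensional_def)
      moreover have "\<forall>y\<in>S. F p (g y) = F p y"
        using p stable_fixw[OF st, of w N] by (auto simp: F_def inA)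
      ultimately show "F p \<in> fixw S N g" using stable_fixw[OF assms(3)] by simp
    qed
    show "(\<lambda>w. (w x, restrict w (S - A))) ` fixw S N g \<subseteq> {..<N} \<times> fixw (S - A) N g"
    proof (rule image_subsetI)
      fix w assume w: "w \<in> fixw S N g"
      then have ww: "w \<in> words S N" by (simp add: fixw_def)
      then have "restrict w (S - A) \<in> words (S - A) N" "w x < N"
        using assms(4) by (auto simp: words_def)
      moreover have "\<forall>y\<in>S - A. restrict w (S - A) (g y) = restrict w (S - A) y"
        using w stable_fixw[OF assms(3) ww] st by (auto simp: stable_def)
      ultimately show "(w x, restrict w (S - A)) \<in> {..<N} \<times> fixw (S - A) N g"
        using stable_fixw[OF st] by simp
    qed
  qed
  then have "psi S N g \<gamma> = (\<Sum>p\<in>{..<N} \<times> fixw (S - A) N g. alternant N int (\<lambda>i. \<gamma> i - cont S (F p) i))"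
    by (simp add: psi_words[OF assms(1)] sum.reindex_bij_betw[symmetric])
  also have "\<dots> = (\<Sum>(c, w)\<in>{..<N} \<times> fixw (S - A) N g.
      alternant N int (\<lambda>i. (\<gamma>(c := \<gamma> c - int (card A))) i - cont (S - A) w i))"
  proof (rule sum.cong[OF refl])
    fix p assume "p \<in> {..<N} \<times> fixw (S - A) N g"
    obtain c w where p: "p = (c, w)" by (cases p)
    have "cont S (F p) i = (if i = c then int (card A) else 0) + cont (S - A) w i" for i
    proof -
      have "{y\<in>S. F p y = i} = (if i = c then A else {}) \<union> {y\<in>S - A. w y = i}"
        using AS by (auto simp: F_def p)
      moreover have "card ((if i = c then A else {}) \<union> {y\<in>S - A. w y = i})
          = card (if i = c then A else {}) + card {y\<in>S - A. w y = i}"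
        using finA assms(1) by (intro card_Un_disjoint) auto
      ultimately show ?thesis by (auto simp: cont_def)
    qed
    then have "(\<lambda>i. \<gamma> i - cont S (F p) i) = (\<lambda>i. (\<gamma>(c := \<gamma> c - int (card A))) i - cont (S - A) w i)"
      by (auto simp: fun_eq_iff)
    then show "alternant N int (\<lambda>i. \<gamma> i - cont S (F p) i) = (case p of (c, w) \<Rightarrow>
      alternant N int (\<lambda>i. (\<gamma>(c := \<gamma> c - int (card A))) i - cont (S - A) w i))"
      by (simp only: p prod.case)
  qed
  also have "\<dots> = (\<Sum>c<N. psi (S - A) N g (\<gamma>(c := \<gamma> c - int (card A))))"
    using assms(1) by (simp only: psi_words[OF finite_Diff[OF assms(1)]] sum.cartesian_product)
  finally show ?thesis by (simp only: A_def)
qed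

lemma orbs_finite: "finite S \<Longrightarrow> finite (orbs g S)"
  by (simp add: orbs_def)

text \<open>The adjoint of p_k acts as k d/dp_k and annihilates a_delta. The induction removes a
  cycle \<open>B\<close>: raising one exponent and lowering another commute, and the Leibniz term
  for \<open>B\<close> itself arises from the exponents smaller than \<open>card B\<close>. The
  bound \<open>card S \<le> N\<close> guarantees that all these small exponents occur.\<close>

lemma Yop_psi:
  assumes "finite S" "permutation g" "stable g S" "card S \<le> N" "k \<ge> 1" "\<And>i. 0 \<le> \<gamma> i"
  shows "Yop N k (psi S N g) \<gamma> = int k * (\<Sum>A | A \<in> orbs g S \<and> card A = k. psi (S - A) N g \<gamma>)"
  using assms
proof (induction "card S" arbitrary: S \<gamma> rule: less_induct)
  case less
  note fin = less.prems(1) and pg = less.prems(2) and st = less.prems(3) and nn = less.prems(6)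
  show ?case
  proof (cases "inj_on \<gamma> {..<N}")
    case False
    have "antisym_fun N (psi (S - A) N g)" if "A \<in> orbs g S" for A
      using that stable_diff_orbit[OF pg st] fin by (auto simp: orbs_def intro!: antisym_psi)
    then have "psi (S - A) N g \<gamma> = 0" if "A \<in> orbs g S" for A
      using that False antisym_fun_noninj by blast
    moreover have "Yop N k (psi S N g) \<gamma> = 0"
      using False antisym_Yop[OF antisym_psi[OF fin st]] antisym_fun_noninj by blast
    ultimately show ?thesis by simp
  next
    case inj: True
    show ?thesis
    proof (cases "S = {}")
      case True
      \<comment> \<open>Distinct nonnegative exponents already sum to at least the degree of
        a_delta, so a raised vector is too large.\<close>
      have "psi S N g (\<gamma>(i := \<gamma> i + int k)) = 0" if i: "i < N" for i
      proof (rule ccontr)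
        assume "psi S N g (\<gamma>(i := \<gamma> i + int k)) \<noteq> 0"
        then have "(\<Sum>l<N. (\<gamma>(i := \<gamma> i + int k)) l) = (\<Sum>l<N. int l)"
          using psi_nonzero(2)[OF fin] True by (metis add_0_right card.empty of_nat_0)
        moreover have "(\<Sum>l<N. (\<gamma>(i := \<gamma> i + int k)) l) = (\<Sum>l<N. \<gamma> l + (if l = i then int k else 0))"
          by (rule sum.cong) auto
        moreover have "\<dots> = (\<Sum>l<N. \<gamma> l) + int k" using i by (simp add: sum.distrib)
        ultimately show False using sum_inj_ge[OF inj] nn \<open>k \<ge> 1\<close> by simp
      qed
      then show ?thesis using True by (simp add: Yop_def orbs_def)
    next
      case False
      then obtain x where x: "x \<in> S" by blast
      define B where "B = orbit g x"
      define S' where "S' = S - B"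
      define b where "b = card B"
      have BS: "B \<subseteq> S" unfolding B_def by (rule orbit_in_stable[OF st x])
      have xB: "x \<in> B" unfolding B_def by (rule permutation_self_in_orbit[OF pg])
      have fin': "finite S'" using fin by (simp add: S'_def)
      have st': "stable g S'" unfolding S'_def B_def by (rule stable_diff_orbit[OF pg st])
      have cS: "card S = card S' + b"
        unfolding S'_def b_def using BS fin by (simp add: card_Diff_subset finite_subset card_mono)
      have "finite B" using BS fin finite_subset by blast
      then have b: "b > 0" using xB by (auto simp: b_def card_gt_0_iff)
      note orb = orbs_remove[OF pg st x, folded B_def, folded S'_def]
      define lower where "lower l \<tau> = \<tau>(l := \<tau> l - int b)" for l and \<tau> :: "nat \<Rightarrow> int"
      have peel: "psi S N g \<tau> = (\<Sum>l<N. psi S' N g (lower l \<tau>))" for \<tau>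
        unfolding lower_def S'_def B_def b_def by (rule psi_remove_orbit[OF fin pg st x])
      have peelA: "psi (S - A) N g \<gamma> = (\<Sum>l<N. psi (S' - A) N g (lower l \<gamma>))" if A: "A \<in> orbs g S'" for A
      proof -
        have "A \<inter> B = {}" using orb(3)[OF A] .
        then have "x \<in> S - A" "S - A - B = S' - A" using x xB by (auto simp: S'_def)
        moreover have "stable g (S - A)"
          using A stable_diff_orbit[OF pg st] by (auto simp: orbs_def)
        ultimately show ?thesis
          using psi_remove_orbit[OF finite_Diff[OF fin] pg, of A x N \<gamma>]
          by (simp add: lower_def b_def flip: B_def)
      qed
      define K where "K = {A. A \<in> orbs g S' \<and> card A = k}"
      have IH: "Yop N k (psi S' N g) (lower l \<gamma>) = int k * (\<Sum>A\<in>K. psi (S' - A) N g (lower l \<gamma>))"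
        if "int b \<le> \<gamma> l" for l
        unfolding K_def
        by (rule less.hyps) (use cS b fin' pg st' less.prems that in \<open>auto simp: lower_def\<close>)
      have neg: "psi T N g \<tau> = 0" if "\<tau> l < 0" "finite T" for T \<tau> l
        using psi_nonzero(1)[OF that(2), of N g \<tau> l] that(1) by force
      \<comment> \<open>If \<open>\<gamma> l\<close> is at least \<open>b\<close>, the induction
        hypothesis applies to the lowered vector. Otherwise the entry at \<open>l\<close> is
        negative unless the same coordinate is raised, which leaves one extra term.\<close>
      have Yl: "(\<Sum>i<N. psi S' N g (lower l (\<gamma>(i := \<gamma> i + int k))))
         = int k * (\<Sum>A\<in>K. psi (S' - A) N g (lower l \<gamma>))
           + (if \<gamma> l < int b then psi S' N g (\<gamma>(l := \<gamma> l + int k - int b)) else 0)" if l: "l < N" for l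
      proof (cases "\<gamma> l < int b")
        case True
        have "(\<Sum>i<N. psi S' N g (lower l (\<gamma>(i := \<gamma> i + int k))))
          = (\<Sum>i<N. if i = l then psi S' N g (\<gamma>(l := \<gamma> l + int k - int b)) else 0)"
        proof (rule sum.cong[OF refl])
          fix i
          have "lower l (\<gamma>(i := \<gamma> i + int k)) l < 0" if "i \<noteq> l" using that True by (simp add: lower_def)
          then show "psi S' N g (lower l (\<gamma>(i := \<gamma> i + int k)))
            = (if i = l then psi S' N g (\<gamma>(l := \<gamma> l + int k - int b)) else 0)"
            using neg[of "lower l (\<gamma>(i := \<gamma> i + int k))" l S'] fin' by (auto simp: lower_def)
        qed
        moreover have "psi (S' - A) N g (lower l \<gamma>) = 0" for A
          by (rule neg[of _ l]) (use True fin' in \<open>auto simp: lower_def\<close>)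
        ultimately show ?thesis using True l by simp
      next
        case False
        have "lower l (\<gamma>(i := \<gamma> i + int k)) = (lower l \<gamma>)(i := lower l \<gamma> i + int k)" for i
          by (auto simp: lower_def fun_eq_iff)
        then show ?thesis using IH[of l] False by (simp add: Yop_def)
      qed
      \<comment> \<open>The derivative of the removed factor. For \<open>k = b\<close>, in the
        nonzero case, each of the values 0, ..., b - 1 occurs exactly once among the exponents,
        giving \<open>b\<close> equal terms. For \<open>k \<noteq> b\<close> a nonzero term would
        force the value \<open>\<gamma> l\<close> to occur at a second index.\<close>
      have extra: "(\<Sum>l<N. if \<gamma> l < int b then psi S' N g (\<gamma>(l := \<gamma> l + int k - int b)) else 0)
         = (if k = b then int k * psi S' N g \<gamma> else 0)"
      proof (cases "k = b")
        case False
        have "psi S' N g (\<gamma>(l := \<gamma> l + int k - int b)) = 0" if l: "l < N" "\<gamma> l < int b" for l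
        proof (rule ccontr)
          define \<tau> where "\<tau> = \<gamma>(l := \<gamma> l + int k - int b)"
          assume "psi S' N g (\<gamma>(l := \<gamma> l + int k - int b)) \<noteq> 0"
          then have nz: "psi S' N g \<tau> \<noteq> 0" by (simp add: \<tau>_def)
          have "inj_on \<tau> {..<N}"
            using nz antisym_fun_noninj[OF antisym_psi[OF fin' st']] by blast
          then have "\<exists>l'<N. \<tau> l' = int (nat (\<gamma> l))"
            using psi_nonzero(1,2)[OF fin' nz] by (rule small_values)
              (use l nn[of l] cS less.prems(4) in linarith)
          then obtain l' where l': "l' < N" "\<tau> l' = \<gamma> l" using nn[of l] by auto
          then have "l' \<noteq> l" using False by (auto simp: \<tau>_def)
          then show False using l' l inj by (auto simp: \<tau>_def inj_on_def)
        qed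
        then show ?thesis using False by (auto intro!: sum.neutral)
      next
        case True
        have "(\<Sum>l<N. if \<gamma> l < int b then psi S' N g (\<gamma>(l := \<gamma> l + int k - int b)) else 0)
          = (\<Sum>l<N. if \<gamma> l < int b then psi S' N g \<gamma> else 0)"
          using True by (intro sum.cong) auto
        also have "\<dots> = int (card {l\<in>{..<N}. \<gamma> l < int b}) * psi S' N g \<gamma>"
          by (simp add: sum.If_cases Int_def)
        also have "\<dots> = int k * psi S' N g \<gamma>"
        proof (cases "psi S' N g \<gamma> = 0")
          case False
          have "bij_betw (nat \<circ> \<gamma>) {l\<in>{..<N}. \<gamma> l < int b} {..<b}"
          proof (rule bij_betw_imageI)
            show "inj_on (nat \<circ> \<gamma>) {l\<in>{..<N}. \<gamma> l < int b}"
              using inj nn by (auto simp: inj_on_def eq_nat_nat_iff)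
            show "(nat \<circ> \<gamma>) ` {l\<in>{..<N}. \<gamma> l < int b} = {..<b}"
            proof (intro equalityI subsetI)
              fix v assume "v \<in> {..<b}"
              then have "\<exists>l<N. \<gamma> l = int v"
                using small_values[OF inj, of "card S'" v] psi_nonzero(1,2)[OF fin' False] cS less.prems(4) by auto
              then obtain l where "l < N" "\<gamma> l = int v" by blast
              then show "v \<in> (nat \<circ> \<gamma>) ` {l\<in>{..<N}. \<gamma> l < int b}"
                using \<open>v \<in> {..<b}\<close> by (intro image_eqI[of _ _ l]) auto
            qed (use b in auto)
          qed
          then show ?thesis using True by (simp add: bij_betw_same_card)
        qed simp
        finally show ?thesis using True by simp
      qed
      have "Yop N k (psi S N g) \<gamma> = (\<Sum>l<N. \<Sum>i<N. psi S' N g (lower l (\<gamma>(i := \<gamma> i + int k))))"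
        unfolding Yop_def peel by (rule sum.swap)
      also have "\<dots> = (\<Sum>l<N. int k * (\<Sum>A\<in>K. psi (S' - A) N g (lower l \<gamma>))
           + (if \<gamma> l < int b then psi S' N g (\<gamma>(l := \<gamma> l + int k - int b)) else 0))"
        by (rule sum.cong) (auto simp: Yl)
      also have "\<dots> = int k * (\<Sum>l<N. \<Sum>A\<in>K. psi (S' - A) N g (lower l \<gamma>)) + (if k = b then int k * psi S' N g \<gamma> else 0)"
        by (simp only: sum.distrib extra sum_distrib_left)
      also have "(\<Sum>l<N. \<Sum>A\<in>K. psi (S' - A) N g (lower l \<gamma>)) = (\<Sum>A\<in>K. psi (S - A) N g \<gamma>)"
        by (subst sum.swap) (simp add: peelA K_def)
      also have "int k * (\<Sum>A\<in>K. psi (S - A) N g \<gamma>) + (if k = b then int k * psi S' N g \<gamma> else 0)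
        = int k * (\<Sum>A | A \<in> orbs g S \<and> card A = k. psi (S - A) N g \<gamma>)"
      proof -
        have "{A. A \<in> orbs g S \<and> card A = k} = (if k = b then insert B K else K)"
          unfolding orb(1) by (auto simp: K_def b_def)
        moreover have "B \<notin> K" "finite K" using orb(2) orbs_finite[OF fin', of g] by (auto simp: K_def)
        ultimately show ?thesis by (auto simp: S'_def distrib_left)
      qed
      finally show ?thesis .
    qed
  qed
qed

text \<open>The operators only raise exponents, so agreement on nonnegative vectors suffices;
  \<open>Yop_psi\<close> is available just there.\<close>

lemma Yiter_cong:
  assumes "\<And>\<gamma>. (\<And>i. 0 \<le> \<gamma> i) \<Longrightarrow> f \<gamma> = f' \<gamma>" "\<And>i. 0 \<le> \<gamma> i"
  shows "(Yop N k ^^ m) f \<gamma> = (Yop N k ^^ m) f' \<gamma>"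
  using assms(2)
proof (induction m arbitrary: \<gamma>)
  case (Suc m)
  have "(Yop N k ^^ m) f (\<gamma>(i := \<gamma> i + int k)) = (Yop N k ^^ m) f' (\<gamma>(i := \<gamma> i + int k))" for i
    by (rule Suc.IH) (use Suc.prems in auto)
  then show ?case
    by (simp only: funpow.simps comp_apply Yop_def[where f = "(Yop N k ^^ m) f"] Yop_def[where f = "(Yop N k ^^ m) f'"])
qed (use assms(1) in simp)

section \<open>Iterated lowering isolates the identity and the cycles\<close>

lemma Yop_sum: "Yop N k (\<lambda>\<gamma>. \<Sum>a\<in>I. f a \<gamma>) = (\<lambda>\<gamma>. \<Sum>a\<in>I. Yop N k (f a) \<gamma>)"
  unfolding Yop_def by (rule ext) (rule sum.swap)

lemma Yop_scale: "Yop N k (\<lambda>\<gamma>. c * f \<gamma>) = (\<lambda>\<gamma>. c * Yop N k f \<gamma>)"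
  unfolding Yop_def by (simp add: sum_distrib_left)

lemma Yiter_sum: "(Yop N k ^^ m) (\<lambda>\<gamma>. \<Sum>a\<in>I. f a \<gamma>) = (\<lambda>\<gamma>. \<Sum>a\<in>I. (Yop N k ^^ m) (f a) \<gamma>)"
  by (induction m) (simp_all add: Yop_sum)

lemma Yiter_scale: "(Yop N k ^^ m) (\<lambda>\<gamma>. c * f \<gamma>) = (\<lambda>\<gamma>. c * (Yop N k ^^ m) f \<gamma>)"
  by (induction m) (simp_all add: Yop_scale)

lemma alternant_int: "alternant N int int = 1"
proof -
  have "alternant N int int = (\<Sum>\<sigma>\<in>sym_grp N. if \<sigma> = id then 1 else 0)"
    unfolding alternant_def
  proof (rule sum.cong[OF refl])
    fix \<sigma> :: "nat \<Rightarrow> nat"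
    have "int = int \<circ> \<sigma> \<longleftrightarrow> \<sigma> = id" by (auto simp: fun_eq_iff)
    then show "(if int = int \<circ> \<sigma> then sign \<sigma> else 0) = (if \<sigma> = id then 1 else 0)" by simp
  qed
  also have "\<dots> = 1" using finite_sym_grp[of N] by (simp add: sym_grp_def permutes_id)
  finally show ?thesis .
qed

lemma psi_empty: "psi {} N g \<gamma> = alternant N int \<gamma>"
proof -
  have "fixw {} N g = {\<lambda>x. undefined}" by (auto simp: fixw_def words_def fun_eq_iff)
  then show ?thesis by (simp add: psi_words cont_def)
qed

lemma orbs_singletons:
  assumes "permutation g"
  shows "{A. A \<in> orbs g S \<and> card A = 1} = (\<lambda>x. {x}) ` {x\<in>S. g x = x}"
proof (intro equalityI subsetI)
  fix A assume "A \<in> {A. A \<in> orbs g S \<and> card A = 1}"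
  then obtain x where x: "x \<in> S" "A = orbit g x" "card A = 1" by (auto simp: orbs_def)
  moreover have "x \<in> A" unfolding x by (rule permutation_self_in_orbit[OF assms])
  ultimately have "A = {x}" by (metis card_1_singletonE singletonD)
  then show "A \<in> (\<lambda>x. {x}) ` {x\<in>S. g x = x}"
    using x orbit_eq_singleton_iff[of g x] by auto
next
  fix A assume "A \<in> (\<lambda>x. {x}) ` {x\<in>S. g x = x}"
  then obtain x where "x \<in> S" "g x = x" "A = {x}" by auto
  then show "A \<in> {A. A \<in> orbs g S \<and> card A = 1}"
    using orbit_eq_singleton_iff[of g x] by (auto simp: orbs_def)
qed

text \<open>Each application removes one fixed point of \<open>g\<close>. All \<open>m\<close>
  points can be removed exactly when \<open>g\<close> fixes them all, and then in \<open>m!\<close>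
  orders.\<close>

lemma Yiter_psi:
  assumes "finite S" "permutation g" "stable g S" "card S = m" "m \<le> N" "\<And>i. 0 \<le> \<gamma> i"
  shows "(Yop N 1 ^^ m) (psi S N g) \<gamma> = (if \<forall>x\<in>S. g x = x then fact m else 0) * alternant N int \<gamma>"
  using assms
proof (induction m arbitrary: S \<gamma>)
  case 0
  then show ?case by (simp add: psi_empty)
next
  case (Suc m)
  define Fx where "Fx = {x\<in>S. g x = x}"
  have step: "Yop N 1 (psi S N g) \<tau> = (\<Sum>x\<in>Fx. psi (S - {x}) N g \<tau>)" if "\<And>i. 0 \<le> \<tau> i" for \<tau>
  proof -
    have "Yop N 1 (psi S N g) \<tau> = (\<Sum>A | A \<in> orbs g S \<and> card A = 1. psi (S - A) N g \<tau>)"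
      using Suc.prems that by (subst Yop_psi) auto
    also have "\<dots> = (\<Sum>x\<in>Fx. psi (S - {x}) N g \<tau>)"
      unfolding orbs_singletons[OF Suc.prems(2)] Fx_def by (subst sum.reindex) (auto simp: inj_on_def)
    finally show ?thesis .
  qed
  have "(Yop N 1 ^^ Suc m) (psi S N g) \<gamma> = (Yop N 1 ^^ m) (Yop N 1 (psi S N g)) \<gamma>"
    by (simp only: funpow_Suc_right comp_apply)
  also have "\<dots> = (Yop N 1 ^^ m) (\<lambda>\<tau>. \<Sum>x\<in>Fx. psi (S - {x}) N g \<tau>) \<gamma>"
    using step Suc.prems(6) by (rule Yiter_cong)
  also have "\<dots> = (\<Sum>x\<in>Fx. (Yop N 1 ^^ m) (psi (S - {x}) N g) \<gamma>)"
    by (simp only: Yiter_sum)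
  also have "\<dots> = (\<Sum>x\<in>Fx. (if \<forall>y\<in>S-{x}. g y = y then fact m else 0) * alternant N int \<gamma>)"
  proof (rule sum.cong[OF refl])
    fix x assume x: "x \<in> Fx"
    then have "orbit g x = {x}" using orbit_eq_singleton_iff[of g x] by (simp add: Fx_def)
    then have "stable g (S - {x})"
      using stable_diff_orbit[OF Suc.prems(2,3), of x] by simp
    then show "(Yop N 1 ^^ m) (psi (S - {x}) N g) \<gamma> = (if \<forall>y\<in>S-{x}. g y = y then fact m else 0) * alternant N int \<gamma>"
      using Suc.prems x by (intro Suc.IH) (auto simp: Fx_def)
  qed
  also have "\<dots> = (if \<forall>x\<in>S. g x = x then fact (Suc m) else 0) * alternant N int \<gamma>"
  proof (cases "\<forall>x\<in>S. g x = x")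
    case True
    then have "Fx = S" by (auto simp: Fx_def)
    then show ?thesis using True Suc.prems by simp
  next
    case False
    then have "(\<Sum>x\<in>Fx. (if \<forall>y\<in>S-{x}. g y = y then fact m else 0) * alternant N int \<gamma>) = 0"
      by (intro sum.neutral) (auto simp: Fx_def)
    then show ?thesis using False by auto
  qed
  finally show ?case .
qed

text \<open>The cycle of length \<open>k\<close> is removed first, then the remaining points one by
  one. Because \<open>k \<ge> 2\<close>, at most one orbit qualifies: a second one would consist of
  a point fixed by \<open>g\<close>. Evaluating at \<open>int\<close> reads off the coefficient 1 of
  a_delta.\<close>

lemma extract_cycle:
  assumes "finite S" "permutation g" "stable g S" "card S \<le> N" "2 \<le> k" "k \<le> card S"
  shows "(Yop N 1 ^^ (card S - k)) (Yop N k (psi S N g)) int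
    = (if \<exists>A\<in>orbs g S. card A = k \<and> (\<forall>x\<in>S-A. g x = x) then int k * fact (card S - k) else 0)"
proof -
  define K where "K = {A. A \<in> orbs g S \<and> card A = k}"
  define G where "G = {A\<in>K. \<forall>x\<in>S-A. g x = x}"
  define E where "E \<longleftrightarrow> (\<exists>A\<in>orbs g S. card A = k \<and> (\<forall>x\<in>S-A. g x = x))"
  have finK: "finite K" using orbs_finite[OF assms(1), of g] by (simp add: K_def)
  have AS: "A \<subseteq> S" "stable g (S - A)" if "A \<in> K" for A
    using that orbit_in_stable[OF assms(3)] stable_diff_orbit[OF assms(2,3)] by (auto simp: K_def orbs_def)
  have "(Yop N 1 ^^ (card S - k)) (Yop N k (psi S N g)) int
    = (Yop N 1 ^^ (card S - k)) (\<lambda>\<tau>. int k * (\<Sum>A\<in>K. psi (S - A) N g \<tau>)) int"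
    unfolding K_def by (rule Yiter_cong) (use assms in \<open>auto intro!: Yop_psi\<close>)
  also have "\<dots> = int k * (\<Sum>A\<in>K. (Yop N 1 ^^ (card S - k)) (psi (S - A) N g) int)"
    by (simp only: Yiter_scale Yiter_sum)
  also have "(\<Sum>A\<in>K. (Yop N 1 ^^ (card S - k)) (psi (S - A) N g) int)
    = (\<Sum>A\<in>K. if \<forall>x\<in>S-A. g x = x then fact (card S - k) else 0)"
  proof (rule sum.cong[OF refl])
    fix A assume A: "A \<in> K"
    have "card (S - A) = card S - k"
      using AS[OF A] A assms(1) by (simp add: K_def card_Diff_subset finite_subset)
    then show "(Yop N 1 ^^ (card S - k)) (psi (S - A) N g) int = (if \<forall>x\<in>S-A. g x = x then fact (card S - k) else 0)"
      using assms AS[OF A] by (subst Yiter_psi) (auto simp: alternant_int)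
  qed
  also have "\<dots> = int (card G) * fact (card S - k)"
    using finK by (simp add: sum.If_cases G_def Int_def)
  also have "card G = (if G \<noteq> {} then 1 else 0)"
  proof -
    have "A = B" if "A \<in> G" "B \<in> G" for A B
    proof (rule ccontr)
      assume ne: "A \<noteq> B"
      have "A \<in> orbit g ` S" "B \<in> orbit g ` S" using that by (simp_all add: G_def K_def orbs_def)
      then obtain x y where xy: "A = orbit g x" "B = orbit g y" "y \<in> S" by blast
      have y: "y \<in> B" unfolding xy by (rule permutation_self_in_orbit[OF assms(2)])
      have "y \<notin> A" using ne orbit_eq_or_disjoint[OF assms(2), of y x] xy by auto
      then have "g y = y" using that xy by (auto simp: G_def)
      then have "B = {y}" using orbit_eq_singleton_iff[of g y] xy by simp
      then show False using that assms(5) by (auto simp: G_def K_def)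
    qed
    then have "G = {A}" if "A \<in> G" for A using that by blast
    then show ?thesis by (cases "G = {}") (simp, metis all_not_in_conv card_1_singleton_iff One_nat_def)
  qed
  also have "G \<noteq> {} \<longleftrightarrow> E"
    by (auto simp: G_def K_def E_def)
  finally show ?thesis unfolding E_def[symmetric] by (cases E) simp_all
qed

section \<open>Alternants\<close>

text \<open>Raising the entry \<open>i\<close> of \<open>\<gamma>\<close> by \<open>k\<close>
  amounts to lowering the entry \<open>\<sigma> i\<close> of \<open>\<mu>\<close> in the term of
  \<open>\<sigma>\<close>.\<close>

lemma Yop_alternant: "Yop N k (alternant N \<mu>) = (\<lambda>\<gamma>. \<Sum>l<N. alternant N (\<mu>(l := \<mu> l - int k)) \<gamma>)"
proof
  fix \<gamma>
  have eq: "\<gamma>(i := \<gamma> i + int k) = \<mu> \<circ> \<sigma> \<longleftrightarrow> \<gamma> = \<mu>(\<sigma> i := \<mu> (\<sigma> i) - int k) \<circ> \<sigma>" if "\<sigma> \<in> sym_grp N" for \<sigma> i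
  proof -
    have inj: "inj \<sigma>" using that by (simp add: sym_grp_def permutes_inj)
    have "\<gamma>(i := \<gamma> i + int k) = \<mu> \<circ> \<sigma> \<longleftrightarrow> (\<forall>x. \<gamma> x + (if x = i then int k else 0) = \<mu> (\<sigma> x))"
      by (auto simp: fun_eq_iff)
    also have "\<dots> \<longleftrightarrow> (\<forall>x. \<gamma> x = \<mu> (\<sigma> x) - (if x = i then int k else 0))"
      by (auto simp: algebra_simps)
    also have "\<dots> \<longleftrightarrow> \<gamma> = \<mu>(\<sigma> i := \<mu> (\<sigma> i) - int k) \<circ> \<sigma>"
      using inj by (auto simp: fun_eq_iff inj_eq)
    finally show ?thesis .
  qed
  have "Yop N k (alternant N \<mu>) \<gamma> = (\<Sum>\<sigma>\<in>sym_grp N. \<Sum>i<N. if \<gamma>(i := \<gamma> i + int k) = \<mu> \<circ> \<sigma> then sign \<sigma> else 0)"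
    unfolding Yop_def alternant_def by (rule sum.swap)
  also have "\<dots> = (\<Sum>\<sigma>\<in>sym_grp N. \<Sum>l<N. if \<gamma> = \<mu>(l := \<mu> l - int k) \<circ> \<sigma> then sign \<sigma> else 0)"
  proof (rule sum.cong[OF refl])
    fix \<sigma> assume \<sigma>: "\<sigma> \<in> sym_grp N"
    show "(\<Sum>i<N. if \<gamma>(i := \<gamma> i + int k) = \<mu> \<circ> \<sigma> then sign \<sigma> else 0)
      = (\<Sum>l<N. if \<gamma> = \<mu>(l := \<mu> l - int k) \<circ> \<sigma> then sign \<sigma> else 0)"
      unfolding eq[OF \<sigma>]
      using sum_sym_grp[OF \<sigma>, of "\<lambda>l. if \<gamma> = \<mu>(l := \<mu> l - int k) \<circ> \<sigma> then sign \<sigma> else 0"] .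
  qed
  also have "\<dots> = (\<Sum>l<N. alternant N (\<mu>(l := \<mu> l - int k)) \<gamma>)"
    unfolding alternant_def by (rule sum.swap)
  finally show "Yop N k (alternant N \<mu>) \<gamma> = (\<Sum>l<N. alternant N (\<mu>(l := \<mu> l - int k)) \<gamma>)" .
qed

text \<open>For \<open>\<mu>\<close> a partition of size \<open>m\<close> plus the staircase, this
  is the number of standard tableaux of that shape; \<open>dlow_Suc\<close> is the branching
  rule.\<close>

definition dlow :: "nat \<Rightarrow> nat \<Rightarrow> (nat \<Rightarrow> int) \<Rightarrow> int" where
  "dlow N m \<mu> = (Yop N 1 ^^ m) (alternant N \<mu>) int"

lemma dlow_0: "dlow N 0 \<mu> = alternant N \<mu> int"
  by (simp add: dlow_def)

lemma dlow_Suc: "dlow N (Suc m) \<mu> = (\<Sum>l<N. dlow N m (\<mu>(l := \<mu> l - 1)))"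
  unfolding dlow_def by (simp only: funpow_Suc_right comp_apply Yop_alternant Yiter_sum) simp

lemma dlow_permute: "\<rho> \<in> sym_grp N \<Longrightarrow> dlow N m (\<mu> \<circ> \<rho>) = sign \<rho> * dlow N m \<mu>"
proof -
  assume \<rho>: "\<rho> \<in> sym_grp N"
  have "alternant N (\<mu> \<circ> \<rho>) = (\<lambda>\<gamma>. sign \<rho> * alternant N \<mu> \<gamma>)" by (rule ext) (rule alternant_permute[OF \<rho>])
  then show ?thesis by (simp only: dlow_def Yiter_scale)
qed

lemma dlow_noninj: "\<not> inj_on \<mu> {..<N} \<Longrightarrow> dlow N m \<mu> = 0"
  by (rule antisym_fun_noninj[of N "dlow N m"]) (auto simp: antisym_fun_def dlow_permute)

text \<open>Lowering never makes a negative entry nonnegative, and the target \<open>int\<close> has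
  no negative entries.\<close>

lemma dlow_neg:
  assumes "l < N" "\<mu> l < 0" shows "dlow N m \<mu> = 0"
  using assms(2)
proof (induction m arbitrary: \<mu>)
  case 0
  have "alternant N \<mu> int = 0"
    unfolding alternant_def
  proof (rule sum.neutral, rule ballI)
    fix \<sigma> assume "\<sigma> \<in> sym_grp N"
    then obtain x where "\<sigma> x = l" using sym_grp_surj by (metis surjD)
    then have "int \<noteq> \<mu> \<circ> \<sigma>" using 0 by (metis comp_apply of_nat_less_0_iff)
    then show "(if int = \<mu> \<circ> \<sigma> then sign \<sigma> else 0) = 0" by simp
  qed
  then show ?case by (simp add: dlow_0)
next
  case (Suc m)
  then show ?case unfolding dlow_Suc by (intro sum.neutral ballI Suc.IH) auto
qed

section \<open>The Vandermonde product\<close>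

definition vdm :: "nat \<Rightarrow> (nat \<Rightarrow> complex) \<Rightarrow> complex" where
  "vdm N x = (\<Prod>(i, j) | i < j \<and> j < N. x j - x i)"

lemma finite_pairs: "finite {(i, j). i < j \<and> j < (N :: nat)}"
  by (rule finite_subset[of _ "{..<N} \<times> {..<N}"]) auto

text \<open>An adjacent transposition preserves the order of every other pair of indices, so just
  the factor of \<open>(a, Suc a)\<close> changes sign.\<close>

lemma vdm_adjacent:
  assumes "Suc a < N"
  shows "vdm N (x \<circ> Transposition.transpose a (Suc a)) = - vdm N x"
proof -
  define t where "t = Transposition.transpose a (Suc a)"
  define P where "P = {(i, j). i < j \<and> j < N} - {(a, Suc a)}"
  have ins: "{(i, j). i < j \<and> j < N} = insert (a, Suc a) P" "(a, Suc a) \<notin> P" "finite P"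
    using assms finite_pairs[of N] by (auto simp: P_def)
  have t: "t i < N" if "i < N" for i using that assms by (auto simp: t_def Transposition.transpose_def)
  have tt: "t (t i) = i" for i by (simp add: t_def)
  have tl: "t i < t j" if "i < j" "(i, j) \<noteq> (a, Suc a)" for i j
    using that by (auto simp: t_def Transposition.transpose_def)
  have tne: "(t i, t j) \<noteq> (a, Suc a)" if "i < j" for i j
    using that by (auto simp: t_def Transposition.transpose_def split: if_splits)
  have "(\<Prod>(i, j)\<in>P. x (t j) - x (t i)) = (\<Prod>(i, j)\<in>P. x j - x i)"
    by (rule prod.reindex_bij_witness[of _ "\<lambda>(i, j). (t i, t j)" "\<lambda>(i, j). (t i, t j)"])
      (auto simp: P_def tt t tl dest: tne)
  moreover have "t a = Suc a" "t (Suc a) = a" by (simp_all add: t_def)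
  ultimately show ?thesis unfolding vdm_def ins(1) using ins(2,3)
    by (simp add: t_def[symmetric]) (simp add: algebra_simps)
qed

text \<open>The transposition of \<open>a\<close> and \<open>Suc b\<close> is that of
  \<open>a\<close> and \<open>b\<close> conjugated by an adjacent one; three sign changes make
  one.\<close>

lemma vdm_transpose:
  assumes "a < b" "b < N"
  shows "vdm N (x \<circ> Transposition.transpose a b) = - vdm N x"
proof -
  have "Suc a \<le> b" using assms by simp
  then show ?thesis using assms(2)
  proof (induction b arbitrary: x rule: dec_induct)
    case base
    then show ?case by (intro vdm_adjacent) simp
  next
    case (step b)
    have "x \<circ> Transposition.transpose a (Suc b)
      = ((x \<circ> Transposition.transpose b (Suc b)) \<circ> Transposition.transpose a b) \<circ> Transposition.transpose b (Suc b)"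
      using step.hyps by (auto simp: fun_eq_iff Transposition.transpose_def)
    then show ?case using step by (simp only: vdm_adjacent step.IH) (simp add: vdm_adjacent step.IH)
  qed
qed

lemma vdm_permute:
  assumes "\<sigma> \<in> sym_grp N" shows "vdm N (x \<circ> \<sigma>) = of_int (sign \<sigma>) * vdm N x"
proof -
  have "\<sigma> permutes {..<N}" using assms by (simp add: sym_grp_def)
  then have "\<forall>x. vdm N (x \<circ> \<sigma>) = of_int (sign \<sigma>) * vdm N x"
    using finite_lessThan[of N]
  proof (induction rule: permutes_induct)
    case (swap a b p)
    have "permutation p" using swap permutation_permutes by blast
    then have s: "sign (Transposition.transpose a b \<circ> p) = - sign p"
      using swap by (simp add: sign_compose permutation_swap_id sign_swap_id)
    have t: "vdm N (x \<circ> Transposition.transpose a b) = - vdm N x" for x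
      using swap vdm_transpose[of a b N x] vdm_transpose[of b a N x]
      by (cases a b rule: linorder_cases) (auto simp: transpose_commute)
    show ?case
    proof
      fix x
      have "vdm N (x \<circ> (Transposition.transpose a b \<circ> p)) = vdm N ((x \<circ> Transposition.transpose a b) \<circ> p)"
        by (simp only: o_assoc)
      also have "\<dots> = of_int (sign p) * vdm N (x \<circ> Transposition.transpose a b)"
      proof -
        have "\<forall>x. vdm N (x \<circ> p) = of_int (sign p) * vdm N x" by (rule swap)
        then show ?thesis by blast
      qed
      finally show "vdm N (x \<circ> (Transposition.transpose a b \<circ> p)) = of_int (sign (Transposition.transpose a b \<circ> p)) * vdm N x"
        by (simp only: s t) simp
    qed
  qed simp
  then show ?thesis by blast
qed

lemma vdm_noninj: "\<not> inj_on x {..<N} \<Longrightarrow> vdm N x = 0"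
proof -
  assume "\<not> inj_on x {..<N}"
  then obtain i j where "i < N" "j < N" "i \<noteq> j" "x i = x j" by (auto simp: inj_on_def)
  then obtain i j where "i < j" "j < N" "x i = x j" by (metis linorder_neqE_nat)
  then have "\<exists>p\<in>{(i, j). i < j \<and> j < N}. (case p of (i, j) \<Rightarrow> x j - x i) = 0"
    by (intro bexI[of _ "(i, j)"]) auto
  then show ?thesis unfolding vdm_def using finite_pairs[of N] by (intro prod_zero)
qed

lemma vdm_inj: 
  assumes "inj_on x {..<N}" shows "vdm N x \<noteq> 0"
proof -
  have "x j - x i \<noteq> 0" if "i < j" "j < N" for i j
    using inj_onD[OF assms, of j i] that by auto
  then show ?thesis unfolding vdm_def using finite_pairs[of N] by auto
qed

text \<open>The pairs containing \<open>l\<close> are the ones affected. For pairs above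
  \<open>l\<close> both differences are reversed, which leaves their quotient unchanged.\<close>

lemma vdm_update:
  assumes "l < N" "inj_on x {..<N}"
  shows "vdm N (x(l := y)) = vdm N x * (\<Prod>j\<in>{..<N}-{l}. (y - x j) / (x l - x j))"
proof -
  define A where "A = {(i, j). i < j \<and> j < N \<and> i \<noteq> l \<and> j \<noteq> l}"
  define B where "B = (\<lambda>j. (j, l)) ` {..<l}"
  define C where "C = (\<lambda>j. (l, j)) ` {l<..<N}"
  have eq: "{(i, j). i < j \<and> j < N} = A \<union> (B \<union> C)" using assms by (auto simp: A_def B_def C_def)
  have fin: "finite A" "finite B" "finite C"
    using finite_pairs[of N] by (auto simp: A_def B_def C_def intro: rev_finite_subset)
  have split: "vdm N z = (\<Prod>(i, j)\<in>A. z j - z i) * ((\<Prod>j<l. z l - z j) * (\<Prod>j\<in>{l<..<N}. z j - z l))" for z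
  proof -
    have "vdm N z = (\<Prod>(i, j)\<in>A. z j - z i) * ((\<Prod>(i, j)\<in>B. z j - z i) * (\<Prod>(i, j)\<in>C. z j - z i))"
      unfolding vdm_def eq using fin
      by (subst prod.union_disjoint, simp, simp, force simp: A_def B_def C_def,
          subst prod.union_disjoint) (auto simp: A_def B_def C_def)
    then show ?thesis by (simp add: B_def C_def prod.reindex inj_on_def)
  qed
  have N: "{..<N} - {l} = {..<l} \<union> {l<..<N}" using assms by auto
  have nz: "x l - x j \<noteq> 0" "x j - x l \<noteq> 0" if "j < N" "j \<noteq> l" for j
    using assms that by (auto simp: inj_on_def)
  have "(\<Prod>j<l. y - x j) = (\<Prod>j<l. x l - x j) * (\<Prod>j<l. (y - x j) / (x l - x j))"
    unfolding prod.distrib[symmetric] by (rule prod.cong) (use nz assms in auto)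
  moreover have "(\<Prod>j\<in>{l<..<N}. x j - y) = (\<Prod>j\<in>{l<..<N}. x j - x l) * (\<Prod>j\<in>{l<..<N}. (y - x j) / (x l - x j))"
    unfolding prod.distrib[symmetric]
  proof (rule prod.cong[OF refl])
    fix j assume "j \<in> {l<..<N}"
    then have "x l - x j \<noteq> 0" using nz by auto
    then show "x j - y = (x j - x l) * ((y - x j) / (x l - x j))" by (simp add: field_simps)
  qed
  moreover have "(\<Prod>(i, j)\<in>A. (x(l := y)) j - (x(l := y)) i) = (\<Prod>(i, j)\<in>A. x j - x i)"
    by (rule prod.cong) (auto simp: A_def)
  ultimately show ?thesis
    unfolding split N by (subst prod.union_disjoint) (auto simp: mult_ac)
qed

text \<open>\<open>residue_sum\<close> with \<open>k = 1\<close> and a single polynomial factor with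
  root 0. Each factor of the series is 1 - t - a t^2 - ..., so the coefficient of t^2 in the product
  is the number of index pairs minus the sum of the points.\<close>

lemma one_step_sum:
  fixes x :: "nat \<Rightarrow> complex"
  assumes "inj_on x {..<N}"
  shows "(\<Sum>l<N. x l * (\<Prod>j\<in>{..<N}-{l}. (x l - 1 - x j) / (x l - x j)))
    = (\<Sum>l<N. x l) - (\<Sum>l<N. of_nat l)"
proof (cases "N = 0")
  case False
  define A where "A = x ` {..<N}"
  have A: "finite A" "A \<noteq> {}" using False by (auto simp: A_def)
  have "(\<Sum>a\<in>A. a * (\<Prod>b\<in>A-{a}. (a - b - 1) / (a - b)))
    = (\<Sum>l<N. x l * (\<Prod>j\<in>{..<N}-{l}. (x l - 1 - x j) / (x l - x j)))"
    unfolding A_def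
  proof (subst sum.reindex[OF assms], unfold comp_def, rule sum.cong[OF refl])
    fix l assume l: "l \<in> {..<N}"
    have "x ` {..<N} - {x l} = x ` ({..<N} - {l})" using assms l by (auto simp: inj_on_def)
    moreover have "inj_on x ({..<N} - {l})" using assms by (rule inj_on_subset) auto
    ultimately show "x l * (\<Prod>b\<in>x ` {..<N} - {x l}. (x l - b - 1) / (x l - b))
      = x l * (\<Prod>j\<in>{..<N}-{l}. (x l - 1 - x j) / (x l - x j))"
      proof -
        have eq: "x l - b - 1 = x l - 1 - b" for b by simp
        show ?thesis by (simp only: eq prod.reindex[OF \<open>inj_on x ({..<N} - {l})\<close>] comp_def \<open>x ` {..<N} - {x l} = x ` ({..<N} - {l})\<close>)
      qed
  qed
  moreover have "- 1 * (\<Sum>a\<in>A. a * (\<Prod>b\<in>A-{a}. (a - b - 1) / (a - b))) = (\<Prod>a\<in>A. lin (a + 1) * geo a) $ 2"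
    using residue_sum[OF A, where k = 1 and K = 1 and c = "\<lambda>_. 0"]
    by (simp add: lin_def numeral_2_eq_2)
  moreover have "(\<Prod>a\<in>A. lin (a + 1) * geo a) $ 2 = (\<Sum>l<N. of_nat l) - (\<Sum>l<N. x l)"
  proof -
    have f: "(lin (a + 1) * geo a) $ 0 = 1" "(lin (a + 1) * geo a) $ 1 = - 1" "(lin (a + 1) * geo a) $ 2 = - a" for a
      using lin_mult_nth_Suc[of "a + 1" "geo a" 0] lin_mult_nth_Suc[of "a + 1" "geo a" 1]
      by (simp_all add: fps_mult_nth_0 numeral_2_eq_2 algebra_simps)
    have "(\<Prod>l<n. lin (x l + 1) * geo (x l)) $ 0 = 1 \<and>
      (\<Prod>l<n. lin (x l + 1) * geo (x l)) $ 1 = - of_nat n \<and>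
      (\<Prod>l<n. lin (x l + 1) * geo (x l)) $ 2 = (\<Sum>l<n. of_nat l) - (\<Sum>l<n. x l)" for n
    proof (induction n)
      case (Suc n)
      define P where "P = (\<Prod>l<n. lin (x l + 1) * geo (x l))"
      define Q where "Q = lin (x n + 1) * geo (x n)"
      have "(P * Q) $ 0 = P $ 0 * Q $ 0" "(P * Q) $ 1 = P $ 0 * Q $ 1 + P $ 1 * Q $ 0"
        "(P * Q) $ 2 = P $ 0 * Q $ 2 + P $ 1 * Q $ 1 + P $ 2 * Q $ 0"
        by (simp_all add: fps_mult_nth numeral_2_eq_2)
      moreover have "P $ 0 = 1" "P $ 1 = - of_nat n" "P $ 2 = (\<Sum>l<n. of_nat l) - (\<Sum>l<n. x l)"
        using Suc by (simp_all add: P_def)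
      moreover have "Q $ 0 = 1" "Q $ 1 = - 1" "Q $ 2 = - x n" unfolding Q_def by (rule f)+
      ultimately show ?case by (simp flip: P_def Q_def)
    qed simp
    moreover have "(\<Prod>a\<in>A. lin (a + 1) * geo a) = (\<Prod>l<N. lin (x l + 1) * geo (x l))"
      unfolding A_def by (simp add: prod.reindex[OF assms])
    ultimately show ?thesis by metis
  qed
  ultimately have "- 1 * (\<Sum>l<N. x l * (\<Prod>j\<in>{..<N}-{l}. (x l - 1 - x j) / (x l - x j)))
    = (\<Sum>l<N. of_nat l) - (\<Sum>l<N. x l)"
    by (simp only:)
  moreover have "b = x' - s" if "- 1 * b = s - x'" for b x' s :: complex
    using that by (simp add: algebra_simps)
  ultimately show ?thesis by blast
qed simp

text \<open>The value 0 at negative arguments makes the recursion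
  \<open>recip_fact (z - 1) = z * recip_fact z\<close> valid for every integer, also at 0.\<close>

definition recip_fact :: "int \<Rightarrow> complex" where
  "recip_fact z = (if z < 0 then 0 else 1 / fact (nat z))"

lemma recip_fact_minus_one: "recip_fact (z - 1) = of_int z * recip_fact z"
proof (cases "z \<le> 0")
  case False
  then obtain n where "z = int (Suc n)" by (metis gr0_conv_Suc not_le_imp_less zero_less_imp_eq_int)
  then have "nat z = Suc n" "nat (z - 1) = n" "z > 0" "of_int z = (of_nat (Suc n) :: complex)" by auto
  then show ?thesis by (simp add: recip_fact_def fact_Suc del: of_nat_Suc)
qed (auto simp: recip_fact_def)

lemma recip_fact_minus: "recip_fact (z - int k) = (\<Prod>s<k. of_int z - of_nat s) * recip_fact z"
proof (induction k)
  case (Suc k)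
  have "recip_fact (z - int (Suc k)) = recip_fact ((z - int k) - 1)" by (simp add: algebra_simps)
  then show ?case by (simp add: recip_fact_minus_one Suc mult_ac)
qed simp

section \<open>The dimension formula and Frobenius' quotient\<close>

definition cvec :: "(nat \<Rightarrow> int) \<Rightarrow> nat \<Rightarrow> complex" where
  "cvec \<mu> i = of_int (\<mu> i)"

text \<open>The value of Vandermonde over factorials at the staircase, which normalises
  \<open>dlow_formula\<close>. As a common factor it cancels once it is known to be nonzero.\<close>

definition kap :: "nat \<Rightarrow> complex" where
  "kap N = vdm N of_nat * (\<Prod>i<N. recip_fact (int i))"

lemma kap_nonzero: "kap N \<noteq> 0"
  unfolding kap_def by (auto simp: recip_fact_def vdm_inj)

lemma recip_fact_prod_update:
  fixes \<mu> :: "nat \<Rightarrow> int"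
  assumes "l < N"
  shows "(\<Prod>i<N. recip_fact ((\<mu>(l := \<mu> l - int k)) i)) = (\<Prod>s<k. of_int (\<mu> l) - of_nat s) * (\<Prod>i<N. recip_fact (\<mu> i))"
proof -
  have "(\<Prod>i<N. f i) = f l * (\<Prod>i\<in>{..<N}-{l}. f i)" for f :: "nat \<Rightarrow> complex"
    using assms by (intro prod.remove) auto
  from this[of "\<lambda>i. recip_fact ((\<mu>(l := \<mu> l - int k)) i)"] this[of "\<lambda>i. recip_fact (\<mu> i)"]
  show ?thesis by (simp add: recip_fact_minus)
qed

lemma inj_on_cvec: "inj_on (cvec \<mu>) {..<N} \<longleftrightarrow> inj_on \<mu> {..<N}"
  by (simp add: inj_on_def cvec_def)

text \<open>With the minimal possible sum there is no gap: \<open>small_values\<close> with excess 0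
  shows that every value below \<open>N\<close> is taken.\<close>

lemma perm_of_small:
  assumes "inj_on \<mu> {..<N}" "\<And>i. i < N \<Longrightarrow> 0 \<le> \<mu> i" "(\<Sum>i<N. \<mu> i) = (\<Sum>i<N. int i)" "\<And>i. N \<le> i \<Longrightarrow> \<mu> i = int i"
  obtains \<sigma> where "\<sigma> \<in> sym_grp N" "\<mu> = int \<circ> \<sigma>"
proof
  define \<sigma> where "\<sigma> i = nat (\<mu> i)" for i
  have nn: "0 \<le> \<mu> i" for i using assms(2,4)[of i] by (cases "i < N") auto
  then show "\<mu> = int \<circ> \<sigma>" by (simp add: fun_eq_iff \<sigma>_def)
  have sub: "{..<N} \<subseteq> \<sigma> ` {..<N}"
  proof
    fix v assume "v \<in> {..<N}"
    then obtain l where "l < N" "\<mu> l = int v"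
      using small_values[OF assms(1,2), of 0 v] assms(3) by auto
    then show "v \<in> \<sigma> ` {..<N}" by (intro image_eqI[of _ _ l]) (auto simp: \<sigma>_def)
  qed
  moreover have "card (\<sigma> ` {..<N}) \<le> N" using card_image_le[of "{..<N}" \<sigma>] by simp
  ultimately have im: "\<sigma> ` {..<N} = {..<N}" by (metis card_lessThan card_subset_eq finite_imageI finite_lessThan card_mono le_antisym)
  have "bij_betw \<sigma> {..<N} {..<N}"
    using im by (simp add: bij_betw_def eq_card_imp_inj_on)
  moreover have "\<sigma> i = i" if "i \<notin> {..<N}" for i using that assms(4) by (simp add: \<sigma>_def)
  ultimately show "\<sigma> \<in> sym_grp N" unfolding sym_grp_def by (auto intro: bij_imp_permutes)
qed

text \<open>The classical count of standard tableaux. Lowering the entry \<open>l\<close> multiplies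
  the right side by \<open>\<mu> l\<close> and by the quotient from \<open>vdm_update\<close>;
  \<open>one_step_sum\<close> adds these factors up to the excess \<open>Suc m\<close>.\<close>

lemma dlow_formula:
  assumes "(\<Sum>i<N. \<mu> i) = (\<Sum>i<N. int i) + int m" "\<And>i. N \<le> i \<Longrightarrow> \<mu> i = int i"
  shows "of_int (dlow N m \<mu>) * kap N = fact m * vdm N (cvec \<mu>) * (\<Prod>i<N. recip_fact (\<mu> i))"
  using assms
proof (induction m arbitrary: \<mu>)
  case (0 \<mu>)
  show ?case
  proof (cases "inj_on \<mu> {..<N} \<and> (\<forall>i<N. 0 \<le> \<mu> i)")
    case False
    then consider "\<not> inj_on \<mu> {..<N}" | l where "l < N" "\<mu> l < 0" by fastforce
    then show ?thesis
    proof cases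
      case 1
      then show ?thesis by (simp add: dlow_noninj vdm_noninj inj_on_cvec)
    next
      case 2
      then have "(\<Prod>i<N. recip_fact (\<mu> i)) = 0" by (intro prod_zero) (auto simp: recip_fact_def)
      then show ?thesis using 2 by (simp add: dlow_neg)
    qed
  next
    case True
    then obtain \<sigma> where \<sigma>: "\<sigma> \<in> sym_grp N" "\<mu> = int \<circ> \<sigma>"
      using perm_of_small[of \<mu> N] 0 by auto
    have "dlow N 0 \<mu> = sign \<sigma>" using dlow_permute[OF \<sigma>(1), of 0 int] by (simp add: \<sigma>(2) dlow_0 alternant_int)
    moreover have "vdm N (cvec \<mu>) = of_int (sign \<sigma>) * vdm N of_nat"
      using vdm_permute[OF \<sigma>(1), of of_nat] by (simp add: \<sigma>(2) cvec_def[abs_def] comp_def)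
    moreover have "(\<Prod>i<N. recip_fact (\<mu> i)) = (\<Prod>i<N. recip_fact (int i))"
    proof -
      have "\<sigma> permutes {..<N}" using \<sigma>(1) by (simp add: sym_grp_def)
      then show ?thesis using prod.permute[of \<sigma> "{..<N}" "\<lambda>i. recip_fact (int i)"] by (simp add: \<sigma>(2) comp_def)
    qed
    ultimately show ?thesis by (simp add: kap_def)
  qed
next
  case (Suc m \<mu>)
  show ?case
  proof (cases "inj_on \<mu> {..<N}")
    case False
    then show ?thesis by (simp add: dlow_noninj vdm_noninj inj_on_cvec)
  next
    case True
    have "of_int (dlow N (Suc m) \<mu>) * kap N = (\<Sum>l<N. of_int (dlow N m (\<mu>(l := \<mu> l - 1))) * kap N)"
      by (simp add: dlow_Suc sum_distrib_right)
    also have "\<dots> = (\<Sum>l<N. fact m * vdm N (cvec \<mu>) * (\<Prod>i<N. recip_fact (\<mu> i)) *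
        (cvec \<mu> l * (\<Prod>j\<in>{..<N}-{l}. (cvec \<mu> l - 1 - cvec \<mu> j) / (cvec \<mu> l - cvec \<mu> j))))"
    proof (rule sum.cong[OF refl])
      fix l assume l: "l \<in> {..<N}"
      have "(\<Sum>i<N. (\<mu>(l := \<mu> l - 1)) i) = (\<Sum>i<N. \<mu> i - (if i = l then 1 else 0))"
        by (rule sum.cong) auto
      then have "(\<Sum>i<N. (\<mu>(l := \<mu> l - 1)) i) = (\<Sum>i<N. int i) + int m"
        using l Suc.prems(1) by (simp add: sum_subtractf)
      then have "of_int (dlow N m (\<mu>(l := \<mu> l - 1))) * kap N
        = fact m * vdm N (cvec (\<mu>(l := \<mu> l - 1))) * (\<Prod>i<N. recip_fact ((\<mu>(l := \<mu> l - 1)) i))"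
        using Suc.prems(2) l by (intro Suc.IH) auto
      also have "cvec (\<mu>(l := \<mu> l - 1)) = (cvec \<mu>)(l := cvec \<mu> l - 1)"
        by (auto simp: cvec_def fun_eq_iff)
      also have "vdm N \<dots> = vdm N (cvec \<mu>) * (\<Prod>j\<in>{..<N}-{l}. (cvec \<mu> l - 1 - cvec \<mu> j) / (cvec \<mu> l - cvec \<mu> j))"
        using l True by (intro vdm_update) (auto simp: inj_on_cvec)
      also have "(\<Prod>i<N. recip_fact ((\<mu>(l := \<mu> l - 1)) i)) = cvec \<mu> l * (\<Prod>i<N. recip_fact (\<mu> i))"
        using l recip_fact_prod_update[of l N \<mu> 1] by (simp add: cvec_def)
      finally show "of_int (dlow N m (\<mu>(l := \<mu> l - 1))) * kap N
        = fact m * vdm N (cvec \<mu>) * (\<Prod>i<N. recip_fact (\<mu> i)) *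
        (cvec \<mu> l * (\<Prod>j\<in>{..<N}-{l}. (cvec \<mu> l - 1 - cvec \<mu> j) / (cvec \<mu> l - cvec \<mu> j)))"
        by (simp only: mult_ac)
    qed
    also have "\<dots> = fact m * vdm N (cvec \<mu>) * (\<Prod>i<N. recip_fact (\<mu> i)) * ((\<Sum>l<N. cvec \<mu> l) - (\<Sum>l<N. of_nat l))"
      using True by (simp only: sum_distrib_left[symmetric] one_step_sum[of "cvec \<mu>" N] inj_on_cvec)
    also have "(\<Sum>l<N. cvec \<mu> l) = of_int (\<Sum>l<N. \<mu> l)" by (simp add: cvec_def)
    also have "\<dots> - (\<Sum>l<N. of_nat l) = of_nat (Suc m)" by (simp only: Suc.prems(1)) simp
    finally show ?thesis by (simp add: algebra_simps)
  qed
qed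

text \<open>By \<open>dlow_formula\<close> the quotient of each lowered count by the full one is, up
  to factorials, a summand of \<open>frob\<close>. The unknown \<open>C\<close> and the constant
  \<open>kap N\<close> cancel.\<close>

lemma frob_eq_lowering:
  assumes inj: "inj_on \<mu> {..<N}" and sum: "(\<Sum>i<N. \<mu> i) = (\<Sum>i<N. int i) + int n"
    and beyond: "\<And>i. N \<le> i \<Longrightarrow> \<mu> i = int i" and k: "1 \<le> k" "k \<le> n"
    and C: "C * dlow N n \<mu> = fact n"
    and F: "C * (\<Sum>l<N. dlow N (n - k) (\<mu>(l := \<mu> l - int k))) = int k * fact (n - k) * F"
  shows "of_int F = frob k N (cvec \<mu>)"
proof -
  define R where "R = vdm N (cvec \<mu>) * (\<Prod>i<N. recip_fact (\<mu> i))"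
  have d: "of_int (dlow N n \<mu>) * kap N = fact n * R"
    using dlow_formula[OF sum beyond] by (simp add: R_def)
  have "of_int (\<Sum>l<N. dlow N (n - k) (\<mu>(l := \<mu> l - int k))) * kap N
    = (\<Sum>l<N. of_int (dlow N (n - k) (\<mu>(l := \<mu> l - int k))) * kap N)"
    by (simp add: sum_distrib_right)
  also have "\<dots> = (\<Sum>l<N. fact (n - k) * R * ((\<Prod>s<k. cvec \<mu> l - of_nat s) *
     (\<Prod>i\<in>{..<N}-{l}. (cvec \<mu> l - cvec \<mu> i - of_nat k) / (cvec \<mu> l - cvec \<mu> i))))"
  proof (rule sum.cong[OF refl])
    fix l assume l: "l \<in> {..<N}"
    have "(\<Sum>i<N. (\<mu>(l := \<mu> l - int k)) i) = (\<Sum>i<N. \<mu> i - (if i = l then int k else 0))"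
      by (rule sum.cong) auto
    then have "(\<Sum>i<N. (\<mu>(l := \<mu> l - int k)) i) = (\<Sum>i<N. int i) + int (n - k)"
      using l sum k by (simp add: sum_subtractf of_nat_diff)
    then have "of_int (dlow N (n - k) (\<mu>(l := \<mu> l - int k))) * kap N
      = fact (n - k) * vdm N (cvec (\<mu>(l := \<mu> l - int k))) * (\<Prod>i<N. recip_fact ((\<mu>(l := \<mu> l - int k)) i))"
      using beyond l by (intro dlow_formula) auto
    also have "cvec (\<mu>(l := \<mu> l - int k)) = (cvec \<mu>)(l := cvec \<mu> l - of_nat k)"
      by (auto simp: cvec_def fun_eq_iff)
    also have "vdm N \<dots> = vdm N (cvec \<mu>) * (\<Prod>j\<in>{..<N}-{l}. (cvec \<mu> l - of_nat k - cvec \<mu> j) / (cvec \<mu> l - cvec \<mu> j))"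
      using l inj by (intro vdm_update) (auto simp: inj_on_cvec)
    also have "(\<Prod>i<N. recip_fact ((\<mu>(l := \<mu> l - int k)) i)) = (\<Prod>s<k. cvec \<mu> l - of_nat s) * (\<Prod>i<N. recip_fact (\<mu> i))"
      using l by (subst recip_fact_prod_update) (auto simp: cvec_def)
    also have "(\<lambda>j. (cvec \<mu> l - of_nat k - cvec \<mu> j) / (cvec \<mu> l - cvec \<mu> j))
      = (\<lambda>i. (cvec \<mu> l - cvec \<mu> i - of_nat k) / (cvec \<mu> l - cvec \<mu> i))" by (simp add: algebra_simps)
    finally show "of_int (dlow N (n - k) (\<mu>(l := \<mu> l - int k))) * kap N
      = fact (n - k) * R * ((\<Prod>s<k. cvec \<mu> l - of_nat s) *
     (\<Prod>i\<in>{..<N}-{l}. (cvec \<mu> l - cvec \<mu> i - of_nat k) / (cvec \<mu> l - cvec \<mu> i)))"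
      by (simp only: R_def mult_ac)
  qed
  also have "\<dots> = fact (n - k) * R * (of_nat k * frob k N (cvec \<mu>))"
    using k by (simp add: frob_def sum_distrib_left)
  finally have dk: "of_int (\<Sum>l<N. dlow N (n - k) (\<mu>(l := \<mu> l - int k))) * kap N = \<dots>" .
  have "of_int (C * dlow N n \<mu>) * kap N = fact n * kap N"
    by (simp only: C of_int_fact)
  then have "fact n * (of_int C * R) = fact n * kap N"
    using d by (simp add: mult.assoc mult.left_commute)
  then have CR: "of_int C * R = kap N" by simp
  have "of_int (int k * fact (n - k) * F) * kap N
    = of_int C * (of_int (\<Sum>l<N. dlow N (n - k) (\<mu>(l := \<mu> l - int k))) * kap N)"
    unfolding F[symmetric] of_int_mult by (rule mult.assoc)
  also have "\<dots> = of_int C * (fact (n - k) * R * (of_nat k * frob k N (cvec \<mu>)))"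
    by (simp only: dk)
  also have "\<dots> = (of_int C * R) * (fact (n - k) * of_nat k * frob k N (cvec \<mu>))"
    by (simp only: mult_ac)
  also have "\<dots> = (fact (n - k) * of_nat k * frob k N (cvec \<mu>)) * kap N"
    by (subst CR) (rule mult.commute)
  finally have "of_int (int k * fact (n - k) * F) = fact (n - k) * of_nat k * frob k N (cvec \<mu>)"
    using kap_nonzero[of N] by simp
  then show ?thesis using k by simp
qed

text \<open>Every summand vanishes. If \<open>\<mu> l < k\<close>, the falling factorial has a zero
  factor; otherwise \<open>\<mu> l - k\<close> must coincide with another entry, since distinct
  nonnegative entries with so small a sum do not exist.\<close>

lemma frob_small:
  assumes inj: "inj_on \<mu> {..<N}" and sum: "(\<Sum>i<N. \<mu> i) = (\<Sum>i<N. int i) + int n"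
    and nonneg: "\<And>i. i < N \<Longrightarrow> 0 \<le> \<mu> i" and k: "n < k"
  shows "frob k N (cvec \<mu>) = 0"
proof -
  have *: "(\<Prod>s<k. cvec \<mu> l - of_nat s) * (\<Prod>i\<in>{..<N}-{l}. (cvec \<mu> l - cvec \<mu> i - of_nat k) / (cvec \<mu> l - cvec \<mu> i)) = 0"
    if l: "l < N" for l
  proof (cases "\<mu> l < int k")
    case True
    then have "nat (\<mu> l) < k" "cvec \<mu> l = of_nat (nat (\<mu> l))"
      using nonneg[OF l] by (auto simp: cvec_def)
    then have "(\<Prod>s<k. cvec \<mu> l - of_nat s) = 0" by (intro prod_zero) auto
    then show ?thesis by simp
  next
    case False
    have "\<exists>i<N. i \<noteq> l \<and> \<mu> i = \<mu> l - int k"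
    proof (rule ccontr)
      assume *: "\<not> ?thesis"
      have "inj_on (\<mu>(l := \<mu> l - int k)) {..<N}"
        using inj * by (auto simp: inj_on_def)
      then have "(\<Sum>i<N. int i) \<le> (\<Sum>i<N. (\<mu>(l := \<mu> l - int k)) i)"
        by (rule sum_inj_ge) (use nonneg False in auto)
      also have "\<dots> = (\<Sum>i<N. \<mu> i - (if i = l then int k else 0))"
        by (rule sum.cong) auto
      finally show False using l sum k by (simp add: sum_subtractf)
    qed
    then obtain i where i: "i < N" "i \<noteq> l" "\<mu> i = \<mu> l - int k" by blast
    then have "(\<Prod>i\<in>{..<N}-{l}. (cvec \<mu> l - cvec \<mu> i - of_nat k) / (cvec \<mu> l - cvec \<mu> i)) = 0"
      by (intro prod_zero) (auto intro!: bexI[of _ i] simp: cvec_def)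
    then show ?thesis by simp
  qed
  have "(\<Sum>l<N. (\<Prod>s<k. cvec \<mu> l - of_nat s) *
      (\<Prod>i\<in>{..<N}-{l}. (cvec \<mu> l - cvec \<mu> i - of_nat k) / (cvec \<mu> l - cvec \<mu> i))) = 0"
    by (intro sum.neutral ballI *) simp
  then show ?thesis by (simp only: frob_def mult_zero_right)
qed

section \<open>Row and column groups\<close>

text \<open>Boxes are known by their numbers \<open>0, ..., n - 1\<close>, so that permutations act
  on them directly. \<open>box_above\<close> says that columns are filled from the top, which is the
  form in which the partition shape enters.\<close>

locale tableau =
  fixes n :: nat and row col :: "nat \<Rightarrow> nat"
  assumes box_inj: "x < n \<Longrightarrow> y < n \<Longrightarrow> row x = row y \<Longrightarrow> col x = col y \<Longrightarrow> x = y"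
    and box_above: "x < n \<Longrightarrow> i \<le> row x \<Longrightarrow> \<exists>y<n. row y = i \<and> col y = col x"
begin

definition Rg :: "(nat \<Rightarrow> nat) set" where
  "Rg = {p \<in> sym_grp n. \<forall>x<n. row (p x) = row x}"

definition Cg :: "(nat \<Rightarrow> nat) set" where
  "Cg = {q \<in> sym_grp n. \<forall>x<n. col (q x) = col x}"

definition phi :: "(nat \<Rightarrow> nat) \<Rightarrow> int" where
  "phi g = (\<Sum>p\<in>Rg. \<Sum>q\<in>Cg. if p \<circ> q = g then sign q else 0)"

lemma sym_grp_lt: "p \<in> sym_grp m \<Longrightarrow> p x < m \<longleftrightarrow> x < m"
  unfolding sym_grp_def using permutes_in_image[of p "{..<m}" x] by simp

lemma finite_Rg [simp]: "finite Rg" and finite_Cg [simp]: "finite Cg"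
  by (auto simp: Rg_def Cg_def)

lemma Rg_comp: "p \<in> Rg \<Longrightarrow> p' \<in> Rg \<Longrightarrow> p \<circ> p' \<in> Rg"
  by (auto simp: Rg_def sym_grp_comp sym_grp_lt)

lemma Cg_comp: "p \<in> Cg \<Longrightarrow> p' \<in> Cg \<Longrightarrow> p \<circ> p' \<in> Cg"
  by (auto simp: Cg_def sym_grp_comp sym_grp_lt)

lemma sym_grp_inv: "p \<in> sym_grp m \<Longrightarrow> inv p \<in> sym_grp m"
  by (simp add: sym_grp_def permutes_inv)

lemma sym_grp_inverses:
  "p \<in> sym_grp m \<Longrightarrow> p (inv p x) = x" "p \<in> sym_grp m \<Longrightarrow> inv p (p x) = x"
  "p \<in> sym_grp m \<Longrightarrow> p \<circ> inv p = id" "p \<in> sym_grp m \<Longrightarrow> inv p \<circ> p = id"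
  by (simp_all add: sym_grp_def permutes_inverses permutes_inv_o)

lemma Rg_inv: "p \<in> Rg \<Longrightarrow> inv p \<in> Rg"
  unfolding Rg_def using sym_grp_inverses(1) sym_grp_lt[OF sym_grp_inv]
  by (auto simp: sym_grp_inv) metis

lemma Cg_inv: "p \<in> Cg \<Longrightarrow> inv p \<in> Cg"
  unfolding Cg_def using sym_grp_inverses(1) sym_grp_lt[OF sym_grp_inv]
  by (auto simp: sym_grp_inv) metis

lemma Rg_id: "id \<in> Rg" and Cg_id: "id \<in> Cg"
  by (auto simp: Rg_def Cg_def sym_grp_def permutes_id)

text \<open>The boxes \<open>q x\<close> and \<open>q' x\<close> share the column of
  \<open>x\<close>, and row permutations carry them to the same box, so they also share a
  row.\<close>

lemma RC_unique:
  assumes "p \<in> Rg" "q \<in> Cg" "p' \<in> Rg" "q' \<in> Cg" "p \<circ> q = p' \<circ> q'"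
  shows "p = p'" "q = q'"
proof -
  show q: "q = q'"
  proof
    fix x
    show "q x = q' x"
    proof (cases "x < n")
      case True
      then have lt: "q x < n" "q' x < n" using assms sym_grp_lt by (auto simp: Cg_def)
      have "p (q x) = p' (q' x)" using assms(5) by (metis comp_apply)
      moreover have "row (p (q x)) = row (q x)" "row (p' (q' x)) = row (q' x)"
        using assms(1,3) lt by (auto simp: Rg_def)
      ultimately have "row (q x) = row (q' x)" by simp
      moreover have "col (q x) = col (q' x)" using True assms by (simp add: Cg_def)
      ultimately show ?thesis using box_inj lt by blast
    next
      case False
      then show ?thesis using assms by (auto simp: Cg_def sym_grp_def permutes_not_in)
    qed
  qed
  have "q \<in> sym_grp n" using assms by (simp add: Cg_def)
  then show "p = p'" using assms(5) q comp_right_cancel[OF sym_grp_surj] by blast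
qed

lemma phi_RC:
  assumes "p \<in> Rg" "q \<in> Cg" shows "phi (p \<circ> q) = sign q"
proof -
  have "phi (p \<circ> q) = (\<Sum>p'\<in>Rg. \<Sum>q'\<in>Cg. if p' = p \<and> q' = q then sign q else 0)"
    unfolding phi_def
  proof (intro sum.cong refl)
    fix p' q' assume "p' \<in> Rg" "q' \<in> Cg"
    then have "p' \<circ> q' = p \<circ> q \<longleftrightarrow> p' = p \<and> q' = q"
      using RC_unique[OF _ _ assms, of p' q'] by auto
    then show "(if p' \<circ> q' = p \<circ> q then sign q' else 0) = (if p' = p \<and> q' = q then sign q else 0)" by auto
  qed
  also have "\<dots> = (\<Sum>p'\<in>Rg. if p' = p then sign q else 0)"
    by (intro sum.cong refl) (use assms in auto)
  also have "\<dots> = sign q" using assms by simp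
  finally show ?thesis .
qed

lemma phi_not_RC: "(\<And>p q. p \<in> Rg \<Longrightarrow> q \<in> Cg \<Longrightarrow> g \<noteq> p \<circ> q) \<Longrightarrow> phi g = 0"
  unfolding phi_def by (intro sum.neutral ballI) auto

lemma phi_id: "phi id = 1"
  using phi_RC[OF Rg_id Cg_id] by simp

lemma Rg_sym_grp: "p \<in> Rg \<Longrightarrow> p \<in> sym_grp n" and Cg_sym_grp: "p \<in> Cg \<Longrightarrow> p \<in> sym_grp n"
  by (auto simp: Rg_def Cg_def)

lemma phi_left:
  assumes "p \<in> Rg" shows "phi (p \<circ> g) = phi g"
proof (cases "\<exists>p'\<in>Rg. \<exists>q\<in>Cg. g = p' \<circ> q")
  case True
  then obtain p' q where g: "p' \<in> Rg" "q \<in> Cg" "g = p' \<circ> q" by blast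
  then have "phi ((p \<circ> p') \<circ> q) = phi (p' \<circ> q)"
    using assms by (simp only: phi_RC Rg_comp)
  then show ?thesis by (simp add: g(3) comp_assoc)
next
  case False
  have "p \<circ> g \<noteq> p' \<circ> q" if "p' \<in> Rg" "q \<in> Cg" for p' q
  proof
    assume "p \<circ> g = p' \<circ> q"
    then have "inv p \<circ> p \<circ> g = (inv p \<circ> p') \<circ> q" by (simp add: comp_assoc)
    then have "g = (inv p \<circ> p') \<circ> q" using sym_grp_inverses(4)[OF Rg_sym_grp[OF assms]] by simp
    then show False using False that assms Rg_comp Rg_inv by blast
  qed
  then show ?thesis using False by (simp add: phi_not_RC)
qed

lemma phi_right:
  assumes "q \<in> Cg" shows "phi (g \<circ> q) = sign q * phi g"
proof (cases "\<exists>p\<in>Rg. \<exists>q'\<in>Cg. g = p \<circ> q'")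
  case True
  then obtain p q' where g: "p \<in> Rg" "q' \<in> Cg" "g = p \<circ> q'" by blast
  have "phi (p \<circ> (q' \<circ> q)) = sign q * phi (p \<circ> q')"
    using assms g by (simp only: phi_RC Cg_comp sign_sym_grp_comp[OF Cg_sym_grp Cg_sym_grp] mult.commute)
  then show ?thesis by (simp only: g(3) comp_assoc)
next
  case False
  have "g \<circ> q \<noteq> p \<circ> q'" if "p \<in> Rg" "q' \<in> Cg" for p q'
  proof
    assume "g \<circ> q = p \<circ> q'"
    then have "g \<circ> (q \<circ> inv q) = p \<circ> (q' \<circ> inv q)" by (simp only: o_assoc)
    then have "g = p \<circ> (q' \<circ> inv q)" using sym_grp_inverses(3)[OF Cg_sym_grp[OF assms]] by simp
    then show False using False that assms Cg_comp Cg_inv by blast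
  qed
  then show ?thesis using False by (simp add: phi_not_RC)
qed

section \<open>Repeated letters in columns and von Neumann's lemma\<close>

lemma transpose_sym_grp: "a < m \<Longrightarrow> b < m \<Longrightarrow> Transposition.transpose a b \<in> sym_grp m"
  by (simp add: sym_grp_def permutes_swap_id)

lemma transpose_Rg: "a < n \<Longrightarrow> b < n \<Longrightarrow> row a = row b \<Longrightarrow> Transposition.transpose a b \<in> Rg"
  by (auto simp: Rg_def transpose_sym_grp Transposition.transpose_def)

lemma transpose_Cg: "a < n \<Longrightarrow> b < n \<Longrightarrow> col a = col b \<Longrightarrow> Transposition.transpose a b \<in> Cg"
  by (auto simp: Cg_def transpose_sym_grp Transposition.transpose_def)

text \<open>Either the column extends to row \<open>card J\<close> or below, and then its first
  \<open>card J\<close> rows hold as many boxes as there are letters, or it lies entirely within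
  these rows.\<close>

lemma column_card_le:
  assumes T: "T \<subseteq> {x. x < n \<and> col x = c}" and u: "inj_on u T" "u ` T \<subseteq> J" "finite J"
  shows "card T \<le> card {x. x < n \<and> col x = c \<and> row x < card J}"
proof (cases "\<exists>x<n. col x = c \<and> card J \<le> row x")
  case True
  then obtain x where x: "x < n" "col x = c" "card J \<le> row x" by blast
  have "{..<card J} \<subseteq> row ` {x. x < n \<and> col x = c \<and> row x < card J}"
  proof
    fix i assume "i \<in> {..<card J}"
    then obtain y where "y < n" "row y = i" "col y = col x" using box_above[OF x(1), of i] x(3) by auto
    then show "i \<in> row ` {x. x < n \<and> col x = c \<and> row x < card J}" using x \<open>i \<in> _\<close> by auto
  qed
  then have "card J \<le> card {x. x < n \<and> col x = c \<and> row x < card J}"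
    using surj_card_le[of "{x. x < n \<and> col x = c \<and> row x < card J}" "{..<card J}" row] by simp
  moreover have "card T \<le> card J" using u by (metis card_image card_mono)
  ultimately show ?thesis by simp
next
  case False
  then show ?thesis using T by (intro card_mono) auto
qed

lemma card_by_columns: "card {x. x < n \<and> P x} = (\<Sum>c\<in>col ` {..<n}. card {x. x < n \<and> col x = c \<and> P x})"
proof -
  have "{x. x < n \<and> P x} = (\<Union>c\<in>col ` {..<n}. {x. x < n \<and> col x = c \<and> P x})" by auto
  also have "card \<dots> = (\<Sum>c\<in>col ` {..<n}. card {x. x < n \<and> col x = c \<and> P x})"
    by (rule card_UN_disjoint) auto
  finally show ?thesis .
qed

lemma card_perm: "g \<in> sym_grp n \<Longrightarrow> card {x. x < n \<and> P (g x)} = card {x. x < n \<and> P x}"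
proof -
  assume g: "g \<in> sym_grp n"
  have "bij_betw g {x. x < n \<and> P (g x)} {x. x < n \<and> P x}"
    by (rule bij_betw_byWitness[where f' = "inv g"])
      (use sym_grp_inverses[OF g] sym_grp_lt[OF g] sym_grp_lt[OF sym_grp_inv[OF g]] in auto)
  then show ?thesis by (rule bij_betw_same_card)
qed

text \<open>Pigeonhole, summed over columns: with no repetition inside a column, the letters from
  \<open>I\<close> would fill no more boxes than the first \<open>card I\<close> rows
  contain.\<close>

lemma column_repeat:
  assumes "finite I" "card {x. x < n \<and> row x < card I} < card {x. x < n \<and> u x \<in> I}"
  shows "\<exists>a b. a < n \<and> b < n \<and> a \<noteq> b \<and> col a = col b \<and> u a = u b"
proof (rule ccontr)
  assume "\<not> ?thesis"
  then have distinct: "a = b" if "a < n" "b < n" "col a = col b" "u a = u b" for a b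
    using that by blast
  have "card {x. x < n \<and> u x \<in> I} = (\<Sum>c\<in>col ` {..<n}. card {x. x < n \<and> col x = c \<and> u x \<in> I})"
    by (rule card_by_columns)
  also have "\<dots> \<le> (\<Sum>c\<in>col ` {..<n}. card {x. x < n \<and> col x = c \<and> row x < card I})"
    by (intro sum_mono column_card_le[where u = u]) (use assms in \<open>auto simp: inj_on_def intro: distinct\<close>)
  also have "\<dots> = card {x. x < n \<and> row x < card I}" by (rule card_by_columns[symmetric])
  finally show False using assms by simp
qed

text \<open>In each column, no more boxes go to the first \<open>r\<close> rows than the column has
  there. The totals over all columns agree because \<open>g\<close> is a permutation, so equality
  holds in every column and each row of a column is hit from that column.\<close>

lemma RC_decomposition:
  assumes g: "g \<in> sym_grp n"
    and distinct: "\<And>a b. a < n \<Longrightarrow> b < n \<Longrightarrow> col a = col b \<Longrightarrow> row (g a) = row (g b) \<Longrightarrow> a = b"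
  shows "\<exists>p\<in>Rg. \<exists>q\<in>Cg. g = p \<circ> q"
proof -
  define cu where "cu c r = card {x. x < n \<and> col x = c \<and> row (g x) < r}" for c r
  define cr where "cr c r = card {x. x < n \<and> col x = c \<and> row x < r}" for c r
  have le: "cu c r \<le> cr c r" for c r
  proof -
    have "inj_on (\<lambda>x. row (g x)) {x. x < n \<and> col x = c \<and> row (g x) < r}"
      by (rule inj_onI, rule distinct) auto
    then have "card {x. x < n \<and> col x = c \<and> row (g x) < r} \<le> card {x. x < n \<and> col x = c \<and> row x < card {..<r}}"
      by (intro column_card_le[where u = "\<lambda>x. row (g x)"]) auto
    then show ?thesis by (simp add: cu_def cr_def)
  qed
  have "(\<Sum>c\<in>col ` {..<n}. cu c r) = (\<Sum>c\<in>col ` {..<n}. cr c r)" for r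
    unfolding cu_def cr_def card_by_columns[symmetric] by (rule card_perm[OF g])
  then have eq: "cu c r = cr c r" if "c \<in> col ` {..<n}" for c r
    using sum_mono_inv[of "\<lambda>c. cu c r" "col ` {..<n}" "\<lambda>c. cr c r" c, OF _ _ that] le by simp
  have ex: "\<exists>y<n. col y = col x \<and> row (g y) = row x" if x: "x < n" for x
  proof (rule ccontr)
    assume *: "\<not> ?thesis"
    have "{y. y < n \<and> col y = col x \<and> row (g y) < Suc (row x)} = {y. y < n \<and> col y = col x \<and> row (g y) < row x}"
      using * by (auto simp: less_Suc_eq)
    then have "cu (col x) (Suc (row x)) = cu (col x) (row x)" by (simp add: cu_def)
    then have "cr (col x) (Suc (row x)) = cr (col x) (row x)" using eq x by simp
    moreover have "{y. y < n \<and> col y = col x \<and> row y < row x} \<subset> {y. y < n \<and> col y = col x \<and> row y < Suc (row x)}"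
      using x by auto
    then have "cr (col x) (row x) < cr (col x) (Suc (row x))"
      unfolding cr_def by (intro psubset_card_mono) auto
    ultimately show False by simp
  qed
  \<comment> \<open>The box in the column of \<open>x\<close> that \<open>g\<close> sends to the row
    of \<open>x\<close>; thus \<open>q\<close> preserves columns and \<open>g \<circ> q\<close>
    preserves rows.\<close>
  define q where "q x = (if x < n then SOME y. y < n \<and> col y = col x \<and> row (g y) = row x else x)" for x
  have q: "q x < n" "col (q x) = col x" "row (g (q x)) = row x" if "x < n" for x
    using someI_ex[OF ex[OF that]] that by (auto simp: q_def)
  have "inj_on q {..<n}"
  proof (rule inj_onI)
    fix x y assume "x \<in> {..<n}" "y \<in> {..<n}" "q x = q y"
    then show "x = y" using q[of x] q[of y] by - (rule box_inj, auto)
  qed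
  moreover have "q ` {..<n} \<subseteq> {..<n}" using q by auto
  ultimately have "bij_betw q {..<n} {..<n}"
    by (simp add: bij_betw_def endo_inj_surj)
  then have qs: "q \<in> sym_grp n" unfolding sym_grp_def using bij_imp_permutes[of q "{..<n}"] by (simp add: q_def)
  then have "q \<in> Cg" using q by (simp add: Cg_def)
  moreover have "g \<circ> q \<in> Rg" using q sym_grp_comp[OF g qs] by (simp add: Rg_def)
  moreover have "g = (g \<circ> q) \<circ> inv q" using sym_grp_inverses(3)[OF qs] by (simp add: comp_assoc)
  ultimately show ?thesis using Cg_inv by blast
qed

text \<open>If two boxes of one column are sent to one row, a row transposition before
  \<open>g\<close> equals a column transposition after it, and the opposite signs annihilate both
  sides. Otherwise \<open>RC_decomposition\<close> reduces the value at \<open>g\<close> to the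
  value at the identity.\<close>

theorem von_neumann:
  fixes y :: "(nat \<Rightarrow> nat) \<Rightarrow> int"
  assumes left: "\<And>p g. p \<in> Rg \<Longrightarrow> g \<in> sym_grp n \<Longrightarrow> y (p \<circ> g) = y g"
    and right: "\<And>q g. q \<in> Cg \<Longrightarrow> g \<in> sym_grp n \<Longrightarrow> y (g \<circ> q) = sign q * y g"
    and g: "g \<in> sym_grp n"
  shows "y g = y id * phi g"
proof (cases "\<exists>a b. a < n \<and> b < n \<and> a \<noteq> b \<and> col a = col b \<and> row (g a) = row (g b)")
  case True
  then obtain a b where ab: "a < n" "b < n" "a \<noteq> b" "col a = col b" "row (g a) = row (g b)" by blast
  define t where "t = Transposition.transpose (g a) (g b)"
  define t' where "t' = Transposition.transpose a b"
  have t: "t \<in> Rg" "t' \<in> Cg" using ab sym_grp_lt[OF g] by (auto simp: t_def t'_def intro: transpose_Rg transpose_Cg)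
  have "inj g" using g by (simp add: sym_grp_def permutes_inj)
  then have tg: "t \<circ> g = g \<circ> t'"
    by (auto simp: fun_eq_iff t_def t'_def Transposition.transpose_def inj_eq)
  have z: "f g = 0" if "f (t \<circ> g) = f g" "f (g \<circ> t') = - f g" for f :: "(nat \<Rightarrow> nat) \<Rightarrow> int"
    using that tg by simp
  have s: "sign t' = -1" using ab by (simp add: t'_def sign_swap_id)
  have "y g = 0" by (rule z) (simp_all only: left[OF t(1) g] right[OF t(2) g] s mult_minus1)
  moreover have "phi g = 0" by (rule z) (simp_all only: phi_left[OF t(1)] phi_right[OF t(2)] s mult_minus1)
  ultimately show ?thesis by simp
next
  case False
  then have "a = b" if "a < n" "b < n" "col a = col b" "row (g a) = row (g b)" for a b
    using that by blast
  then obtain p q where pq: "p \<in> Rg" "q \<in> Cg" "g = p \<circ> q"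
    using RC_decomposition[OF g] by blast
  have "y (p \<circ> q) = y (id \<circ> q)" using left[OF pq(1) Cg_sym_grp[OF pq(2)]] by simp
  also have "\<dots> = sign q * y id" using Rg_sym_grp[OF Rg_id] by (rule right[OF pq(2)])
  finally show ?thesis by (simp add: pq phi_RC)
qed

text \<open>A family closed under conjugation can be moved past row permutations, so its sum
  inherits both symmetries of \<open>phi\<close>. By \<open>von_neumann\<close> it is a multiple of
  \<open>phi\<close>, with its value at the identity as factor.\<close>

lemma central_sum:
  assumes "finite I" "\<And>i. i \<in> I \<Longrightarrow> h i \<in> sym_grp n"
    and conj: "\<And>p. p \<in> sym_grp n \<Longrightarrow> \<exists>\<beta>. bij_betw \<beta> I I \<and> (\<forall>i\<in>I. h i \<circ> p = p \<circ> h (\<beta> i))"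
    and g: "g \<in> sym_grp n"
  shows "(\<Sum>i\<in>I. phi (h i \<circ> g)) = (\<Sum>i\<in>I. phi (h i)) * phi g"
proof -
  define y where "y g = (\<Sum>i\<in>I. phi (h i \<circ> g))" for g
  have "y g = y id * phi g"
  proof (rule von_neumann)
    fix p g assume p: "p \<in> Rg"
    obtain \<beta> where \<beta>: "bij_betw \<beta> I I" "\<forall>i\<in>I. h i \<circ> p = p \<circ> h (\<beta> i)"
      using conj[OF Rg_sym_grp[OF p]] by blast
    have "y (p \<circ> g) = (\<Sum>i\<in>I. phi (p \<circ> (h (\<beta> i) \<circ> g)))"
      unfolding y_def using \<beta>(2) by (intro sum.cong refl) (metis comp_assoc)
    also have "\<dots> = (\<Sum>i\<in>I. phi (h (\<beta> i) \<circ> g))" by (simp only: phi_left[OF p])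
    also have "\<dots> = y g" unfolding y_def using sum.reindex_bij_betw[OF \<beta>(1), of "\<lambda>i. phi (h i \<circ> g)"] .
    finally show "y (p \<circ> g) = y g" .
  next
    fix q g assume "q \<in> Cg"
    then show "y (g \<circ> q) = sign q * y g"
      by (simp add: y_def o_assoc phi_right sum_distrib_left)
  qed (rule g)
  then show ?thesis by (simp add: y_def)
qed

text \<open>If the letters in \<open>I\<close> are more frequent than \<open>card I\<close> rows allow, two boxes of one column
  carry the same letter, and their transposition cancels the sum.\<close>

lemma phi_stabilizer_sum:
  assumes "finite I" "card {x. x < n \<and> row x < card I} < card {x. x < n \<and> w x \<in> I}"
  shows "(\<Sum>g\<in>sym_grp n. if w \<circ> g = w then phi g else 0) = 0"
proof -
  have inner: "(\<Sum>q\<in>Cg. if w \<circ> (p \<circ> q) = w then sign q else 0) = 0" if p: "p \<in> Rg" for p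
  proof -
    define u where "u = w \<circ> p"
    have "card {x. x < n \<and> u x \<in> I} = card {x. x < n \<and> w x \<in> I}"
      using card_perm[OF Rg_sym_grp[OF p], of "\<lambda>x. w x \<in> I"] by (simp add: u_def)
    then obtain a b where ab: "a < n" "b < n" "a \<noteq> b" "col a = col b" "u a = u b"
      using column_repeat[of I u] assms by auto
    define t where "t = Transposition.transpose a b"
    have t: "t \<in> Cg" "sign t = -1" using ab by (auto simp: t_def sign_swap_id intro: transpose_Cg)
    have ut: "u \<circ> t = u" using ab by (auto simp: t_def fun_eq_iff Transposition.transpose_def)
    show ?thesis
    proof (rule sum_involution[where h = "\<lambda>q. t \<circ> q"])
      fix q assume q: "q \<in> Cg"
      show "t \<circ> q \<in> Cg" using t q by (intro Cg_comp)
      show "t \<circ> (t \<circ> q) = q" by (simp add: t_def fun_eq_iff)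
      have "w \<circ> (p \<circ> (t \<circ> q)) = w \<circ> (p \<circ> q)"
        using ut by (simp add: u_def o_assoc)
      moreover have "sign (t \<circ> q) = - sign q"
        using t q by (simp add: sign_sym_grp_comp[OF Cg_sym_grp Cg_sym_grp])
      ultimately show "(if w \<circ> (p \<circ> (t \<circ> q)) = w then sign (t \<circ> q) else 0)
        = - (if w \<circ> (p \<circ> q) = w then sign q else 0)" by simp
    qed
  qed
  have "(\<Sum>g\<in>sym_grp n. if w \<circ> g = w then phi g else 0)
    = (\<Sum>g\<in>sym_grp n. \<Sum>p\<in>Rg. \<Sum>q\<in>Cg. if p \<circ> q = g then (if w \<circ> g = w then sign q else 0) else 0)"
  proof (intro sum.cong refl)
    fix g
    show "(if w \<circ> g = w then phi g else 0)
      = (\<Sum>p\<in>Rg. \<Sum>q\<in>Cg. if p \<circ> q = g then (if w \<circ> g = w then sign q else 0) else 0)"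
    proof (cases "w \<circ> g = w")
      case True
      then show ?thesis unfolding phi_def by (simp only: if_True simp_thms)
    next
      case False
      then show ?thesis by (simp only: if_False if_cancel sum.neutral_const)
    qed
  qed
  also have "\<dots> = (\<Sum>p\<in>Rg. \<Sum>q\<in>Cg. \<Sum>g\<in>sym_grp n. if p \<circ> q = g then (if w \<circ> g = w then sign q else 0) else 0)"
    by (subst sum.swap, rule sum.cong[OF refl], rule sum.swap)
  also have "\<dots> = (\<Sum>p\<in>Rg. \<Sum>q\<in>Cg. if w \<circ> (p \<circ> q) = w then sign q else 0)"
    by (intro sum.cong refl) (simp add: sym_grp_comp Rg_sym_grp Cg_sym_grp)
  also have "\<dots> = 0" by (intro sum.neutral ballI inner)
  finally show ?thesis .
qed

lemma phi_transpose:
  assumes ab: "a < n" "b < n" "a \<noteq> b"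
  shows "phi (Transposition.transpose a b) = of_bool (row a = row b) - of_bool (col a = col b)"
proof -
  define t where "t = Transposition.transpose a b"
  have nb: "\<not> (row a = row b \<and> col a = col b)" using box_inj ab by blast
  consider "row a = row b" | "col a = col b" | "row a \<noteq> row b" "col a \<noteq> col b" by blast
  then show ?thesis
  proof cases
    case 1
    then have "phi (t \<circ> id) = 1" using transpose_Rg ab Cg_id by (subst phi_RC) (auto simp: t_def)
    then show ?thesis using 1 nb by (simp add: t_def)
  next
    case 2
    then have "phi (id \<circ> t) = -1" using transpose_Cg ab Rg_id by (subst phi_RC) (auto simp: t_def sign_swap_id)
    then show ?thesis using 2 nb by (simp add: t_def)
  next
    case 3
    have "t \<noteq> p \<circ> q" if pq: "p \<in> Rg" "q \<in> Cg" for p q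
    proof
      assume eq: "t = p \<circ> q"
      have lt: "q x < n" if "x < n" for x using sym_grp_lt[OF Cg_sym_grp[OF pq(2)]] that by simp
      have rowq: "row (q x) = row (t x)" if "x < n" for x
        using pq(1) lt[OF that] by (simp add: Rg_def eq)
      have colq: "col (q x) = col x" if "x < n" for x using pq(2) that by (simp add: Cg_def)
      \<comment> \<open>Away from \<open>a\<close> and \<open>b\<close> the box \<open>q x\<close>
        has the row and the column of \<open>x\<close>.\<close>
      have "q x = x" if "x < n" "x \<noteq> a" "x \<noteq> b" for x
        using that rowq[of x] colq[of x] lt[of x] by - (rule box_inj, auto simp: t_def)
      moreover have "inj q" using Cg_sym_grp[OF pq(2)] by (simp add: sym_grp_def permutes_inj)
      ultimately have "q a = a \<or> q a = b" using lt[OF ab(1)] by (metis inj_eq)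
      then have "q a = a" using colq[OF ab(1)] 3 by auto
      then show False using rowq[OF ab(1)] 3 by (simp add: t_def)
    qed
    then have "phi t = 0" by (rule phi_not_RC)
    then show ?thesis using 3 by (simp add: t_def)
  qed
qed

section \<open>Row lengths and the content sum\<close>

definition lam :: "nat \<Rightarrow> nat" where
  "lam i = card {x. x < n \<and> row x = i}"

lemma row_eq_card: "x < n \<Longrightarrow> row x = card {y. y < n \<and> col y = col x \<and> row y < row x}"
proof -
  assume x: "x < n"
  have "bij_betw row {y. y < n \<and> col y = col x \<and> row y < row x} {..<row x}"
  proof (rule bij_betw_imageI)
    show "inj_on row {y. y < n \<and> col y = col x \<and> row y < row x}"
      by (rule inj_onI, rule box_inj) auto
    show "row ` {y. y < n \<and> col y = col x \<and> row y < row x} = {..<row x}"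
    proof (intro equalityI subsetI)
      fix i assume "i \<in> {..<row x}"
      then obtain y where "y < n" "row y = i" "col y = col x" using box_above[OF x, of i] by auto
      then show "i \<in> row ` {y. y < n \<and> col y = col x \<and> row y < row x}" using \<open>i \<in> _\<close> by auto
    qed auto
  qed
  then show ?thesis by (simp add: bij_betw_same_card)
qed

lemma row_less: "x < n \<Longrightarrow> row x < n"
proof -
  assume x: "x < n"
  have "row x = card {y. y < n \<and> col y = col x \<and> row y < row x}" by (rule row_eq_card[OF x])
  also have "\<dots> \<le> card ({..<n} - {x})" by (rule card_mono) auto
  also have "\<dots> < n" using x by simp
  finally show ?thesis .
qed

lemma sum_rows:
  assumes "n \<le> N" shows "(\<Sum>x<n. f (row x)) = (\<Sum>i<N. of_nat (lam i) * f i :: int)"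
proof -
  have "(\<Sum>x<n. f (row x)) = (\<Sum>i<N. \<Sum>x | x \<in> {..<n} \<and> row x = i. f (row x))"
    using row_less assms by (intro sum.group[symmetric]) (auto intro: less_le_trans)
  also have "\<dots> = (\<Sum>i<N. of_nat (lam i) * f i)"
    by (simp add: lam_def)
  finally show ?thesis .
qed

text \<open>Twice the sum of the contents. Row \<open>i\<close> contains
  \<open>lam i * (lam i - 1)\<close> ordered pairs; a box in row \<open>i\<close> has
  \<open>i\<close> boxes above it, so the column pairs count each row index twice.\<close>

lemma phi_transpose_total:
  assumes "n \<le> N"
  shows "(\<Sum>(a, b) | a < n \<and> b < n \<and> a \<noteq> b. phi (Transposition.transpose a b))
    = (\<Sum>i<N. int (lam i) * (int (lam i) - 1 - 2 * int i))"
proof -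
  have P: "{(a, b). a < n \<and> b < n \<and> a \<noteq> b} = (SIGMA a:{..<n}. {..<n} - {a})" by auto
  have "(\<Sum>(a, b) | a < n \<and> b < n \<and> a \<noteq> b. phi (Transposition.transpose a b))
    = (\<Sum>a<n. \<Sum>b\<in>{..<n}-{a}. phi (Transposition.transpose a b))"
    unfolding P by (simp add: sum.Sigma)
  also have "\<dots> = (\<Sum>a<n. \<Sum>b\<in>{..<n}-{a}. of_bool (row a = row b) - of_bool (col a = col b))"
    by (intro sum.cong refl phi_transpose) auto
  also have "\<dots> = (\<Sum>a<n. \<Sum>b\<in>{..<n}-{a}. of_bool (row a = row b)) - (\<Sum>a<n. \<Sum>b\<in>{..<n}-{a}. of_bool (col a = col b))"
    by (simp only: sum_subtractf)
  also have "(\<Sum>a<n. \<Sum>b\<in>{..<n}-{a}. of_bool (row a = row b)) = (\<Sum>a<n. int (lam (row a)) - 1)"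
  proof (rule sum.cong[OF refl])
    fix a assume a: "a \<in> {..<n}"
    have "{x. x < n \<and> row x = row a} = insert a {b \<in> {..<n} - {a}. row a = row b}" using a by auto
    then have "lam (row a) = Suc (card {b \<in> {..<n} - {a}. row a = row b})"
      by (simp add: lam_def)
    then show "(\<Sum>b\<in>{..<n}-{a}. of_bool (row a = row b)) = int (lam (row a)) - 1"
      by (simp add: Int_def)
  qed
  also have "\<dots> = (\<Sum>i<N. int (lam i) * (int (lam i) - 1))" by (rule sum_rows[OF assms])
  also have "(\<Sum>a<n. \<Sum>b\<in>{..<n}-{a}. of_bool (col a = col b)) = (\<Sum>a<n. 2 * int (row a))"
  proof -
    have split: "of_bool (col a = col b) = of_bool (col a = col b \<and> row b < row a) + (of_bool (col b = col a \<and> row a < row b) :: int)"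
      if "a < n" "b < n" "a \<noteq> b" for a b
      using that box_inj[of a b] by (cases "row a" "row b" rule: linorder_cases) auto
    have "(\<Sum>a<n. \<Sum>b\<in>{..<n}-{a}. of_bool (col a = col b) :: int)
      = (\<Sum>(a, b)\<in>offdiag n. of_bool (col a = col b \<and> row b < row a) + of_bool (col b = col a \<and> row a < row b))"
      unfolding sum_offdiag by (intro sum.cong refl split) auto
    also have "\<dots> = (\<Sum>(a, b)\<in>offdiag n. of_bool (col a = col b \<and> row b < row a)) + (\<Sum>(a, b)\<in>offdiag n. of_bool (col b = col a \<and> row a < row b))"
      by (simp add: case_prod_beta sum.distrib)
    also have "(\<Sum>(a, b)\<in>offdiag n. of_bool (col b = col a \<and> row a < row b) :: int) = (\<Sum>(a, b)\<in>offdiag n. of_bool (col a = col b \<and> row b < row a))"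
      by (rule sum_offdiag_swap)
    also have "(\<Sum>(a, b)\<in>offdiag n. of_bool (col a = col b \<and> row b < row a) :: int) = (\<Sum>a<n. int (row a))"
      unfolding sum_offdiag
    proof (rule sum.cong[OF refl])
      fix a assume a: "a \<in> {..<n}"
      have "(\<Sum>b\<in>{..<n}-{a}. of_bool (col a = col b \<and> row b < row a)) = int (card {b \<in> {..<n} - {a}. col a = col b \<and> row b < row a})"
        by (simp add: Int_def)
      also have "{b \<in> {..<n} - {a}. col a = col b \<and> row b < row a} = {y. y < n \<and> col y = col a \<and> row y < row a}" by auto
      also have "card \<dots> = row a" by (rule row_eq_card[symmetric]) (use a in simp)
      finally show "(\<Sum>b\<in>{..<n}-{a}. of_bool (col a = col b \<and> row b < row a)) = int (row a)" .
    qed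
    finally show ?thesis by (simp only: sum.distrib[symmetric] mult_2)
  qed
  also have "\<dots> = (\<Sum>i<N. int (lam i) * (2 * int i))" by (rule sum_rows[OF assms])
  finally show ?thesis by (simp only: sum_subtractf[symmetric] right_diff_distrib[symmetric])
qed

text \<open>By \<open>box_above\<close>, a column that meets row \<open>j\<close> also meets row
  \<open>i\<close>.\<close>

lemma lam_antimono: "i \<le> j \<Longrightarrow> lam j \<le> lam i"
proof -
  assume ij: "i \<le> j"
  have "col ` {x. x < n \<and> row x = j} \<subseteq> col ` {x. x < n \<and> row x = i}"
  proof
    fix c assume "c \<in> col ` {x. x < n \<and> row x = j}"
    then obtain x where x: "x < n" "row x = j" "c = col x" by auto
    then obtain y where "y < n" "row y = i" "col y = col x" using box_above[OF x(1), of i] ij by auto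
    then show "c \<in> col ` {x. x < n \<and> row x = i}" using x by (auto intro!: image_eqI[of _ _ y])
  qed
  moreover have "inj_on col {x. x < n \<and> row x = r}" for r by (rule inj_onI, rule box_inj) auto
  then have c: "card (col ` {x. x < n \<and> row x = r}) = lam r" for r
    unfolding lam_def by (rule card_image)
  ultimately show ?thesis unfolding c[symmetric] by (intro card_mono) auto
qed

lemma sum_lam: "n \<le> N \<Longrightarrow> (\<Sum>i<N. int (lam i)) = int n"
  using sum_rows[of N "\<lambda>_. 1"] by simp

lemma card_rows_below: "int (card {x. x < n \<and> row x < r}) = (\<Sum>i<r. int (lam i))"
proof -
  have "{x. x < n \<and> row x < r} = (\<Union>i<r. {x. x < n \<and> row x = i})" by auto
  also have "card \<dots> = (\<Sum>i<r. lam i)" unfolding lam_def by (rule card_UN_disjoint) auto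
  finally show ?thesis by simp
qed

end

section \<open>Frobenius' formula for cycles\<close>

lemma sym_grp_stable: "g \<in> sym_grp n \<Longrightarrow> stable g {..<n}"
  by (simp add: stable_def sym_grp_def permutes_in_image del: lessThan_iff)

section \<open>Rearrangements and dominance\<close>

lemma increasing_perm_id:
  assumes "\<sigma> \<in> sym_grp N" "\<And>i j. i < j \<Longrightarrow> j < N \<Longrightarrow> \<sigma> i < \<sigma> j"
  shows "\<sigma> = id"
proof -
  have ge: "i < N \<longrightarrow> i \<le> \<sigma> i" for i
  proof (induction i)
    case (Suc i)
    show ?case
    proof
      assume N: "Suc i < N"
      then have "i \<le> \<sigma> i" using Suc by linarith
      also have "\<dots> < \<sigma> (Suc i)" by (rule assms(2)) (use N in simp_all)
      finally show "Suc i \<le> \<sigma> (Suc i)" by (rule Suc_leI)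
    qed
  qed blast
  show ?thesis
  proof (rule ext)
    fix i
    show "\<sigma> i = id i"
    proof (cases "i < N")
      case True
      have "(\<Sum>i<N. i) = (\<Sum>i<N. \<sigma> i)"
        by (rule sum_sym_grp[OF assms(1), of "\<lambda>i. i", symmetric])
      then have "i = \<sigma> i"
        by (rule sum_mono_inv) (use ge True in blast)+
      then show ?thesis unfolding id_apply by (rule sym)
    next
      case False
      have "\<sigma> permutes {..<N}" using assms(1) unfolding sym_grp_def by blast
      then show ?thesis using False permutes_not_in[of \<sigma> "{..<N}" i] unfolding id_apply by blast
    qed
  qed
qed

text \<open>The inverse of the rank function, which is extended by the identity beyond
  \<open>N\<close>.\<close>

lemma sorting_perm:
  fixes \<gamma> :: "nat \<Rightarrow> int"
  assumes inj: "inj_on \<gamma> {..<N}"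
  obtains \<rho> where "\<rho> \<in> sym_grp N" "\<And>i j. i < j \<Longrightarrow> j < N \<Longrightarrow> \<gamma> (\<rho> i) < \<gamma> (\<rho> j)"
proof
  define rk where "rk i = (if i < N then card {j. j < N \<and> \<gamma> j < \<gamma> i} else i)" for i
  have less: "rk i < rk j" if "i < N" "j < N" "\<gamma> i < \<gamma> j" for i j
    unfolding rk_def using that by (auto intro!: psubset_card_mono)
  have "inj_on rk {..<N}"
  proof (rule inj_onI)
    fix i j assume ij: "i \<in> {..<N}" "j \<in> {..<N}" "rk i = rk j"
    then have "\<not> \<gamma> i < \<gamma> j" "\<not> \<gamma> j < \<gamma> i" using less[of i j] less[of j i] by auto
    then have "\<gamma> i = \<gamma> j" by simp
    then show "i = j" using inj_onD[OF inj] ij by blast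
  qed
  moreover have "rk ` {..<N} \<subseteq> {..<N}"
  proof (rule image_subsetI)
    fix i assume i: "i \<in> {..<N}"
    have "card {j. j < N \<and> \<gamma> j < \<gamma> i} \<le> card ({..<N} - {i})" by (rule card_mono) auto
    then show "rk i \<in> {..<N}" using i by (auto simp: rk_def)
  qed
  ultimately have "bij_betw rk {..<N} {..<N}" by (simp add: bij_betw_def endo_inj_surj)
  then have rk: "rk \<in> sym_grp N"
    unfolding sym_grp_def using bij_imp_permutes[of rk "{..<N}"] by (simp add: rk_def)
  then have p: "rk permutes {..<N}" by (simp add: sym_grp_def)
  show "inv rk \<in> sym_grp N" using p by (simp add: sym_grp_def permutes_inv)
  show "\<gamma> (inv rk i) < \<gamma> (inv rk j)" if ij: "i < j" "j < N" for i j
  proof (rule ccontr)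
    define a where "a = inv rk i"
    define b where "b = inv rk j"
    have lt: "a < N" "b < N"
      using permutes_in_image[OF permutes_inv[OF p], of i] permutes_in_image[OF permutes_inv[OF p], of j] ij
      by (auto simp: a_def b_def)
    have v: "rk a = i" "rk b = j" using permutes_inverses(1)[OF p] by (auto simp: a_def b_def)
    assume "\<not> \<gamma> (inv rk i) < \<gamma> (inv rk j)"
    then have "\<gamma> b \<le> \<gamma> a" by (simp add: a_def b_def)
    moreover have "a \<noteq> b" using v ij by auto
    then have "\<gamma> a \<noteq> \<gamma> b" using inj_onD[OF inj, of a b] lt by auto
    ultimately have "rk b < rk a" using less lt by simp
    then show False using v ij by simp
  qed
qed

lemma summation_by_parts:
  fixes d s :: "nat \<Rightarrow> int"
  shows "(\<Sum>i<Suc m. d i * s i) = (\<Sum>i<Suc m. d i) * s m - (\<Sum>i<m. (\<Sum>l<Suc i. d l) * (s (Suc i) - s i))"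
  by (induction m) (simp_all add: algebra_simps)

text \<open>Summation by parts turns the pairing with \<open>s\<close> into a sum of terms of one
  sign, each a partial sum of \<open>d\<close> times a positive step of \<open>s\<close>. Hence all
  partial sums vanish.\<close>

lemma dominance_rigid:
  fixes d s :: "nat \<Rightarrow> int"
  assumes "\<And>j. j \<le> N \<Longrightarrow> (\<Sum>i<j. d i) \<le> 0" "(\<Sum>i<N. d i) = 0"
    "\<And>i. Suc i < N \<Longrightarrow> s i < s (Suc i)" "(\<Sum>i<N. d i * s i) = 0" "i < N"
  shows "d i = 0"
proof -
  obtain m where N: "N = Suc m" using assms(5) by (cases N) auto
  have "(\<Sum>i<m. - (\<Sum>l<Suc i. d l) * (s (Suc i) - s i)) = 0"
  proof -
    have "(\<Sum>i<m. (\<Sum>l<Suc i. d l) * (s (Suc i) - s i)) = 0"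
      using summation_by_parts[of d s m] assms(2,4) unfolding N by simp
    then show ?thesis by (simp only: mult_minus_left sum_negf)
  qed
  moreover have "- (\<Sum>l<Suc i. d l) * (s (Suc i) - s i) \<ge> 0" if "i < m" for i
  proof -
    have "0 \<le> - (\<Sum>l<Suc i. d l)" using assms(1)[of "Suc i"] that by (simp add: N)
    moreover have "0 \<le> s (Suc i) - s i" using assms(3)[of i] that by (simp add: N)
    ultimately show ?thesis by (rule mult_nonneg_nonneg)
  qed
  ultimately have z: "- (\<Sum>l<Suc i. d l) * (s (Suc i) - s i) = 0" if "i < m" for i
    using sum_nonneg_eq_0_iff[of "{..<m}" "\<lambda>i. - (\<Sum>l<Suc i. d l) * (s (Suc i) - s i)"] that by auto
  have S: "(\<Sum>l<Suc i. d l) = 0" if "i < N" for i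
  proof (cases "i < m")
    case True
    then show ?thesis using z[OF True] assms(3)[of i] by (simp add: N)
  next
    case False
    then have "Suc i = N" using that N by simp
    then show ?thesis using assms(2) by simp
  qed
  show ?thesis
  proof (cases i)
    case 0
    then show ?thesis using S[of 0] assms(5) by simp
  next
    case (Suc j)
    then show ?thesis using S[of j] S[of i] assms(5) by simp
  qed
qed

lemma sum_subset_sym_grp_le:
  assumes "\<sigma> \<in> sym_grp N" "j \<le> N"
  shows "(\<Sum>i<j. int i) \<le> (\<Sum>i<j. int (\<sigma> i))"
proof -
  have "inj \<sigma>" using assms(1) by (simp add: sym_grp_def permutes_inj)
  then have "inj_on (\<lambda>i. int (\<sigma> i)) {..<j}" by (auto simp: inj_on_def)
  then show ?thesis by (rule sum_inj_ge) simp
qed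

text \<open>The sum is symmetric in its points; the reversal reconciles the increasing vector
  \<open>beta\<close> with the decreasing order of rows.\<close>

lemma frob_rev: "frob k N m = frob k N (\<lambda>j. m (N - 1 - j))"
proof -
  define r where "r j = N - 1 - j" for j
  have r: "r j < N" "r (r j) = j" if "j < N" for j using that by (auto simp: r_def)
  have r_inj: "i = j" if "r i = r j" "i < N" "j < N" for i j using that by (auto simp: r_def)
  have "(\<Sum>j<N. (\<Prod>s<k. m j - of_nat s) * (\<Prod>i\<in>{..<N}-{j}. (m j - m i - of_nat k) / (m j - m i)))
    = (\<Sum>j<N. (\<Prod>s<k. m (r j) - of_nat s) * (\<Prod>i\<in>{..<N}-{j}. (m (r j) - m (r i) - of_nat k) / (m (r j) - m (r i))))"
  proof (rule sum.reindex_bij_witness[of _ r r])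
    fix j assume j: "j \<in> {..<N}"
    have "(\<Prod>i\<in>{..<N}-{r j}. (m j - m (r i) - of_nat k) / (m j - m (r i)))
      = (\<Prod>i\<in>{..<N}-{j}. (m j - m i - of_nat k) / (m j - m i))"
    proof (rule prod.reindex_bij_witness[of _ r r])
      fix i assume i: "i \<in> {..<N} - {r j}"
      then show "r (r i) = i" using r by simp
      have "r i \<noteq> j" using i r(2)[of i] by fastforce
      then show "r i \<in> {..<N} - {j}" using i r(1) by simp
    next
      fix i assume i: "i \<in> {..<N} - {j}"
      then show *: "r (r i) = i" using r by simp
      have "r i \<noteq> r j" using i j r_inj[of "i" j] by blast
      then show "r i \<in> {..<N} - {r j}" using i r(1) by simp
    qed (rule refl)
    then show "(\<Prod>s<k. m (r (r j)) - of_nat s) * (\<Prod>i\<in>{..<N}-{r j}. (m (r (r j)) - m (r i) - of_nat k) / (m (r (r j)) - m (r i)))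
      = (\<Prod>s<k. m j - of_nat s) * (\<Prod>i\<in>{..<N}-{j}. (m j - m i - of_nat k) / (m j - m i))"
      using j r by simp
  qed (use r in auto)
  then show ?thesis by (simp add: frob_def r_def)
qed

text \<open>The cycles of length \<open>k\<close> described by orbits, as
  \<open>extract_cycle\<close> delivers them; \<open>conj_class_cycle\<close> identifies them with
  the conjugacy class.\<close>

definition cycle_perms :: "nat \<Rightarrow> nat \<Rightarrow> (nat \<Rightarrow> nat) set" where
  "cycle_perms n k = {g \<in> sym_grp n. \<exists>A\<in>orbs g {..<n}. card A = k \<and> (\<forall>x\<in>{..<n}-A. g x = x)}"

context tableau
begin

section \<open>The function D and its proportionality to an alternant\<close>

definition Dfun :: "nat \<Rightarrow> (nat \<Rightarrow> int) \<Rightarrow> int" where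
  "Dfun N \<gamma> = (\<Sum>g\<in>sym_grp n. phi g * psi {..<n} N g \<gamma>)"

text \<open>The partition plus the staircase, listed increasingly like \<open>int\<close> itself and
  continued beyond \<open>N\<close> as the support of \<open>psi\<close> requires.\<close>

definition beta :: "nat \<Rightarrow> nat \<Rightarrow> int" where
  "beta N i = (if i < N then int (lam (N - 1 - i)) + int i else int i)"

lemma antisym_Dfun: "antisym_fun N (Dfun N)"
  unfolding antisym_fun_def
proof (intro ballI allI)
  fix \<rho> \<gamma> assume \<rho>: "\<rho> \<in> sym_grp N"
  have "psi {..<n} N g (\<gamma> \<circ> \<rho>) = sign \<rho> * psi {..<n} N g \<gamma>" if "g \<in> sym_grp n" for g
    using antisym_psi[OF finite_lessThan sym_grp_stable[OF that], of N] \<rho> unfolding antisym_fun_def by blast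
  then show "Dfun N (\<gamma> \<circ> \<rho>) = sign \<rho> * Dfun N \<gamma>"
    by (simp add: Dfun_def sum_distrib_left mult.left_commute)
qed

text \<open>Replacing \<open>g\<close> by its product with a transposition transfers the sum over
  transpositions from \<open>psi\<close> to \<open>phi\<close>. It is evaluated by
  \<open>psi_transpose_sum\<close> on one side and by \<open>central_sum\<close> on the
  other.\<close>

lemma Dfun_eigen:
  "((\<Sum>i<N. (\<gamma> i)^2) - (\<Sum>i<N. (int i)^2) - (2 * int N - 1) * int n) * Dfun N \<gamma>
   = (\<Sum>(a, b) | a < n \<and> b < n \<and> a \<noteq> b. phi (Transposition.transpose a b)) * Dfun N \<gamma>"
proof -
  define P where "P = {(a, b). a < n \<and> b < n \<and> a \<noteq> b}"
  define tr where "tr p = Transposition.transpose (fst p) (snd p)" for p :: "nat \<times> nat"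
  have fP: "finite P" by (rule finite_subset[of _ "{..<n} \<times> {..<n}"]) (auto simp: P_def)
  have tr: "tr p \<in> sym_grp n" "tr p \<circ> (tr p \<circ> g) = g" if "p \<in> P" for p and g :: "nat \<Rightarrow> nat"
    using that by (auto simp: tr_def P_def transpose_sym_grp fun_eq_iff)
  define E where "E = (\<Sum>i<N. (\<gamma> i)^2) - (\<Sum>i<N. (int i)^2) - (2 * int N - 1) * int n"
  have psi: "E * psi {..<n} N g \<gamma> = (\<Sum>p\<in>P. psi {..<n} N (tr p \<circ> g) \<gamma>)" if "g \<in> sym_grp n" for g
  proof -
    have "g permutes {..<n}" using that by (simp add: sym_grp_def)
    from psi_transpose_sum[OF finite_lessThan this, of N \<gamma>] show ?thesis
      by (simp add: E_def P_def tr_def case_prod_beta)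
  qed
  have "E * Dfun N \<gamma> = (\<Sum>g\<in>sym_grp n. phi g * (E * psi {..<n} N g \<gamma>))"
    by (simp add: Dfun_def sum_distrib_left mult.left_commute)
  also have "\<dots> = (\<Sum>g\<in>sym_grp n. \<Sum>p\<in>P. phi g * psi {..<n} N (tr p \<circ> g) \<gamma>)"
    by (simp add: psi sum_distrib_left)
  also have "\<dots> = (\<Sum>p\<in>P. \<Sum>g\<in>sym_grp n. phi g * psi {..<n} N (tr p \<circ> g) \<gamma>)"
    by (rule sum.swap)
  also have "\<dots> = (\<Sum>p\<in>P. \<Sum>g\<in>sym_grp n. phi (tr p \<circ> g) * psi {..<n} N g \<gamma>)"
  proof (rule sum.cong[OF refl])
    fix p assume p: "p \<in> P"
    show "(\<Sum>g\<in>sym_grp n. phi g * psi {..<n} N (tr p \<circ> g) \<gamma>) = (\<Sum>g\<in>sym_grp n. phi (tr p \<circ> g) * psi {..<n} N g \<gamma>)"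
      using sum_sym_grp_left[OF tr(1)[OF p], of "\<lambda>g. phi g * psi {..<n} N (tr p \<circ> g) \<gamma>"]
      by (simp only: tr(2)[OF p])
  qed
  also have "\<dots> = (\<Sum>g\<in>sym_grp n. (\<Sum>p\<in>P. phi (tr p \<circ> g)) * psi {..<n} N g \<gamma>)"
    unfolding sum_distrib_right by (rule sum.swap)
  also have "\<dots> = (\<Sum>g\<in>sym_grp n. ((\<Sum>p\<in>P. phi (tr p)) * phi g) * psi {..<n} N g \<gamma>)"
  proof (intro sum.cong refl arg_cong2[where f = "(*)"] central_sum[OF fP])
    fix p assume p: "p \<in> sym_grp n"
    note ip = sym_grp_inverses[OF p] sym_grp_lt[OF sym_grp_inv[OF p]] sym_grp_lt[OF p]
    have inj: "inv p x = inv p y \<longleftrightarrow> x = y" "p x = p y \<longleftrightarrow> x = y" for x y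
      using ip(1)[of x] ip(1)[of y] ip(2)[of x] ip(2)[of y] by metis+
    have "bij_betw (map_prod (inv p) (inv p)) P P"
      by (rule bij_betw_byWitness[where f' = "map_prod p p"]) (auto simp: P_def ip inj)
    moreover have "tr q \<circ> p = p \<circ> tr (map_prod (inv p) (inv p) q)" for q
    proof
      fix x
      have "inj p" using p by (simp add: sym_grp_def permutes_inj)
      then show "(tr q \<circ> p) x = (p \<circ> tr (map_prod (inv p) (inv p) q)) x"
        using ip(1,2) by (cases q) (auto simp: tr_def Transposition.transpose_def)
    qed
    ultimately show "\<exists>\<beta>. bij_betw \<beta> P P \<and> (\<forall>q\<in>P. tr q \<circ> p = p \<circ> tr (\<beta> q))" by blast
  qed (use tr(1) in auto)
  also have "\<dots> = (\<Sum>p\<in>P. phi (tr p)) * Dfun N \<gamma>"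
    by (simp add: Dfun_def sum_distrib_left mult.assoc)
  finally show ?thesis by (simp add: E_def P_def tr_def case_prod_beta)
qed

text \<open>After expanding over \<open>\<sigma>\<close> and over words, some word of content
  \<open>sub \<gamma> \<sigma>\<close> has a nonzero stabilizer sum. By
  \<open>phi_stabilizer_sum\<close> it has at most as many letters in \<open>I\<close> as there are
  boxes in the first \<open>card I\<close> rows.\<close>

lemma Dfun_support:
  assumes "Dfun N \<gamma> \<noteq> 0"
  obtains \<sigma> where "\<sigma> \<in> sym_grp N"
    "\<forall>I\<subseteq>{..<N}. (\<Sum>i\<in>I. sub \<gamma> \<sigma> i) \<le> (\<Sum>i<card I. int (lam i))"
proof -
  have expand: "Dfun N \<gamma> = (\<Sum>\<sigma>\<in>sym_grp N. sign \<sigma> * (\<Sum>g\<in>sym_grp n. phi g * fix_count {..<n} N g (sub \<gamma> \<sigma>)))"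
  proof -
    have "Dfun N \<gamma> = (\<Sum>g\<in>sym_grp n. \<Sum>\<sigma>\<in>sym_grp N. phi g * (sign \<sigma> * fix_count {..<n} N g (sub \<gamma> \<sigma>)))"
      by (simp only: Dfun_def psi_def sum_distrib_left)
    also have "\<dots> = (\<Sum>\<sigma>\<in>sym_grp N. \<Sum>g\<in>sym_grp n. phi g * (sign \<sigma> * fix_count {..<n} N g (sub \<gamma> \<sigma>)))"
      by (rule sum.swap)
    also have "\<dots> = (\<Sum>\<sigma>\<in>sym_grp N. \<Sum>g\<in>sym_grp n. sign \<sigma> * (phi g * fix_count {..<n} N g (sub \<gamma> \<sigma>)))"
      by (simp only: mult.left_commute)
    finally show ?thesis by (simp only: sum_distrib_left)
  qed
  obtain \<sigma> where \<sigma>: "\<sigma> \<in> sym_grp N" "(\<Sum>g\<in>sym_grp n. phi g * fix_count {..<n} N g (sub \<gamma> \<sigma>)) \<noteq> 0"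
  proof -
    have "(\<Sum>\<sigma>\<in>sym_grp N. sign \<sigma> * (\<Sum>g\<in>sym_grp n. phi g * fix_count {..<n} N g (sub \<gamma> \<sigma>))) \<noteq> 0"
      using assms expand by simp
    then obtain \<tau> where "\<tau> \<in> sym_grp N" "sign \<tau> * (\<Sum>g\<in>sym_grp n. phi g * fix_count {..<n} N g (sub \<gamma> \<tau>)) \<noteq> 0"
      by (rule sum.not_neutral_contains_not_neutral)
    then show ?thesis using that[of \<tau>] by auto
  qed
  define W where "W = {w\<in>words {..<n} N. cont {..<n} w = sub \<gamma> \<sigma>}"
  have fW: "finite W" by (simp add: W_def)
  have fix_count: "fix_count {..<n} N g (sub \<gamma> \<sigma>) = (\<Sum>w\<in>W. if w \<circ> g = w then 1 else 0)" for g
  proof -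
    have "{w\<in>fixw {..<n} N g. cont {..<n} w = sub \<gamma> \<sigma>} = W \<inter> {w. w \<circ> g = w}" by (auto simp: fixw_def W_def)
    then show ?thesis using fW by (simp add: fix_count_def sum.If_cases)
  qed
  have "(\<Sum>g\<in>sym_grp n. phi g * fix_count {..<n} N g (sub \<gamma> \<sigma>)) = (\<Sum>g\<in>sym_grp n. \<Sum>w\<in>W. if w \<circ> g = w then phi g else 0)"
    unfolding fix_count sum_distrib_left by (intro sum.cong refl) auto
  also have "\<dots> = (\<Sum>w\<in>W. \<Sum>g\<in>sym_grp n. if w \<circ> g = w then phi g else 0)"
    by (rule sum.swap)
  finally have "(\<Sum>w\<in>W. \<Sum>g\<in>sym_grp n. if w \<circ> g = w then phi g else 0) \<noteq> 0" using \<sigma>(2) by simp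
  then obtain w where w: "w \<in> W" "(\<Sum>g\<in>sym_grp n. if w \<circ> g = w then phi g else 0) \<noteq> 0"
    by (rule sum.not_neutral_contains_not_neutral)
  have "(\<Sum>i\<in>I. sub \<gamma> \<sigma> i) \<le> (\<Sum>i<card I. int (lam i))" if I: "I \<subseteq> {..<N}" for I
  proof -
    have fI: "finite I" using I finite_subset by blast
    then have "\<not> card {x. x < n \<and> row x < card I} < card {x. x < n \<and> w x \<in> I}"
      using phi_stabilizer_sum[of I w] w(2) by blast
    then have le: "int (card {x. x < n \<and> w x \<in> I}) \<le> (\<Sum>i<card I. int (lam i))"
      by (simp only: card_rows_below[symmetric])
    have "{x. x < n \<and> w x \<in> I} = (\<Union>i\<in>I. {x. x \<in> {..<n} \<and> w x = i})" by auto
    then have "card {x. x < n \<and> w x \<in> I} = (\<Sum>i\<in>I. card {x. x \<in> {..<n} \<and> w x = i})"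
      using fI by (simp only:) (rule card_UN_disjoint, auto)
    then have "int (card {x. x < n \<and> w x \<in> I}) = (\<Sum>i\<in>I. cont {..<n} w i)"
      by (simp only: cont_def of_nat_sum)
    then show ?thesis using le w(1) by (simp add: W_def)
  qed
  then show ?thesis by (intro that[OF \<sigma>(1)] allI impI)
qed

lemma Dfun_nonzero:
  assumes "Dfun N \<gamma> \<noteq> 0"
  shows "\<And>i. 0 \<le> \<gamma> i" "(\<Sum>i<N. \<gamma> i) = (\<Sum>i<N. int i) + int n" "\<And>i. N \<le> i \<Longrightarrow> \<gamma> i = int i"
proof -
  have "(\<Sum>g\<in>sym_grp n. phi g * psi {..<n} N g \<gamma>) \<noteq> 0" using assms by (simp add: Dfun_def)
  then obtain g where "phi g * psi {..<n} N g \<gamma> \<noteq> 0" by (rule sum.not_neutral_contains_not_neutral)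
  then have g: "psi {..<n} N g \<gamma> \<noteq> 0" by auto
  show "\<And>i. 0 \<le> \<gamma> i" "(\<Sum>i<N. \<gamma> i) = (\<Sum>i<N. int i) + int n" "\<And>i. N \<le> i \<Longrightarrow> \<gamma> i = int i"
    using psi_nonzero[OF _ g] by auto
qed

lemma sum_reverse: "(\<Sum>i<N. f i (N - 1 - i)) = (\<Sum>i<N. f (N - 1 - i) i)" for f :: "nat \<Rightarrow> nat \<Rightarrow> int"
  by (rule sum.reindex_bij_witness[of _ "\<lambda>i. N - 1 - i" "\<lambda>i. N - 1 - i"]) auto

lemma beta_props:
  assumes "n \<le> N"
  shows "(\<Sum>i<N. beta N i) = (\<Sum>i<N. int i) + int n"
    "\<And>i j. i < j \<Longrightarrow> j < N \<Longrightarrow> beta N i < beta N j" "\<And>i. 0 \<le> beta N i"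
    "(\<Sum>i<N. (beta N i)^2) - (\<Sum>i<N. (int i)^2) - (2 * int N - 1) * int n
     = (\<Sum>(a, b) | a < n \<and> b < n \<and> a \<noteq> b. phi (Transposition.transpose a b))"
proof -
  have "(\<Sum>i<N. beta N i) = (\<Sum>i<N. int (lam (N - 1 - i))) + (\<Sum>i<N. int i)"
    by (simp add: beta_def sum.distrib)
  then show s: "(\<Sum>i<N. beta N i) = (\<Sum>i<N. int i) + int n"
    using sum_reverse[of "\<lambda>_ j. int (lam j)" N] sum_lam[OF assms] by simp
  show "beta N i < beta N j" if "i < j" "j < N" for i j
  proof -
    have "N - 1 - j \<le> N - 1 - i" using that by simp
    from lam_antimono[OF this] show ?thesis using that by (simp add: beta_def)
  qed
  show "0 \<le> beta N i" for i by (simp add: beta_def)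
  have "(\<Sum>i<N. (beta N i)^2) - (\<Sum>i<N. (int i)^2) - (2 * int N - 1) * int n
    = (\<Sum>i<N. (int (lam (N - 1 - i)) + int i)^2 - (int i)^2 - (2 * int N - 1) * int (lam (N - 1 - i)))"
    using sum_reverse[of "\<lambda>_ j. int (lam j)" N] sum_lam[OF assms]
    by (simp add: sum_subtractf beta_def flip: sum_distrib_left)
  \<comment> \<open>Reversing the index restores the order of the rows, after which the squares
    expand to the terms of \<open>phi_transpose_total\<close>.\<close>
  also have "\<dots> = (\<Sum>i<N. (int (lam i) + int (N - 1 - i))^2 - (int (N - 1 - i))^2 - (2 * int N - 1) * int (lam i))"
    by (rule sum_reverse[of "\<lambda>i j. (int (lam j) + int i)^2 - (int i)^2 - (2 * int N - 1) * int (lam j)"])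
  also have "\<dots> = (\<Sum>i<N. int (lam i) * (int (lam i) - 1 - 2 * int i))"
  proof (rule sum.cong[OF refl])
    fix i assume "i \<in> {..<N}"
    then have "int (N - 1 - i) = int N - 1 - int i" by (simp add: of_nat_diff)
    then show "(int (lam i) + int (N - 1 - i))^2 - (int (N - 1 - i))^2 - (2 * int N - 1) * int (lam i)
      = int (lam i) * (int (lam i) - 1 - 2 * int i)"
      by (simp add: power2_eq_square algebra_simps)
  qed
  also have "\<dots> = (\<Sum>(a, b) | a < n \<and> b < n \<and> a \<noteq> b. phi (Transposition.transpose a b))"
    by (rule phi_transpose_total[OF assms, symmetric])
  finally show "(\<Sum>i<N. (beta N i)^2) - (\<Sum>i<N. (int i)^2) - (2 * int N - 1) * int n
     = (\<Sum>(a, b) | a < n \<and> b < n \<and> a \<noteq> b. phi (Transposition.transpose a b))" .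
qed

text \<open>The difference \<open>d\<close> of \<open>beta N\<close> and \<open>\<gamma>\<close> has
  nonpositive partial sums by dominance and total 0 by homogeneity. Equal eigenvalues give equal
  sums of squares, so \<open>d\<close> pairs to 0 with the increasing vector
  \<open>beta N + \<gamma>\<close>, and \<open>dominance_rigid\<close> applies.\<close>

lemma Dfun_increasing:
  assumes "n \<le> N" "Dfun N \<gamma> \<noteq> 0" and incr: "\<And>i j. i < j \<Longrightarrow> j < N \<Longrightarrow> \<gamma> i < \<gamma> j"
  shows "\<gamma> = beta N"
proof -
  obtain \<sigma> where \<sigma>: "\<sigma> \<in> sym_grp N"
    and dom: "\<forall>I\<subseteq>{..<N}. (\<Sum>i\<in>I. sub \<gamma> \<sigma> i) \<le> (\<Sum>i<card I. int (lam i))"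
    using assms(2) by (rule Dfun_support)
  define d where "d i = beta N i - \<gamma> i" for i
  have total: "(\<Sum>i<N. d i) = 0"
    using beta_props(1)[OF assms(1)] Dfun_nonzero(2)[OF assms(2)] by (simp add: d_def sum_subtractf)
  have split: "(\<Sum>i<N. f i) = (\<Sum>i<j. f i) + (\<Sum>i\<in>{j..<N}. f i)" if "j \<le> N" for j and f :: "nat \<Rightarrow> int"
  proof -
    have "{..<N} = {..<j} \<union> {j..<N}" using that by auto
    then have "(\<Sum>i<N. f i) = sum f ({..<j} \<union> {j..<N})" by (rule arg_cong)
    also have "\<dots> = (\<Sum>i<j. f i) + (\<Sum>i\<in>{j..<N}. f i)" by (rule sum.union_disjoint) auto
    finally show ?thesis .
  qed
  \<comment> \<open>Dominance is used for the top indices \<open>{j..<N}\<close>, where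
    \<open>\<sigma>\<close> sums to at most what the identity gives.\<close>
  have part: "(\<Sum>i<j. d i) \<le> 0" if j: "j \<le> N" for j
  proof -
    have "(\<Sum>i\<in>{j..<N}. sub \<gamma> \<sigma> i) \<le> (\<Sum>i<N - j. int (lam i))"
    proof -
      have "{j..<N} \<subseteq> {..<N}" by auto
      from dom[rule_format, OF this] show ?thesis by (simp only: card_atLeastLessThan)
    qed
    also have "\<dots> = (\<Sum>i\<in>{j..<N}. int (lam (N - 1 - i)))"
      by (rule sum.reindex_bij_witness[of _ "\<lambda>i. N - 1 - i" "\<lambda>i. N - 1 - i"]) (use j in auto)
    also have "\<dots> = (\<Sum>i\<in>{j..<N}. beta N i - int i)"
      by (rule sum.cong) (auto simp: beta_def)
    finally have "(\<Sum>i\<in>{j..<N}. \<gamma> i) - (\<Sum>i\<in>{j..<N}. int (\<sigma> i)) \<le> (\<Sum>i\<in>{j..<N}. beta N i) - (\<Sum>i\<in>{j..<N}. int i)"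
      by (simp add: sub_def sum_subtractf)
    moreover have "(\<Sum>i\<in>{j..<N}. int (\<sigma> i)) \<le> (\<Sum>i\<in>{j..<N}. int i)"
      using split[OF j, of int] split[OF j, of "\<lambda>i. int (\<sigma> i)"] sum_sym_grp[OF \<sigma>, of int] sum_subset_sym_grp_le[OF \<sigma> j]
      by linarith
    ultimately have "(\<Sum>i\<in>{j..<N}. d i) \<ge> 0" by (simp add: d_def sum_subtractf)
    then show ?thesis using total split[OF j, of d] by linarith
  qed
  have "((\<Sum>i<N. (\<gamma> i)^2) - (\<Sum>i<N. (int i)^2) - (2 * int N - 1) * int n)
    = ((\<Sum>i<N. (beta N i)^2) - (\<Sum>i<N. (int i)^2) - (2 * int N - 1) * int n)"
    using Dfun_eigen[of \<gamma> N] assms(2) by (simp only: beta_props(4)[OF assms(1)] mult_right_cancel[OF assms(2)])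
  then have "(\<Sum>i<N. (beta N i)^2) - (\<Sum>i<N. (\<gamma> i)^2) = 0" by linarith
  moreover have "d i * (beta N i + \<gamma> i) = (beta N i)^2 - (\<gamma> i)^2" for i
    unfolding d_def by (simp only: power2_eq_square square_diff_square_factored mult.commute)
  ultimately have quad: "(\<Sum>i<N. d i * (beta N i + \<gamma> i)) = 0"
    by (simp only: sum_subtractf)
  have d0: "d i = 0" if "i < N" for i
  proof (rule dominance_rigid[OF part total _ quad that])
    show "beta N i + \<gamma> i < beta N (Suc i) + \<gamma> (Suc i)" if "Suc i < N" for i
      using incr[of i "Suc i"] beta_props(2)[OF assms(1), of i "Suc i"] that by simp
  qed
  show ?thesis
  proof
    fix i
    show "\<gamma> i = beta N i"
      using d0[of i] Dfun_nonzero(3)[OF assms(2), of i] by (cases "i < N") (auto simp: d_def beta_def)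
  qed
qed

lemma alternant_increasing:
  assumes "\<And>i j. i < j \<Longrightarrow> j < N \<Longrightarrow> \<mu> i < \<mu> j" "\<And>i j. i < j \<Longrightarrow> j < N \<Longrightarrow> \<gamma> i < \<gamma> j"
  shows "alternant N \<mu> \<gamma> = (if \<gamma> = \<mu> then 1 else 0)"
proof -
  have "\<sigma> = id" if \<sigma>: "\<sigma> \<in> sym_grp N" "\<gamma> = \<mu> \<circ> \<sigma>" for \<sigma>
  proof (rule increasing_perm_id[OF \<sigma>(1)])
    fix i j assume ij: "i < j" "j < N"
    then have "\<mu> (\<sigma> i) < \<mu> (\<sigma> j)" using assms(2)[OF ij] \<sigma>(2) by simp
    moreover have "\<sigma> i < N" using ij \<sigma>(1) sym_grp_lt[of \<sigma> N i] by simp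
    ultimately show "\<sigma> i < \<sigma> j" using assms(1)[of "\<sigma> j" "\<sigma> i"] by (cases "\<sigma> i" "\<sigma> j" rule: linorder_cases) auto
  qed
  then have "alternant N \<mu> \<gamma> = (\<Sum>\<sigma>\<in>sym_grp N. if \<sigma> = id then (if \<gamma> = \<mu> then 1 else 0) else 0)"
    unfolding alternant_def
  proof (intro sum.cong refl)
    fix \<sigma> assume \<sigma>: "\<sigma> \<in> sym_grp N"
    show "(if \<gamma> = \<mu> \<circ> \<sigma> then sign \<sigma> else 0) = (if \<sigma> = id then (if \<gamma> = \<mu> then 1 else 0) else 0)"
    proof (cases "\<sigma> = id")
      case False
      then have "\<gamma> \<noteq> \<mu> \<circ> \<sigma>" using \<open>\<And>\<sigma>. \<sigma> \<in> sym_grp N \<Longrightarrow> \<gamma> = \<mu> \<circ> \<sigma> \<Longrightarrow> \<sigma> = id\<close> \<sigma> by blast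
      then show ?thesis using False by simp
    qed simp
  qed
  then show ?thesis using finite_sym_grp[of N] by (simp add: sym_grp_def permutes_id)
qed

text \<open>Both sides are antisymmetric, so increasing exponents suffice, and among those
  \<open>Dfun_increasing\<close> admits just \<open>beta N\<close>.\<close>

lemma Dfun_eq_alternant:
  assumes "n \<le> N"
  shows "Dfun N \<gamma> = Dfun N (beta N) * alternant N (beta N) \<gamma>"
proof (cases "inj_on \<gamma> {..<N}")
  case False
  then show ?thesis
    using antisym_fun_noninj[OF antisym_Dfun] antisym_fun_noninj[OF antisym_alternant] by simp
next
  case True
  then obtain \<rho> where \<rho>: "\<rho> \<in> sym_grp N" and incr: "\<And>i j. i < j \<Longrightarrow> j < N \<Longrightarrow> \<gamma> (\<rho> i) < \<gamma> (\<rho> j)"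
    using sorting_perm by blast
  have "Dfun N (\<gamma> \<circ> \<rho>) = Dfun N (beta N) * alternant N (beta N) (\<gamma> \<circ> \<rho>)"
  proof (cases "\<gamma> \<circ> \<rho> = beta N")
    case True
    then show ?thesis using alternant_increasing[of N "beta N" "beta N"] beta_props(2)[OF assms] by simp
  next
    case False
    then have "Dfun N (\<gamma> \<circ> \<rho>) = 0" using Dfun_increasing[OF assms, of "\<gamma> \<circ> \<rho>"] incr by auto
    moreover have "alternant N (beta N) (\<gamma> \<circ> \<rho>) = 0"
      using alternant_increasing[of N "beta N" "\<gamma> \<circ> \<rho>"] beta_props(2)[OF assms] incr False by simp
    ultimately show ?thesis by simp
  qed
  moreover have "Dfun N (\<gamma> \<circ> \<rho>) = sign \<rho> * Dfun N \<gamma>" "alternant N (beta N) (\<gamma> \<circ> \<rho>) = sign \<rho> * alternant N (beta N) \<gamma>"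
    using antisym_Dfun antisym_alternant \<rho> unfolding antisym_fun_def by blast+
  ultimately have "sign \<rho> * Dfun N \<gamma> = sign \<rho> * (Dfun N (beta N) * alternant N (beta N) \<gamma>)"
    by (simp only: mult.left_commute)
  then show ?thesis by simp
qed

lemma inj_on_beta: "n \<le> N \<Longrightarrow> inj_on (beta N) {..<N}"
  by (rule linorder_inj_onI) (auto dest: beta_props(2))

lemma frob_beta: "frob k N (cvec (beta N)) = frob k N (\<lambda>j. of_nat (lam j + (N - 1 - j)))"
proof -
  have cong: "frob k N f = frob k N f'" if "\<And>j. j < N \<Longrightarrow> f j = f' j" for f f'
    unfolding frob_def using that by (intro arg_cong2[where f = "(*)"] sum.cong prod.cong refl) auto
  show ?thesis
    by (subst frob_rev, rule cong) (auto simp: cvec_def beta_def)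
qed

text \<open>The proportionality of \<open>Dfun\<close> is evaluated at the staircase in two ways:
  \<open>n\<close> operators for p_1 isolate the identity, where \<open>phi\<close> is 1, and one
  for p_k with \<open>n - k\<close> for p_1 isolates the cycles. These are the two equations
  required by \<open>frob_eq_lowering\<close>.\<close>

theorem cycle_sum_eq_frob:
  assumes "n \<le> N" "2 \<le> k" "k \<le> n"
  shows "of_int (\<Sum>g\<in>cycle_perms n k. phi g) = frob k N (\<lambda>j. of_nat (lam j + (N - 1 - j)))"
proof -
  define C where "C = Dfun N (beta N)"
  define F where "F = (\<Sum>g\<in>cycle_perms n k. phi g)"
  have D: "(\<lambda>\<gamma>. \<Sum>g\<in>sym_grp n. phi g * psi {..<n} N g \<gamma>) = (\<lambda>\<gamma>. C * alternant N (beta N) \<gamma>)"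
    unfolding C_def Dfun_def[symmetric] by (rule ext) (rule Dfun_eq_alternant[OF assms(1)])
  have perm: "permutation g" "stable g {..<n}" if "g \<in> sym_grp n" for g
    using that sym_grp_permutation sym_grp_stable by auto
  have "C * dlow N n (beta N) = (Yop N 1 ^^ n) (\<lambda>\<gamma>. C * alternant N (beta N) \<gamma>) int"
    by (simp add: Yiter_scale dlow_def)
  also have "\<dots> = (\<Sum>g\<in>sym_grp n. phi g * (Yop N 1 ^^ n) (psi {..<n} N g) int)"
    unfolding D[symmetric] by (simp only: Yiter_sum Yiter_scale)
  also have "\<dots> = (\<Sum>g\<in>sym_grp n. if g = id then fact n else 0)"
  proof (rule sum.cong[OF refl])
    fix g assume g: "g \<in> sym_grp n"
    have "(\<forall>x\<in>{..<n}. g x = x) \<longleftrightarrow> g = id"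
      using g by (auto simp: fun_eq_iff sym_grp_def) (metis lessThan_iff permutes_not_in)
    then show "phi g * (Yop N 1 ^^ n) (psi {..<n} N g) int = (if g = id then fact n else 0)"
      using Yiter_psi[OF finite_lessThan perm[OF g], of n N int] assms(1) by (simp add: alternant_int phi_id)
  qed
  also have "\<dots> = fact n" using finite_sym_grp[of n] by (simp add: sym_grp_def permutes_id)
  finally have 1: "C * dlow N n (beta N) = fact n" .
  have "C * (\<Sum>l<N. dlow N (n - k) ((beta N)(l := beta N l - int k)))
    = (Yop N 1 ^^ (n - k)) (Yop N k (\<lambda>\<gamma>. C * alternant N (beta N) \<gamma>)) int"
    by (simp only: Yop_scale Yop_alternant Yiter_scale Yiter_sum dlow_def)
  also have "\<dots> = (\<Sum>g\<in>sym_grp n. phi g * (Yop N 1 ^^ (n - k)) (Yop N k (psi {..<n} N g)) int)"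
    unfolding D[symmetric] by (simp only: Yop_sum Yop_scale Yiter_sum Yiter_scale)
  also have "\<dots> = (\<Sum>g\<in>sym_grp n. if g \<in> cycle_perms n k then int k * fact (n - k) * phi g else 0)"
  proof (rule sum.cong[OF refl])
    fix g assume g: "g \<in> sym_grp n"
    show "phi g * (Yop N 1 ^^ (n - k)) (Yop N k (psi {..<n} N g)) int
      = (if g \<in> cycle_perms n k then int k * fact (n - k) * phi g else 0)"
    proof -
      have "(Yop N 1 ^^ (n - k)) (Yop N k (psi {..<n} N g)) int
        = (if \<exists>A\<in>orbs g {..<n}. card A = k \<and> (\<forall>x\<in>{..<n}-A. g x = x) then int k * fact (n - k) else 0)"
        using extract_cycle[OF finite_lessThan perm[OF g], of N k] assms by (simp only: card_lessThan)
      moreover have "g \<in> cycle_perms n k \<longleftrightarrow> (\<exists>A\<in>orbs g {..<n}. card A = k \<and> (\<forall>x\<in>{..<n}-A. g x = x))"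
        using g unfolding cycle_perms_def by blast
      ultimately show ?thesis by (cases "g \<in> cycle_perms n k") (simp_all only: if_True if_False mult_zero_right mult.commute)
    qed
  qed
  also have "\<dots> = int k * fact (n - k) * F"
  proof -
    have "sym_grp n \<inter> {g. g \<in> cycle_perms n k} = cycle_perms n k" by (auto simp: cycle_perms_def)
    then show ?thesis by (simp add: sum.If_cases F_def sum_distrib_left)
  qed
  finally have 2: "C * (\<Sum>l<N. dlow N (n - k) ((beta N)(l := beta N l - int k))) = int k * fact (n - k) * F" .
  have "of_int F = frob k N (cvec (beta N))"
    by (rule frob_eq_lowering[OF inj_on_beta[OF assms(1)] beta_props(1)[OF assms(1)] _ _ _ 1 2])
      (use assms in \<open>auto simp: beta_def\<close>)
  then show ?thesis by (simp only: F_def frob_beta)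
qed

lemma frob_zero:
  assumes "n \<le> N" "n < k" shows "frob k N (\<lambda>j. of_nat (lam j + (N - 1 - j))) = 0"
  using frob_small[OF inj_on_beta[OF assms(1)] beta_props(1)[OF assms(1)] beta_props(3)[OF assms(1)] assms(2)]
  by (simp only: frob_beta)

end
section \<open>The conjugacy class of a cycle\<close>

lemma cycle_of_list_upt:
  assumes "i < k"
  shows "cycle_of_list [0..<k] i = (if Suc i = k then 0 else Suc i)"
proof -
  have "map (cycle_of_list [0..<k]) [0..<k] = rotate1 [0..<k]"
    using cyclic_rotation[of "[0..<k]" 1] by simp
  then have "cycle_of_list [0..<k] ([0..<k] ! i) = rotate1 [0..<k] ! i"
    using assms by (metis length_map length_upt minus_nat.diff_0 nth_map)
  also have "\<dots> = [0..<k] ! (Suc i mod k)"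
    using assms by (subst nth_rotate1) auto
  finally show ?thesis using assms by auto
qed

lemma cycle_of_list_upt_beyond: "k \<le> i \<Longrightarrow> cycle_of_list [0..<k] i = i"
  by (rule id_outside_supp) simp

text \<open>A conjugate by \<open>h\<close> runs through \<open>h 0, ..., h (k - 1)\<close> and
  fixes the rest. Conversely, a conjugating permutation is read off from the orbit.\<close>

lemma conj_class_cycle:
  assumes "1 \<le> k" "k \<le> n"
  shows "conj_class n (cycle_of_list [0..<k]) = cycle_perms n k"
proof (intro equalityI subsetI)
  define c where "c = cycle_of_list [0..<k]"
  have c: "c i = (if Suc i = k then 0 else Suc i)" if "i < k" for i
    unfolding c_def by (rule cycle_of_list_upt[OF that])
  have c': "c i = i" if "k \<le> i" for i unfolding c_def by (rule cycle_of_list_upt_beyond[OF that])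
  have cs: "c \<in> sym_grp n"
    unfolding c_def sym_grp_def using cycle_permutes[of "[0..<k]"] assms(2)
    by (auto intro: permutes_subset)
  fix g assume "g \<in> conj_class n (cycle_of_list [0..<k])"
  then obtain h where h: "h \<in> sym_grp n" "g = h \<circ> c \<circ> inv h"
    by (auto simp: conj_class_def sym_grp_def sym_grp_def c_def)
  have hp: "h permutes {..<n}" using h by (simp add: sym_grp_def)
  note ih = permutes_inverses[OF hp]
  have gh: "g (h i) = h (c i)" for i by (simp add: h(2) ih)
  have gs: "g \<in> sym_grp n"
    unfolding h(2) using h(1) cs hp by (intro sym_grp_comp) (auto simp: sym_grp_def permutes_inv)
  have orb: "orbit g (h 0) = h ` {..<k}"
  proof (intro equalityI subsetI)
    fix y assume "y \<in> orbit g (h 0)"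
    then show "y \<in> h ` {..<k}"
    proof induction
      case base
      then show ?case using assms(1) by (auto simp: gh c)
    next
      case (step y)
      then obtain i where "i < k" "y = h i" by auto
      then show ?case using assms(1) by (auto simp: gh c)
    qed
  next
    have in_orb: "h i \<in> orbit g (h 0)" if "i < k" for i
      using that
    proof (induction i)
      case 0
      show ?case by (rule permutation_self_in_orbit[OF sym_grp_permutation[OF gs]])
    next
      case (Suc i)
      then have "g (h i) \<in> orbit g (h 0)" by (intro orbit.step) simp
      then show ?case using Suc.prems by (simp add: gh c)
    qed
    fix y assume "y \<in> h ` {..<k}"
    then show "y \<in> orbit g (h 0)" using in_orb by auto
  qed
  have "inj h" using hp by (rule permutes_inj)
  then have "inj_on h {..<k}" by (rule inj_on_subset) simp
  then have "card (orbit g (h 0)) = k" unfolding orb by (simp only: card_image card_lessThan)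
  moreover have "g x = x" if "x \<notin> orbit g (h 0)" for x
  proof -
    have "\<not> inv h x < k" using that unfolding orb by (metis ih(1) image_eqI lessThan_iff)
    then have "c (inv h x) = inv h x" using c' by simp
    then show ?thesis using gh[of "inv h x"] by (simp add: ih)
  qed
  moreover have "h 0 < n" using permutes_in_image[OF hp, of 0] assms by simp
  ultimately show "g \<in> cycle_perms n k"
    using gs unfolding cycle_perms_def orbs_def by auto
next
  define c where "c = cycle_of_list [0..<k]"
  have c: "c i = (if Suc i = k then 0 else Suc i)" if "i < k" for i
    unfolding c_def by (rule cycle_of_list_upt[OF that])
  have c': "c i = i" if "k \<le> i" for i unfolding c_def by (rule cycle_of_list_upt_beyond[OF that])
  fix g assume g: "g \<in> cycle_perms n k"
  then have gs: "g \<in> sym_grp n" by (simp add: cycle_perms_def)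
  obtain x where x: "x < n" "card (orbit g x) = k" "\<forall>y\<in>{..<n} - orbit g x. g y = y"
    using g by (auto simp: cycle_perms_def orbs_def)
  define A where "A = orbit g x"
  have xx: "x \<in> orbit g x" by (rule permutation_self_in_orbit[OF sym_grp_permutation[OF gs]])
  define p where "p = funpow_dist1 g x x"
  have A: "A = (\<lambda>i. (g ^^ i) x) ` {0..<p}" unfolding A_def p_def by (rule orbit_conv_funpow_dist1[OF xx])
  have injp: "inj_on (\<lambda>i. (g ^^ i) x) {0..<p}" unfolding p_def by (rule inj_on_funpow_dist1[OF xx])
  have pk: "p = k" using x(2) card_image[OF injp] by (simp add: A_def[symmetric] A)
  have gk: "(g ^^ k) x = x" using funpow_dist1_prop[OF xx] by (simp add: p_def[symmetric] pk)
  have An: "A \<subseteq> {..<n}" unfolding A_def by (rule orbit_in_stable) (use sym_grp_stable[OF gs] x in auto)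
  have "card {k..<n} = card ({..<n} - A)"
    using An x(2) by (simp add: card_Diff_subset finite_subset A_def[symmetric])
  then obtain e where e: "bij_betw e {k..<n} ({..<n} - A)"
    using finite_same_card_bij[of "{k..<n}" "{..<n} - A"] by auto
  \<comment> \<open>The orbit of \<open>x\<close> is listed in the order in which \<open>g\<close>
    runs through it; the remaining points are matched arbitrarily by \<open>e\<close>.\<close>
  define h where "h i = (if i < k then (g ^^ i) x else if i < n then e i else i)" for i
  have hA: "bij_betw h {..<k} A"
    using injp by (auto simp: bij_betw_def A pk h_def inj_on_def)
  have "bij_betw h {k..<n} ({..<n} - A)"
    using e by (rule bij_betw_cong[THEN iffD1, rotated]) (auto simp: h_def)
  with hA have "bij_betw h ({..<k} \<union> {k..<n}) (A \<union> ({..<n} - A))"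
    by (rule bij_betw_combine) auto
  moreover have "{..<k} \<union> {k..<n} = {..<n}" "A \<union> ({..<n} - A) = {..<n}" using assms An by auto
  ultimately have "bij_betw h {..<n} {..<n}" by simp
  then have hp: "h permutes {..<n}"
    by (rule bij_imp_permutes) (use assms in \<open>auto simp: h_def\<close>)
  note ih = permutes_inverses[OF hp]
  have "g (h i) = h (c i)" for i
  proof -
    consider "i < k" "Suc i = k" | "Suc i < k" | "k \<le> i" "i < n" | "n \<le> i" by linarith
    then show ?thesis
    proof cases
      case 1
      then have "g (h i) = (g ^^ k) x" by (auto simp: h_def)
      then show ?thesis using 1 assms by (simp add: gk c h_def)
    next
      case 2
      then show ?thesis by (simp add: c h_def)
    next
      case 3
      then have "e i \<in> {..<n} - A" using e by (auto simp: bij_betw_def)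
      then show ?thesis using 3 x(3) by (auto simp: c' h_def A_def)
    next
      case 4
      then have "g i = i" using gs by (simp add: sym_grp_def permutes_not_in)
      then show ?thesis using 4 assms by (simp add: c' h_def)
    qed
  qed
  then have "g = h \<circ> c \<circ> inv h" by (auto simp: fun_eq_iff) (metis ih(1))
  then show "g \<in> conj_class n (cycle_of_list [0..<k])"
    using hp by (auto simp: conj_class_def sym_grp_def c_def)
qed

lemma cycle_perms_inv: 
  assumes "g \<in> cycle_perms n k" shows "inv g \<in> cycle_perms n k"
proof -
  have g: "g \<in> sym_grp n" using assms by (simp add: cycle_perms_def)
  then have p: "g permutes {..<n}" by (simp add: sym_grp_def)
  have "orbit (inv g) x = orbit g x" for x by (rule orbit_inv_eq[OF sym_grp_permutation[OF g]])
  moreover have "inv g x = x" if "g x = x" for x by (metis that permutes_inverses(2)[OF p])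
  moreover have "inv g \<in> sym_grp n" using p by (simp add: sym_grp_def permutes_inv)
  ultimately show ?thesis using assms by (auto simp: cycle_perms_def orbs_def)
qed

lemma cycle_perms_conj:
  assumes "g \<in> cycle_perms n k" "h \<in> sym_grp n" "1 \<le> k" "k \<le> n"
  shows "h \<circ> g \<circ> inv h \<in> cycle_perms n k"
proof -
  obtain u where u: "u permutes {..<n}" "g = u \<circ> cycle_of_list [0..<k] \<circ> inv u"
    using assms(1) conj_class_cycle[OF assms(3,4)] by (auto simp: conj_class_def sym_grp_def)
  have h: "h permutes {..<n}" using assms(2) by (simp add: sym_grp_def)
  have "h \<circ> g \<circ> inv h = (h \<circ> u) \<circ> cycle_of_list [0..<k] \<circ> inv (h \<circ> u)"
    using u h by (simp add: o_inv_distrib permutes_bij comp_assoc)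
  moreover have "h \<circ> u permutes {..<n}" using u h by (simp add: permutes_compose)
  ultimately show ?thesis
    unfolding conj_class_cycle[OF assms(3,4), symmetric] conj_class_def sym_grp_def by blast
qed

section \<open>The standard tableau\<close>

text \<open>The inverse of \<open>tableau_entry\<close>. The clause for the empty list is reached
  only by numbers outside the diagram.\<close>

fun box :: "nat list \<Rightarrow> nat \<Rightarrow> nat \<times> nat" where
  "box [] x = (0, 0)"
| "box (a # \<mu>) x = (if x < a then (0, x) else map_prod Suc id (box \<mu> (x - a)))"

lemma box_entry: "(i, j) \<in> diagram \<mu> \<Longrightarrow> box \<mu> (tableau_entry \<mu> i j) = (i, j)"
proof (induction \<mu> arbitrary: i)
  case (Cons a \<mu>)
  then show ?case by (cases i) (auto simp: diagram_def tableau_entry_def)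
qed (simp add: diagram_def)

lemma tableau_entry_less: "(i, j) \<in> diagram \<mu> \<Longrightarrow> tableau_entry \<mu> i j < sum_list \<mu>"
proof (induction \<mu> arbitrary: i)
  case (Cons a \<mu>)
  show ?case
  proof (cases i)
    case 0
    then show ?thesis using Cons.prems by (simp add: diagram_def tableau_entry_def)
  next
    case (Suc i')
    then have "tableau_entry \<mu> i' j < sum_list \<mu>"
      using Cons.prems Cons.IH[of i'] by (simp add: diagram_def)
    then show ?thesis using Suc by (simp add: tableau_entry_def)
  qed
qed (simp add: diagram_def)

lemma box_diagram: "x < sum_list \<mu> \<Longrightarrow> box \<mu> x \<in> diagram \<mu>"
proof (induction \<mu> arbitrary: x)
  case (Cons a \<mu>)
  show ?case
  proof (cases "x < a")
    case False
    then have "box \<mu> (x - a) \<in> diagram \<mu>" using Cons by simp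
    then show ?thesis using False by (cases "box \<mu> (x - a)") (simp add: diagram_def)
  qed (simp add: diagram_def)
qed simp

lemma entry_box: "x < sum_list \<mu> \<Longrightarrow> tableau_entry \<mu> (fst (box \<mu> x)) (snd (box \<mu> x)) = x"
proof (induction \<mu> arbitrary: x)
  case (Cons a \<mu>)
  show ?case
  proof (cases "x < a")
    case False
    then have "tableau_entry \<mu> (fst (box \<mu> (x - a))) (snd (box \<mu> (x - a))) = x - a" using Cons by simp
    then show ?thesis using False by (simp add: tableau_entry_def)
  qed (simp add: tableau_entry_def)
qed simp

lemma diagram_upward:
  assumes "is_partition \<mu>" "(i, j) \<in> diagram \<mu>" "i' \<le> i"
  shows "(i', j) \<in> diagram \<mu>"
proof -
  have "\<mu> ! i \<le> \<mu> ! i'"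
    using assms sorted_wrt_nth_less[of "(\<ge>)" \<mu> i' i]
    by (cases "i' = i") (auto simp: is_partition_def diagram_def)
  then show ?thesis using assms(2,3) by (auto simp: diagram_def)
qed

lemma tableau_box:
  assumes "is_partition \<mu>"
  shows "tableau (sum_list \<mu>) (\<lambda>x. fst (box \<mu> x)) (\<lambda>x. snd (box \<mu> x))"
proof
  fix x y assume "x < sum_list \<mu>" "y < sum_list \<mu>" "fst (box \<mu> x) = fst (box \<mu> y)" "snd (box \<mu> x) = snd (box \<mu> y)"
  then show "x = y" using entry_box[of x \<mu>] entry_box[of y \<mu>] by metis
next
  fix x i assume x: "x < sum_list \<mu>" "i \<le> fst (box \<mu> x)"
  define j where "j = snd (box \<mu> x)"
  have d: "(i, j) \<in> diagram \<mu>"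
    by (rule diagram_upward[OF assms _ x(2)]) (use box_diagram[OF x(1)] in \<open>simp add: j_def\<close>)
  show "\<exists>y<sum_list \<mu>. fst (box \<mu> y) = i \<and> snd (box \<mu> y) = snd (box \<mu> x)"
  proof (intro exI conjI)
    show "tableau_entry \<mu> i j < sum_list \<mu>" by (rule tableau_entry_less[OF d])
    show "fst (box \<mu> (tableau_entry \<mu> i j)) = i" "snd (box \<mu> (tableau_entry \<mu> i j)) = snd (box \<mu> x)"
      by (simp_all add: box_entry[OF d]) (simp add: j_def)
  qed
qed

lemma card_row: "card {x. x < sum_list \<mu> \<and> fst (box \<mu> x) = i} = part \<mu> (Suc i)"
proof -
  have "bij_betw (\<lambda>j. tableau_entry \<mu> i j) {j. (i, j) \<in> diagram \<mu>} {x. x < sum_list \<mu> \<and> fst (box \<mu> x) = i}"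
  proof (rule bij_betw_byWitness[where f' = "\<lambda>x. snd (box \<mu> x)"])
    show "\<forall>j\<in>{j. (i, j) \<in> diagram \<mu>}. snd (box \<mu> (tableau_entry \<mu> i j)) = j"
      by (simp add: box_entry)
    show "\<forall>x\<in>{x. x < sum_list \<mu> \<and> fst (box \<mu> x) = i}. tableau_entry \<mu> i (snd (box \<mu> x)) = x"
      using entry_box by blast
    show "(\<lambda>j. tableau_entry \<mu> i j) ` {j. (i, j) \<in> diagram \<mu>} \<subseteq> {x. x < sum_list \<mu> \<and> fst (box \<mu> x) = i}"
      by (auto simp: box_entry tableau_entry_less)
    show "(\<lambda>x. snd (box \<mu> x)) ` {x. x < sum_list \<mu> \<and> fst (box \<mu> x) = i} \<subseteq> {j. (i, j) \<in> diagram \<mu>}"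
      using box_diagram[of _ \<mu>] by auto
  qed
  then have "card {x. x < sum_list \<mu> \<and> fst (box \<mu> x) = i} = card {j. (i, j) \<in> diagram \<mu>}"
    by (simp only: bij_betw_same_card)
  also have "{j. (i, j) \<in> diagram \<mu>} = {..<part \<mu> (Suc i)}"
    by (auto simp: diagram_def part_def)
  finally show ?thesis by simp
qed

lemma row_group_iff:
  "g \<in> row_group \<mu> \<longleftrightarrow> g \<in> sym_grp (sum_list \<mu>) \<and> (\<forall>x<sum_list \<mu>. fst (box \<mu> (g x)) = fst (box \<mu> x))"
  (is "_ \<longleftrightarrow> _ \<and> ?R")
proof -
  have "(\<forall>(i, j)\<in>diagram \<mu>. \<exists>j'. (i, j') \<in> diagram \<mu> \<and> g (tableau_entry \<mu> i j) = tableau_entry \<mu> i j') \<longleftrightarrow> ?R"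
    (is "?L \<longleftrightarrow> _") if g: "g \<in> sym_grp (sum_list \<mu>)"
  proof
    assume L: ?L
    show ?R
    proof (intro allI impI)
      fix x assume x: "x < sum_list \<mu>"
      obtain i j where ij: "box \<mu> x = (i, j)" by fastforce
      then have "(i, j) \<in> diagram \<mu>" "tableau_entry \<mu> i j = x" using box_diagram[OF x] entry_box[OF x] by simp_all
      then obtain j' where "(i, j') \<in> diagram \<mu>" "g x = tableau_entry \<mu> i j'" using L by blast
      then show "fst (box \<mu> (g x)) = fst (box \<mu> x)" using ij by (simp add: box_entry)
    qed
  next
    assume R: ?R
    show ?L
    proof (intro ballI, clarify)
      fix i j assume ij: "(i, j) \<in> diagram \<mu>"
      define x where "x = tableau_entry \<mu> i j"
      have x: "x < sum_list \<mu>" "box \<mu> x = (i, j)" using ij by (simp_all add: x_def box_entry tableau_entry_less)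
      have gx: "g x < sum_list \<mu>" using g x(1) permutes_in_image[of g "{..<sum_list \<mu>}" x] by (simp add: sym_grp_def)
      have f: "fst (box \<mu> (g x)) = i" using R x by simp
      show "\<exists>j'. (i, j') \<in> diagram \<mu> \<and> g (tableau_entry \<mu> i j) = tableau_entry \<mu> i j'"
        using box_diagram[OF gx] entry_box[OF gx] f unfolding x_def[symmetric]
        by (intro exI[of _ "snd (box \<mu> (g x))"]) (cases "box \<mu> (g x)", simp)
    qed
  qed
  then show ?thesis by (auto simp: row_group_def sym_grp_def sym_grp_def)
qed

lemma col_group_iff:
  "g \<in> col_group \<mu> \<longleftrightarrow> g \<in> sym_grp (sum_list \<mu>) \<and> (\<forall>x<sum_list \<mu>. snd (box \<mu> (g x)) = snd (box \<mu> x))"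
  (is "_ \<longleftrightarrow> _ \<and> ?R")
proof -
  have "(\<forall>(i, j)\<in>diagram \<mu>. \<exists>i'. (i', j) \<in> diagram \<mu> \<and> g (tableau_entry \<mu> i j) = tableau_entry \<mu> i' j) \<longleftrightarrow> ?R"
    (is "?L \<longleftrightarrow> _") if g: "g \<in> sym_grp (sum_list \<mu>)"
  proof
    assume L: ?L
    show ?R
    proof (intro allI impI)
      fix x assume x: "x < sum_list \<mu>"
      obtain i j where ij: "box \<mu> x = (i, j)" by fastforce
      then have "(i, j) \<in> diagram \<mu>" "tableau_entry \<mu> i j = x" using box_diagram[OF x] entry_box[OF x] by simp_all
      then obtain i' where "(i', j) \<in> diagram \<mu>" "g x = tableau_entry \<mu> i' j" using L by blast
      then show "snd (box \<mu> (g x)) = snd (box \<mu> x)" using ij by (simp add: box_entry)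
    qed
  next
    assume R: ?R
    show ?L
    proof (intro ballI, clarify)
      fix i j assume ij: "(i, j) \<in> diagram \<mu>"
      define x where "x = tableau_entry \<mu> i j"
      have x: "x < sum_list \<mu>" "box \<mu> x = (i, j)" using ij by (simp_all add: x_def box_entry tableau_entry_less)
      have gx: "g x < sum_list \<mu>" using g x(1) permutes_in_image[of g "{..<sum_list \<mu>}" x] by (simp add: sym_grp_def)
      have f: "snd (box \<mu> (g x)) = j" using R x by simp
      show "\<exists>i'. (i', j) \<in> diagram \<mu> \<and> g (tableau_entry \<mu> i j) = tableau_entry \<mu> i' j"
        using box_diagram[OF gx] entry_box[OF gx] f unfolding x_def[symmetric]
        by (intro exI[of _ "fst (box \<mu> (g x))"]) (cases "box \<mu> (g x)", simp)
    qed
  qed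
  then show ?thesis by (auto simp: col_group_def sym_grp_def sym_grp_def)
qed

lemma sum_fun_apply: "(\<Sum>i\<in>A. f i) x = (\<Sum>i\<in>A. f i x)" for f :: "'a \<Rightarrow> 'b \<Rightarrow> 'c::comm_monoid_add"
  by (induction A rule: infinite_finite_induct) auto

lemma young_symmetrizer_eq:
  assumes "is_partition \<mu>"
  shows "young_symmetrizer \<mu> g = of_int (tableau.phi (sum_list \<mu>) (\<lambda>x. fst (box \<mu> x)) (\<lambda>x. snd (box \<mu> x)) g)"
proof -
  interpret tableau "sum_list \<mu>" "\<lambda>x. fst (box \<mu> x)" "\<lambda>x. snd (box \<mu> x)" by (rule tableau_box[OF assms])
  have "Rg = row_group \<mu>" "Cg = col_group \<mu>" by (auto simp: Rg_def Cg_def row_group_iff col_group_iff)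
  then show ?thesis
    unfolding young_symmetrizer_def phi_def sum_fun_apply of_int_sum
    by (intro sum.cong) (auto simp: grp_alg_scale_def grp_alg_single_def)
qed

section \<open>The group algebra\<close>

lemma grp_alg_mult_apply:
  assumes "g \<in> sym_grp n"
  shows "grp_alg_mult n x y g = (\<Sum>h\<in>sym_grp n. x h * y (inv h \<circ> g))"
proof -
  have perm: "h permutes {..<n}" if "h \<in> sym_grp n" for h using that by (simp add: sym_grp_def)
  have "(\<Sum>(h, h') | h \<in> sym_grp n \<and> h' \<in> sym_grp n \<and> h \<circ> h' = g. x h * y h')
    = (\<Sum>h\<in>sym_grp n. x h * y (inv h \<circ> g))"
  proof (rule sum.reindex_bij_witness[of _ "\<lambda>h. (h, inv h \<circ> g)" fst])
    fix a assume "a \<in> {(h, h'). h \<in> sym_grp n \<and> h' \<in> sym_grp n \<and> h \<circ> h' = g}"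
    then obtain h h' where a: "a = (h, h')" "h \<in> sym_grp n" "h \<circ> h' = g" by auto
    have "inv h \<circ> g = h'"
      using a(2) permutes_inv_o(2)[of h "{..<n}"] by (simp add: a(3)[symmetric] o_assoc sym_grp_def)
    then show "(fst a, inv (fst a) \<circ> g) = a" "fst a \<in> sym_grp n"
      "x (fst a) * y (inv (fst a) \<circ> g) = (case a of (h, h') \<Rightarrow> x h * y h')"
      using a(1,2) by (simp_all add: sym_grp_def sym_grp_def)
  next
    fix h assume h: "h \<in> sym_grp n"
    have "inv h \<circ> g \<in> sym_grp n"
      using h assms by (simp add: sym_grp_def sym_grp_def permutes_compose permutes_inv)
    moreover have "h \<circ> (inv h \<circ> g) = g"
      using permutes_inv_o(1)[OF perm[OF h]] by (simp add: o_assoc)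
    ultimately show "(h, inv h \<circ> g) \<in> {(h, h'). h \<in> sym_grp n \<and> h' \<in> sym_grp n \<and> h \<circ> h' = g}"
      using h by (simp add: sym_grp_def sym_grp_def)
  qed simp
  then show ?thesis by (simp add: grp_alg_mult_def)
qed

lemma grp_alg_mult_outside:
  assumes "g \<notin> sym_grp n"
  shows "grp_alg_mult n x y g = 0"
proof -
  have "{(h, h'). h \<in> sym_grp n \<and> h' \<in> sym_grp n \<and> h \<circ> h' = g} = {}"
    using assms permutes_compose[of _ "{..<n}"] by (auto simp: sym_grp_def sym_grp_def)
  then show ?thesis by (simp only: grp_alg_mult_def sum.empty)
qed

lemma grp_alg_single_mult:
  assumes "h \<in> sym_grp n"
  shows "grp_alg_mult n (grp_alg_single h) x = (\<lambda>g. if g \<in> sym_grp n then x (inv h \<circ> g) else 0)"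
proof
  fix g
  show "grp_alg_mult n (grp_alg_single h) x g = (if g \<in> sym_grp n then x (inv h \<circ> g) else 0)"
  proof (cases "g \<in> sym_grp n")
    case True
    have "(\<Sum>h'\<in>sym_grp n. grp_alg_single h h' * x (inv h' \<circ> g)) = (\<Sum>h'\<in>sym_grp n. if h' = h then x (inv h \<circ> g) else 0)"
      by (rule sum.cong) (auto simp: grp_alg_single_def)
    then show ?thesis using True assms by (simp add: grp_alg_mult_apply finite_sym_grp)
  qed (simp add: grp_alg_mult_outside)
qed

section \<open>Traces\<close>

text \<open>The basis chosen in \<open>grp_alg_trace\<close> depends on \<open>V\<close> alone. All
  operators on \<open>V\<close> share it, so additivity and cyclicity of the trace follow without a
  change of basis.\<close>

definition trace_basis :: "grp_alg set \<Rightarrow> grp_alg set" where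
  "trace_basis V = (SOME B. B \<subseteq> V \<and> grp_alg.independent B \<and> V \<subseteq> grp_alg.span B)"

lemma grp_alg_trace_eq:
  "grp_alg_trace V T = (\<Sum>b\<in>trace_basis V. grp_alg.representation (trace_basis V) (T b) b)"
  by (simp add: grp_alg_trace_def trace_basis_def Let_def)

lemma trace_basis:
  shows "trace_basis V \<subseteq> V" "grp_alg.independent (trace_basis V)" "V \<subseteq> grp_alg.span (trace_basis V)"
proof -
  have "\<exists>B. B \<subseteq> V \<and> grp_alg.independent B \<and> V \<subseteq> grp_alg.span B"
    by (rule grp_alg.maximal_independent_subset[of V]) (intro exI conjI)
  from someI_ex[OF this] show "trace_basis V \<subseteq> V" "grp_alg.independent (trace_basis V)" "V \<subseteq> grp_alg.span (trace_basis V)"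
    unfolding trace_basis_def[symmetric] by blast+
qed

lemma finite_trace_basis:
  assumes "V \<subseteq> grp_alg_carrier n"
  shows "finite (trace_basis V)"
proof -
  have "x \<in> grp_alg.span (grp_alg_single ` sym_grp n)" if x: "x \<in> grp_alg_carrier n" for x
  proof -
    have "x = (\<Sum>g\<in>sym_grp n. grp_alg_scale (x g) (grp_alg_single g))"
    proof
      fix h
      have "(\<Sum>g\<in>sym_grp n. grp_alg_scale (x g) (grp_alg_single g)) h = (\<Sum>g\<in>sym_grp n. if g = h then x h else 0)"
        unfolding sum_fun_apply by (rule sum.cong) (auto simp: grp_alg_scale_def grp_alg_single_def)
      also have "\<dots> = x h"
        using x by (auto simp: grp_alg_carrier_def sym_grp_def sym_grp_def finite_permutations)
      finally show "x h = (\<Sum>g\<in>sym_grp n. grp_alg_scale (x g) (grp_alg_single g)) h" by (rule sym)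
    qed
    moreover have "(\<Sum>g\<in>sym_grp n. grp_alg_scale (x g) (grp_alg_single g)) \<in> grp_alg.span (grp_alg_single ` sym_grp n)"
      by (intro grp_alg.span_sum grp_alg.span_scale grp_alg.span_base imageI)
    ultimately show ?thesis by (simp only:)
  qed
  then have "trace_basis V \<subseteq> grp_alg.span (grp_alg_single ` sym_grp n)"
    using trace_basis(1)[of V] assms by blast
  then show ?thesis
    using grp_alg.independent_span_bound[OF finite_imageI[OF finite_sym_grp] trace_basis(2)] by blast
qed

text \<open>Linearity in the form in which it is applied: to expansions in a finite subset of
  \<open>V\<close>.\<close>

definition lin_op :: "grp_alg set \<Rightarrow> (grp_alg \<Rightarrow> grp_alg) \<Rightarrow> bool" where
  "lin_op V T \<longleftrightarrow> T ` V \<subseteq> V \<and> (\<forall>B a. finite B \<longrightarrow> B \<subseteq> V \<longrightarrow>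
     T (\<Sum>b\<in>B. grp_alg_scale (a b) b) = (\<Sum>b\<in>B. grp_alg_scale (a b) (T b)))"

text \<open>The diagonal of a product of two matrices; exchanging the two summations gives
  \<open>trace_commute\<close>.\<close>

lemma trace_comp:
  assumes V: "V \<subseteq> grp_alg_carrier n" and S: "lin_op V S" and T: "lin_op V T"
  shows "grp_alg_trace V (\<lambda>x. S (T x))
    = (\<Sum>b'\<in>trace_basis V. \<Sum>b\<in>trace_basis V.
        grp_alg.representation (trace_basis V) (T b') b * grp_alg.representation (trace_basis V) (S b) b')"
proof -
  define B where "B = trace_basis V"
  note B = trace_basis[of V, folded B_def] finite_trace_basis[OF V, folded B_def]
  define R where "R = grp_alg.representation B"
  have "R (S (T b')) b' = (\<Sum>b\<in>B. R (T b') b * R (S b) b')" if b': "b' \<in> B" for b'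
  proof -
    have Tb: "T b' \<in> V" using T b' B(1) by (auto simp: lin_op_def)
    have Sb: "S b \<in> grp_alg.span B" if "b \<in> B" for b using S that B(1,3) by (auto simp: lin_op_def)
    have "T b' = (\<Sum>b\<in>B. grp_alg_scale (R (T b') b) b)"
      unfolding R_def
      by (rule grp_alg.sum_representation_eq[symmetric]) (use B Tb in auto)
    then have "S (T b') = S (\<Sum>b\<in>B. grp_alg_scale (R (T b') b) b)" by (rule arg_cong)
    also have "\<dots> = (\<Sum>b\<in>B. grp_alg_scale (R (T b') b) (S b))"
      using S B(1,4) by (simp add: lin_op_def)
    finally have "R (S (T b')) = R (\<Sum>b\<in>B. grp_alg_scale (R (T b') b) (S b))" by (rule arg_cong)
    also have "\<dots> = (\<lambda>u. \<Sum>b\<in>B. R (grp_alg_scale (R (T b') b) (S b)) u)"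
      unfolding R_def by (rule grp_alg.representation_sum) (use B Sb grp_alg.span_scale in auto)
    also have "\<dots> = (\<lambda>u. \<Sum>b\<in>B. R (T b') b * R (S b) u)"
      by (intro ext sum.cong refl) (simp add: R_def grp_alg.representation_scale[OF B(2) Sb])
    finally show ?thesis by (rule fun_cong)
  qed
  then show ?thesis unfolding grp_alg_trace_eq by (simp only: R_def B_def cong: sum.cong)
qed

lemma trace_commute:
  assumes "V \<subseteq> grp_alg_carrier n" "lin_op V S" "lin_op V T"
  shows "grp_alg_trace V (\<lambda>x. S (T x)) = grp_alg_trace V (\<lambda>x. T (S x))"
  unfolding trace_comp[OF assms] trace_comp[OF assms(1,3,2)]
  by (subst sum.swap) (simp only: mult.commute)

lemma trace_scalar:
  assumes "\<And>x. x \<in> V \<Longrightarrow> T x = grp_alg_scale a x"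
  shows "grp_alg_trace V T = a * of_nat (card (trace_basis V))"
proof -
  define B where "B = trace_basis V"
  note B = trace_basis[of V, folded B_def]
  have "grp_alg.representation B (T b) b = a" if b: "b \<in> B" for b
  proof -
    have "T b = grp_alg_scale a b" using assms b B(1) by blast
    moreover have "grp_alg.representation B (grp_alg_scale a b) = (\<lambda>u. a * grp_alg.representation B b u)"
      by (rule grp_alg.representation_scale[OF B(2) grp_alg.span_base[OF b]])
    moreover have "grp_alg.representation B b b = 1"
      by (simp add: grp_alg.representation_basis[OF B(2) b])
    ultimately show ?thesis by simp
  qed
  then show ?thesis unfolding grp_alg_trace_eq B_def[symmetric] by simp
qed

lemma trace_sum:
  assumes "\<And>h x. h \<in> K \<Longrightarrow> x \<in> V \<Longrightarrow> T h x \<in> V"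
  shows "grp_alg_trace V (\<lambda>x. \<Sum>h\<in>K. T h x) = (\<Sum>h\<in>K. grp_alg_trace V (T h))"
proof -
  define B where "B = trace_basis V"
  note B = trace_basis[of V, folded B_def]
  have "grp_alg.representation B (\<Sum>h\<in>K. T h b) b = (\<Sum>h\<in>K. grp_alg.representation B (T h b) b)" if b: "b \<in> B" for b
  proof -
    have "grp_alg.representation B (\<Sum>h\<in>K. T h b) = (\<lambda>u. \<Sum>h\<in>K. grp_alg.representation B (T h b) u)"
      by (rule grp_alg.representation_sum[OF B(2)]) (use assms B b in blast)
    then show ?thesis by (rule fun_cong)
  qed
  then show ?thesis unfolding grp_alg_trace_eq B_def[symmetric]
    by (subst sum.swap) (simp only: cong: sum.cong)
qed

section \<open>The irreducible representations\<close>

abbreviation lmult :: "nat \<Rightarrow> (nat \<Rightarrow> nat) \<Rightarrow> grp_alg \<Rightarrow> grp_alg" where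
  "lmult n h \<equiv> grp_alg_mult n (grp_alg_single h)"

lemma sym_grp_invs:
  assumes "h \<in> sym_grp n" shows "inv h \<in> sym_grp n" "inv h \<circ> (h \<circ> g) = g" "h \<circ> (inv h \<circ> g) = g" "inv (inv h) = h"
proof -
  have p: "h permutes {..<n}" using assms by (simp add: sym_grp_def)
  show "inv h \<in> sym_grp n" using p by (simp add: sym_grp_def permutes_inv)
  show "inv h \<circ> (h \<circ> g) = g" "h \<circ> (inv h \<circ> g) = g"
    by (simp_all add: fun_eq_iff permutes_inverses[OF p])
  show "inv (inv h) = h" by (rule permutes_inv_inv[OF p])
qed

lemma inv_sym_grp_comp:
  assumes "h \<in> sym_grp n" "h' \<in> sym_grp n" shows "inv (h \<circ> h') = inv h' \<circ> inv h"
  using assms by (intro o_inv_distrib) (auto simp: sym_grp_def permutes_bij)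

lemma lmult_lmult:
  assumes "h \<in> sym_grp n" "h' \<in> sym_grp n"
  shows "lmult n h (lmult n h' x) = lmult n (h \<circ> h') x"
proof
  fix g
  have "inv h \<circ> g \<in> sym_grp n" if "g \<in> sym_grp n" by (rule sym_grp_comp[OF sym_grp_invs(1)[OF assms(1)] that])
  then show "lmult n h (lmult n h' x) g = lmult n (h \<circ> h') x g"
    unfolding grp_alg_single_mult[OF assms(1)] grp_alg_single_mult[OF assms(2)]
      grp_alg_single_mult[OF sym_grp_comp[OF assms]] inv_sym_grp_comp[OF assms]
    by (simp add: comp_assoc)
qed

lemma lmult_irrep:
  assumes h: "h \<in> sym_grp (sum_list \<mu>)" and v: "v \<in> irrep \<mu>"
  shows "lmult (sum_list \<mu>) h v \<in> irrep \<mu>"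
proof -
  define n where "n = sum_list \<mu>"
  define c where "c = young_symmetrizer \<mu>"
  note h = h[folded n_def]
  obtain x where x: "x \<in> grp_alg_carrier n" "v = grp_alg_mult n x c"
    using v unfolding irrep_def n_def c_def by blast
  define y where "y = lmult n h x"
  have y: "y = (\<lambda>g. if g \<in> sym_grp n then x (inv h \<circ> g) else 0)"
    unfolding y_def by (rule grp_alg_single_mult[OF h])
  have "lmult n h v = grp_alg_mult n y c"
  proof
    fix g
    show "lmult n h v g = grp_alg_mult n y c g"
    proof (cases "g \<in> sym_grp n")
      case g: True
      have hg: "inv h \<circ> g \<in> sym_grp n" by (rule sym_grp_comp[OF sym_grp_invs(1)[OF h] g])
      have "lmult n h v g = (\<Sum>s\<in>sym_grp n. x s * c (inv s \<circ> (inv h \<circ> g)))"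
        using g hg by (simp add: grp_alg_single_mult[OF h] x(2) grp_alg_mult_apply)
      also have "\<dots> = (\<Sum>s\<in>sym_grp n. x (inv h \<circ> s) * c (inv (inv h \<circ> s) \<circ> (inv h \<circ> g)))"
        by (rule sum_sym_grp_left[OF sym_grp_invs(1)[OF h], of "\<lambda>s. x s * c (inv s \<circ> (inv h \<circ> g))"])
      also have "\<dots> = (\<Sum>s\<in>sym_grp n. y s * c (inv s \<circ> g))"
      proof (rule sum.cong[OF refl])
        fix s assume s: "s \<in> sym_grp n"
        have "inv (inv h \<circ> s) \<circ> (inv h \<circ> g) = inv s \<circ> (h \<circ> (inv h \<circ> g))"
          by (simp only: inv_sym_grp_comp[OF sym_grp_invs(1)[OF h] s] sym_grp_invs(4)[OF h] comp_assoc)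
        then show "x (inv h \<circ> s) * c (inv (inv h \<circ> s) \<circ> (inv h \<circ> g)) = y s * c (inv s \<circ> g)"
          using s by (simp only: y if_True sym_grp_invs(3)[OF h])
      qed
      finally show ?thesis by (simp only: grp_alg_mult_apply[OF g])
    qed (simp add: grp_alg_mult_outside)
  qed
  moreover have "y \<in> grp_alg_carrier n"
    by (auto simp: y grp_alg_carrier_def sym_grp_def sym_grp_def)
  ultimately show ?thesis unfolding irrep_def n_def c_def by blast
qed

lemma lin_op_lmult:
  assumes "h \<in> sym_grp (sum_list \<mu>)"
  shows "lin_op (irrep \<mu>) (lmult (sum_list \<mu>) h)"
proof -
  have "lmult (sum_list \<mu>) h (\<Sum>b\<in>B. grp_alg_scale (a b) b) = (\<Sum>b\<in>B. grp_alg_scale (a b) (lmult (sum_list \<mu>) h b))" for B a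
  proof
    fix g
    show "lmult (sum_list \<mu>) h (\<Sum>b\<in>B. grp_alg_scale (a b) b) g = (\<Sum>b\<in>B. grp_alg_scale (a b) (lmult (sum_list \<mu>) h b)) g"
      unfolding grp_alg_single_mult[OF assms] sum_fun_apply grp_alg_scale_def
      by (cases "g \<in> sym_grp (sum_list \<mu>)") simp_all
  qed
  then show ?thesis using lmult_irrep[OF assms] by (auto simp: lin_op_def)
qed

lemma irrep_carrier: "irrep \<mu> \<subseteq> grp_alg_carrier (sum_list \<mu>)"
proof -
  have "grp_alg_mult (sum_list \<mu>) x c \<in> grp_alg_carrier (sum_list \<mu>)" for x c
    using grp_alg_mult_outside[of _ "sum_list \<mu>" x c] by (simp add: grp_alg_carrier_def sym_grp_def sym_grp_def)
  then show ?thesis unfolding irrep_def by blast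
qed

text \<open>Cyclicity of the trace brings \<open>u\<close> next to \<open>inv u\<close>.\<close>

lemma irr_char_conj:
  assumes "u \<in> sym_grp (sum_list \<mu>)" "c \<in> sym_grp (sum_list \<mu>)"
  shows "irr_char \<mu> (u \<circ> c \<circ> inv u) = irr_char \<mu> c"
proof -
  define n where "n = sum_list \<mu>"
  note u = assms(1)[folded n_def] and c = assms(2)[folded n_def]
  have lin: "lin_op (irrep \<mu>) (lmult n h)" if "h \<in> sym_grp n" for h
    using lin_op_lmult that unfolding n_def by blast
  have cu: "c \<circ> inv u \<in> sym_grp n" by (rule sym_grp_comp[OF c sym_grp_invs(1)[OF u]])
  have "irr_char \<mu> (u \<circ> c \<circ> inv u) = grp_alg_trace (irrep \<mu>) (\<lambda>x. lmult n u (lmult n (c \<circ> inv u) x))"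
    unfolding irr_char_def n_def[symmetric] lmult_lmult[OF u cu] comp_assoc ..
  also have "\<dots> = grp_alg_trace (irrep \<mu>) (\<lambda>x. lmult n (c \<circ> inv u) (lmult n u x))"
    by (rule trace_commute[OF irrep_carrier lin[OF u] lin[OF cu]])
  also have "\<dots> = irr_char \<mu> c"
  proof -
    have "c \<circ> inv u \<circ> u = c" using sym_grp_invs(2)[OF u, of id] by (simp add: comp_assoc)
    then show ?thesis unfolding irr_char_def n_def[symmetric] lmult_lmult[OF cu u] by simp
  qed
  finally show ?thesis .
qed

text \<open>Left multiplication by a class sum evaluates \<open>phi\<close> at
  \<open>inv s \<circ> (inv h \<circ> g)\<close>. Replacing \<open>h\<close> by its inverse
  conjugated by \<open>s\<close> moves the summation variable to the front, where
  \<open>central_sum\<close> applies.\<close>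

lemma (in tableau) phi_central_inv:
  assumes K: "finite K" "\<And>h. h \<in> K \<Longrightarrow> h \<in> sym_grp n" "\<And>h. h \<in> K \<Longrightarrow> inv h \<in> K"
    "\<And>h u. h \<in> K \<Longrightarrow> u \<in> sym_grp n \<Longrightarrow> u \<circ> h \<circ> inv u \<in> K"
    and s: "s \<in> sym_grp n" and g: "g \<in> sym_grp n"
  shows "(\<Sum>h\<in>K. phi (inv s \<circ> (inv h \<circ> g))) = (\<Sum>h\<in>K. phi h) * phi (inv s \<circ> g)"
proof -
  have "(\<Sum>h\<in>K. phi (inv s \<circ> (inv h \<circ> g))) = (\<Sum>h\<in>K. phi (h \<circ> (inv s \<circ> g)))"
  proof (rule sum.reindex_bij_witness[of _ "\<lambda>h. s \<circ> inv h \<circ> inv s" "\<lambda>h. inv s \<circ> inv h \<circ> s"])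
    fix h assume h: "h \<in> K"
    note hs = K(2)[OF h] K(2)[OF K(3)[OF h]]
    note si = sym_grp_invs(1)[OF s]
    have 1: "inv (inv s \<circ> inv h \<circ> s) = inv s \<circ> h \<circ> s"
      by (simp only: inv_sym_grp_comp[OF sym_grp_comp[OF si hs(2)] s] inv_sym_grp_comp[OF si hs(2)]
          sym_grp_invs(4)[OF s] sym_grp_invs(4)[OF hs(1)]) (simp only: comp_assoc)
    have 2: "inv (s \<circ> inv h \<circ> inv s) = s \<circ> h \<circ> inv s"
      by (simp only: inv_sym_grp_comp[OF sym_grp_comp[OF s hs(2)] si] inv_sym_grp_comp[OF s hs(2)]
          sym_grp_invs(4)[OF s] sym_grp_invs(4)[OF hs(1)]) (simp only: comp_assoc)
    have id: "inv s \<circ> s = id" "s \<circ> inv s = id"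
      using sym_grp_invs(2,3)[OF s, of id] by simp_all
    show "s \<circ> inv (inv s \<circ> inv h \<circ> s) \<circ> inv s = h"
      unfolding 1 unfolding comp_assoc sym_grp_invs(3)[OF s] by (simp only: id comp_id)
    show "inv s \<circ> inv (s \<circ> inv h \<circ> inv s) \<circ> s = h"
      unfolding 2 unfolding comp_assoc sym_grp_invs(2)[OF s] by (simp only: id comp_id)
    show "inv s \<circ> inv h \<circ> s \<in> K"
      using K(4)[OF K(3)[OF h] si] by (simp only: sym_grp_invs(4)[OF s])
    show "s \<circ> inv h \<circ> inv s \<in> K" by (rule K(4)[OF K(3)[OF h] s])
    show "phi (inv s \<circ> inv h \<circ> s \<circ> (inv s \<circ> g)) = phi (inv s \<circ> (inv h \<circ> g))"
      unfolding comp_assoc sym_grp_invs(3)[OF s] ..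
  qed
  also have "\<dots> = (\<Sum>h\<in>K. phi h) * phi (inv s \<circ> g)"
  proof (rule central_sum[OF K(1,2) _ sym_grp_comp[OF sym_grp_invs(1)[OF s] g], of "\<lambda>h. h"])
    fix p assume p: "p \<in> sym_grp n"
    note pi = sym_grp_invs(1)[OF p]
    have "bij_betw (\<lambda>h. inv p \<circ> h \<circ> p) K K"
    proof (rule bij_betw_byWitness[where f' = "\<lambda>h. p \<circ> h \<circ> inv p"])
      have id: "inv p \<circ> p = id" "p \<circ> inv p = id"
        using sym_grp_invs(2,3)[OF p, of id] by simp_all
      show "\<forall>h\<in>K. p \<circ> (inv p \<circ> h \<circ> p) \<circ> inv p = h" "\<forall>h\<in>K. inv p \<circ> (p \<circ> h \<circ> inv p) \<circ> p = h"
        unfolding comp_assoc sym_grp_invs(2)[OF p] sym_grp_invs(3)[OF p] by (simp_all only: id comp_id) blast+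
      show "(\<lambda>h. inv p \<circ> h \<circ> p) ` K \<subseteq> K"
        using K(4)[OF _ pi] by (auto simp: sym_grp_invs(4)[OF p])
      show "(\<lambda>h. p \<circ> h \<circ> inv p) ` K \<subseteq> K" using K(4)[OF _ p] by auto
    qed
    moreover have "h \<circ> p = p \<circ> (inv p \<circ> h \<circ> p)" for h
      unfolding comp_assoc sym_grp_invs(3)[OF p] ..
    ultimately show "\<exists>\<beta>. bij_betw \<beta> K K \<and> (\<forall>h\<in>K. h \<circ> p = p \<circ> \<beta> h)" by blast
  qed
  finally show ?thesis .
qed

text \<open>Every vector is a left multiple of the symmetrizer, so the class sum acts by the scalar
  of \<open>phi_central_inv\<close>, and its trace is this scalar times the dimension. The dimension
  is nonzero because the symmetrizer lies in the representation and has coefficient 1 at the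
  identity.\<close>

lemma class_sum_char:
  assumes \<mu>: "is_partition \<mu>"
    and K: "finite K" "\<And>h. h \<in> K \<Longrightarrow> h \<in> sym_grp (sum_list \<mu>)" "\<And>h. h \<in> K \<Longrightarrow> inv h \<in> K"
    "\<And>h u. h \<in> K \<Longrightarrow> u \<in> sym_grp (sum_list \<mu>) \<Longrightarrow> u \<circ> h \<circ> inv u \<in> K"
  shows "(\<Sum>h\<in>K. irr_char \<mu> h)
    = of_int (\<Sum>h\<in>K. tableau.phi (sum_list \<mu>) (\<lambda>x. fst (box \<mu> x)) (\<lambda>x. snd (box \<mu> x)) h) * irr_char \<mu> id"
    and "irr_char \<mu> id \<noteq> 0"
proof -
  define n where "n = sum_list \<mu>"
  interpret tableau n "\<lambda>x. fst (box \<mu> x)" "\<lambda>x. snd (box \<mu> x)"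
    unfolding n_def by (rule tableau_box[OF \<mu>])
  note K = K[folded n_def]
  define V where "V = irrep \<mu>"
  have V: "V \<subseteq> grp_alg_carrier n" unfolding V_def n_def by (rule irrep_carrier)
  have c: "young_symmetrizer \<mu> g = of_int (phi g)" for g
    unfolding n_def by (rule young_symmetrizer_eq[OF \<mu>])
  have id: "id \<in> sym_grp n" unfolding sym_grp_def by (simp only: mem_Collect_eq permutes_id)
  have inv_id: "inv id = (id :: nat \<Rightarrow> nat)" by simp
  have outside: "x g = 0" if "x \<in> V" "g \<notin> sym_grp n" for x g
    using V that by (auto simp: grp_alg_carrier_def sym_grp_def sym_grp_def)
  have "irr_char \<mu> id = 1 * of_nat (card (trace_basis V))"
    unfolding irr_char_def n_def[symmetric] V_def[symmetric]
  proof (rule trace_scalar)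
    fix x assume "x \<in> V"
    then show "lmult n id x = grp_alg_scale 1 x"
      using outside by (auto simp: grp_alg_single_mult[OF id] grp_alg_scale_def)
  qed
  then have dim: "irr_char \<mu> id = of_nat (card (trace_basis V))" by simp
  have "grp_alg_trace V (\<lambda>x. \<Sum>h\<in>K. lmult n h x) = of_int (\<Sum>h\<in>K. phi h) * of_nat (card (trace_basis V))"
  proof (rule trace_scalar)
    fix v assume v: "v \<in> V"
    then obtain x where x: "v = grp_alg_mult n x (young_symmetrizer \<mu>)" unfolding V_def irrep_def n_def by blast
    show "(\<Sum>h\<in>K. lmult n h v) = grp_alg_scale (of_int (\<Sum>h\<in>K. phi h)) v"
    proof
      fix g
      show "(\<Sum>h\<in>K. lmult n h v) g = grp_alg_scale (of_int (\<Sum>h\<in>K. phi h)) v g"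
      proof (cases "g \<in> sym_grp n")
        case g: True
        have "(\<Sum>h\<in>K. lmult n h v) g = (\<Sum>h\<in>K. \<Sum>s\<in>sym_grp n. x s * of_int (phi (inv s \<circ> (inv h \<circ> g))))"
          unfolding sum_fun_apply
        proof (rule sum.cong[OF refl])
          fix h assume h: "h \<in> K"
          have hg: "inv h \<circ> g \<in> sym_grp n" by (rule sym_grp_comp[OF sym_grp_invs(1)[OF K(2)[OF h]] g])
          show "lmult n h v g = (\<Sum>s\<in>sym_grp n. x s * of_int (phi (inv s \<circ> (inv h \<circ> g))))"
            unfolding grp_alg_single_mult[OF K(2)[OF h]] x grp_alg_mult_apply[OF hg] c using g by simp
        qed
        also have "\<dots> = (\<Sum>s\<in>sym_grp n. x s * of_int (\<Sum>h\<in>K. phi (inv s \<circ> (inv h \<circ> g))))"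
          unfolding of_int_sum sum_distrib_left by (rule sum.swap)
        also have "\<dots> = (\<Sum>s\<in>sym_grp n. of_int (\<Sum>h\<in>K. phi h) * (x s * of_int (phi (inv s \<circ> g))))"
        proof (rule sum.cong[OF refl])
          fix s assume s: "s \<in> sym_grp n"
          have "(\<Sum>h\<in>K. phi (inv s \<circ> (inv h \<circ> g))) = (\<Sum>h\<in>K. phi h) * phi (inv s \<circ> g)"
            by (rule phi_central_inv[OF K s g])
          then show "x s * of_int (\<Sum>h\<in>K. phi (inv s \<circ> (inv h \<circ> g))) = of_int (\<Sum>h\<in>K. phi h) * (x s * of_int (phi (inv s \<circ> g)))"
            by (simp only: of_int_mult mult.left_commute)
        qed
        also have "\<dots> = grp_alg_scale (of_int (\<Sum>h\<in>K. phi h)) v g"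
          unfolding grp_alg_scale_def x grp_alg_mult_apply[OF g] c sum_distrib_left ..
        finally show ?thesis .
      next
        case False
        then show ?thesis using outside[OF v False]
          by (simp add: sum_fun_apply grp_alg_mult_outside grp_alg_scale_def)
      qed
    qed
  qed
  moreover have "grp_alg_trace V (\<lambda>x. \<Sum>h\<in>K. lmult n h x) = (\<Sum>h\<in>K. irr_char \<mu> h)"
    unfolding irr_char_def n_def[symmetric] V_def[symmetric]
  proof (rule trace_sum)
    fix h x assume "h \<in> K" "x \<in> V"
    then show "lmult n h x \<in> V" using lmult_irrep K(2) unfolding V_def n_def by blast
  qed
  ultimately show "(\<Sum>h\<in>K. irr_char \<mu> h)
    = of_int (\<Sum>h\<in>K. tableau.phi (sum_list \<mu>) (\<lambda>x. fst (box \<mu> x)) (\<lambda>x. snd (box \<mu> x)) h) * irr_char \<mu> id"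
    unfolding dim n_def by (simp only:)
  have "grp_alg_mult n (grp_alg_single id) (young_symmetrizer \<mu>) \<in> V"
    unfolding V_def irrep_def n_def[symmetric]
  proof (rule imageI)
    have "id \<in> sym_grp n" using id unfolding sym_grp_def sym_grp_def .
    then show "grp_alg_single id \<in> grp_alg_carrier n"
      unfolding grp_alg_carrier_def grp_alg_single_def by auto
  qed
  moreover have "grp_alg_mult n (grp_alg_single id) (young_symmetrizer \<mu>) id = 1"
    by (simp add: grp_alg_single_mult[OF id] id c phi_id)
  ultimately have "\<not> V \<subseteq> {0}" by force
  then have "trace_basis V \<noteq> {}" using trace_basis(3)[of V] by auto
  then show "irr_char \<mu> id \<noteq> 0" unfolding dim using finite_trace_basis[OF V] by simp
qed

text \<open>The character is constant on the class, so class size times character is a class sum,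
  evaluated by \<open>class_sum_char\<close> and \<open>cycle_sum_eq_frob\<close>; for
  \<open>n < k\<close> both sides vanish. Taking one variable more than the size keeps their number
  positive for the empty partition.\<close>

lemma f_fun_eq_frob:
  assumes \<mu>: "is_partition \<mu>" and k: "2 \<le> k"
  shows "f_fun k \<mu> = frob k (Suc (sum_list \<mu>)) (\<lambda>j. of_nat (part \<mu> (Suc j) + (Suc (sum_list \<mu>) - 1 - j)))"
proof -
  define n where "n = sum_list \<mu>"
  interpret tableau n "\<lambda>x. fst (box \<mu> x)" "\<lambda>x. snd (box \<mu> x)"
    unfolding n_def by (rule tableau_box[OF \<mu>])
  have lam: "lam j = part \<mu> (Suc j)" for j unfolding lam_def by (rule card_row[of \<mu> j, folded n_def])
  have "f_fun k \<mu> = frob k (Suc n) (\<lambda>j. of_nat (lam j + (Suc n - 1 - j)))"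
  proof (cases "n < k")
    case True
    then have "f_fun k \<mu> = 0" by (simp add: f_fun_def n_def)
    then show ?thesis using frob_zero[OF le_SucI[OF order_refl] True] by (simp only:)
  next
    case False
    then have kn: "1 \<le> k" "k \<le> n" using k by simp_all
    define c where "c = cycle_of_list [0..<k]"
    define K where "K = cycle_perms n k"
    have K_class: "conj_class n c = K" unfolding c_def K_def by (rule conj_class_cycle[OF kn])
    have sub: "K \<subseteq> sym_grp n" unfolding K_def cycle_perms_def by blast
    then have "finite K" using finite_sym_grp finite_subset by blast
    moreover have "inv h \<in> K" if "h \<in> K" for h using that unfolding K_def by (rule cycle_perms_inv)
    moreover have "u \<circ> h \<circ> inv u \<in> K" if "h \<in> K" "u \<in> sym_grp n" for h u
      using that unfolding K_def by (rule cycle_perms_conj[OF _ _ kn])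
    ultimately have K: "finite K" "\<And>h. h \<in> K \<Longrightarrow> h \<in> sym_grp n" "\<And>h. h \<in> K \<Longrightarrow> inv h \<in> K"
      "\<And>h u. h \<in> K \<Longrightarrow> u \<in> sym_grp n \<Longrightarrow> u \<circ> h \<circ> inv u \<in> K"
      using sub by blast+
    note char = class_sum_char[OF \<mu> K[unfolded n_def], folded n_def]
    have c: "c \<in> sym_grp n"
      unfolding c_def sym_grp_def using cycle_permutes[of "[0..<k]"] kn by (auto intro: permutes_subset)
    have "irr_char \<mu> h = irr_char \<mu> c" if hK: "h \<in> K" for h
    proof -
      have "h \<in> conj_class n c" unfolding K_class by (rule hK)
      then obtain u where "u \<in> sym_grp n" "h = u \<circ> c \<circ> inv u"
        unfolding conj_class_def sym_grp_def sym_grp_def by blast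
      then show ?thesis using irr_char_conj[of u \<mu> c] c unfolding n_def by (simp only:)
    qed
    then have "(\<Sum>h\<in>K. irr_char \<mu> h) = of_nat (card K) * irr_char \<mu> c" by simp
    then have "of_nat (card K) * irr_char \<mu> c = of_int (\<Sum>h\<in>K. phi h) * irr_char \<mu> id"
      using char(1) by (simp only:)
    then have "f_fun k \<mu> = of_int (\<Sum>h\<in>K. phi h)"
      using char(2) False by (simp add: f_fun_def Let_def n_def[symmetric] c_def[symmetric] K_class)
    also have "\<dots> = frob k (Suc n) (\<lambda>j. of_nat (lam j + (Suc n - 1 - j)))"
      unfolding K_def by (rule cycle_sum_eq_frob[OF le_SucI[OF order_refl] k kn(2)])
    finally show ?thesis .
  qed
  then show ?thesis unfolding lam unfolding n_def .
qed

lemma length_le_sum_list: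
  assumes "is_partition \<mu>" shows "length \<mu> \<le> sum_list \<mu>"
proof -
  have "length \<mu> \<le> sum_list \<mu>" if "\<forall>a\<in>set \<mu>. 1 \<le> a" for \<mu> :: "nat list"
    using that by (induction \<mu>) auto
  then show ?thesis using assms by (simp add: is_partition_def)
qed

theorem theorem5p5:
  fixes k :: nat
  assumes "k \<ge> 2"
  shows "\<exists>c :: nat list \<Rightarrow> complex. \<forall>\<mu>. is_partition \<mu> \<longrightarrow>
    f_fun k \<mu> =
      1 / of_nat k *
        (\<Sum>\<rho> | is_partition \<rho> \<and> weight \<rho> = k + 1.
           (- of_nat k) ^ (length \<rho> - 1) / of_nat (mult_fact \<rho>) * p_prod \<rho> \<mu>)
      + (\<Sum>\<eta> | is_partition \<eta> \<and> weight \<eta> < k + 1. c \<eta> * p_prod \<eta> \<mu>)"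
proof -
  have "1 \<le> k" using assms by simp
  \<comment> \<open>The coefficients are obtained before any partition is fixed, so they serve all
    partitions although the number of variables varies with the partition.\<close>
  from frob_expansion[OF this] obtain c where c: "\<forall>\<mu> N. is_partition \<mu> \<longrightarrow> length \<mu> \<le> N \<longrightarrow> 0 < N \<longrightarrow>
    frob k N (\<lambda>j. of_nat (part \<mu> (Suc j) + (N - 1 - j))) =
      1 / of_nat k *
        (\<Sum>\<rho> | is_partition \<rho> \<and> weight \<rho> = k + 1.
           (- of_nat k) ^ (length \<rho> - 1) / of_nat (mult_fact \<rho>) * p_prod \<rho> \<mu>)
      + (\<Sum>\<eta> | is_partition \<eta> \<and> weight \<eta> < k + 1. c \<eta> * p_prod \<eta> \<mu>)" ..
  show ?thesis
  proof (rule exI[of _ c], intro allI impI)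
    fix \<mu> assume \<mu>: "is_partition \<mu>"
    have "length \<mu> \<le> Suc (sum_list \<mu>)" using length_le_sum_list[OF \<mu>] by simp
    from c[rule_format, OF \<mu> this zero_less_Suc] show "f_fun k \<mu> =
      1 / of_nat k *
        (\<Sum>\<rho> | is_partition \<rho> \<and> weight \<rho> = k + 1.
           (- of_nat k) ^ (length \<rho> - 1) / of_nat (mult_fact \<rho>) * p_prod \<rho> \<mu>)
      + (\<Sum>\<eta> | is_partition \<eta> \<and> weight \<eta> < k + 1. c \<eta> * p_prod \<eta> \<mu>)"
      by (simp only: f_fun_eq_frob[OF \<mu> assms])
  qed
qed

end
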